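(* Assume that $M$ is a Polish space and that the semigroup envelope $\mathscr{S}$ is continuous from above on $\mathrm{Lip}_{\rm b}$. Then there exists a quadruple $(\Omega,\mathcal{F},(\mathcal{E}^x)_{x\in M},(X_t)_{t\ge0})$ such that (i) $X_t\colon\Omega\to M$ is $\mathcal{F}$-$\mathcal{B}$-measurable for all $t\ge0$; (ii) $(\Omega,\mathcal{F},\mathcal{E}^x)$ is a sublinear expectation space with $\mathcal{E}^x(u(X_0))=u(x)$ for all $x\in M$ and $u\in\mathrm{C}_{\rm b}$; (iii) for all $x\in M$, $0\le s<t$, $n\in\mathbb{N}$, $0\le t_1<\dots<t_n\le s$ and $v\in\mathrm{C}_{\rm b}(M^{n+1})$, $$\mathcal{E}^x\big(v(X_{t_1},\dots,X_{t_n},X_t)\big)=\mathcal{E}^x\Big(\big(\mathscr{S}(t-s)v(X_{t_1},\dots,X_{t_n},\,\cdot\,)\big)(X_s)\Big).$$ In particular, $(\mathscr{S}(t)u)(x)=\mathcal{E}^x(u(X_t))$ for all $t\ge0$, $x\in M$ and $u\in\mathrm{C}_{\rm b}$.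
   Context: Setting: $\Lambda$ is a nonempty set, $(M,d)$ is a separable metric space with Borel $\sigma$-algebra $\mathcal{B}$, and $\kappa\colon M\to(0,\infty)$ is continuous and bounded. $\|u\|_\infty=\sup_{x\in M}|u(x)|$; $\|u\|_\kappa=\|\kappa u\|_\infty$; $\|u\|_{\mathrm{Lip}}=\inf\{L\ge 0: |u(x)-u(y)|\le L d(x,y)\ \forall x,y\in M\}$. $\mathrm{C}_{\rm b}=\mathrm{C}_{\rm b}(M)$ (resp. $\mathrm{C}_{\rm b}(M^{n+1})$) is the space of bounded continuous real functions on $M$ (resp. $M^{n+1}$); $\mathrm{C}_\kappa$ is the space of continuous $u\colon M\to\mathbb{R}$ with $\|u\|_\kappa<\infty$; $\mathrm{Lip}_{\rm b}$ is the space of bounded Lipschitz functions $M\to\mathbb{R}$; $\mathrm{UC}_\kappa$ is the closure of $\mathrm{Lip}_{\rm b}$ in $(\mathrm{C}_\kappa,\|\cdot\|_\kappa)$. Order between functions is pointwise; $u_n\nearrow u$ (resp. $u_n\searrow u$) means pointwise nondecreasing (resp. nonincreasing) pointwise convergence. A Feller semigroup is a family $T=(T(t))_{t\ge0}$ of possibly nonlinear operators such that (i) $T(t)\colon\mathrm{UC}_\kappa\to\mathrm{UC}_\kappa$ is ($\|\cdot\|_\kappa$-)continuous for all $t\ge 0$; (ii) $T(0)u=u$ and $T(s+t)u=T(s)T(t)u$ for all $s,t\ge0$, $u\in\mathrm{UC}_\kappa$; (iii) each $T(t)$ is monotone and continuous from below, i.e. $u_n\nearrow u$ in $\mathrm{UC}_\kappa$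 implies $T(t)u_n\nearrow T(t)u$. Standing assumptions: (A1) for every $\lambda\in\Lambda$, $S_\lambda=(S_\lambda(t))_{t\ge0}$ is a Feller semigroup of linear operators with $S_\lambda(t)1=1$ for all $t\geq 0$; (A2) there are $\alpha,\beta\in\mathbb{R}$ with $\|S_\lambda(t)u\|_\kappa\le e^{\alpha t}\|u\|_\kappa$ and $\|S_\lambda(t)u\|_{\mathrm{Lip}}\le e^{\beta t}\|u\|_{\mathrm{Lip}}$ for all $u\in\mathrm{Lip}_{\rm b}$, $\lambda\in\Lambda$, $t\ge0$. For $h\ge0$, $u\in\mathrm{UC}_\kappa$: $(\mathcal{E}_hu)(x)=\sup_{\lambda\in\Lambda}(S_\lambda(h)u)(x)$; $\mathcal{E}_h$ maps $\mathrm{UC}_\kappa$ to itself. $P$ is the set of finite subsets $\pi\subset[0,\infty)$ with $0\in\pi$, and $P_t=\{\pi\in P:\max\pi=t\}$. For $\pi=\{t_0,\dots,t_m\}$ with $0=t_0<t_1<\dots<t_m$, $m\ge 1$, $\mathcal{E}_\pi u=\mathcal{E}_{t_1-t_0}\cdots\mathcal{E}_{t_m-t_{m-1}}u$ (composition), and $\mathcal{E}_{\{0\}}u=u$. The semigroup envelope $\mathscr{S}=(\mathscr{S}(t))_{t\ge0}$ is $(\mathscr{S}(t)u)(x)=\sup_{\pi\in P_t}(\mathcal{E}_\pi u)(x)$ for $u\in\mathrm{UC}_\kappa$; it is a Feller semigroup of sublinear operators (i.e. $\mathscr{S}(t)(u+v)\le\mathscr{S}(t)u+\mathscr{S}(t)v$,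 $\mathscr{S}(t)(cu)=c\,\mathscr{S}(t)u$ for $c>0$) and maps $\mathrm{Lip}_{\rm b}$ to itself. For a linear space $L\subset\mathrm{UC}_\kappa$, $\mathscr{S}$ is continuous from above on $L$ if $\mathscr{S}(t)u_n\searrow0$ for all $t\ge0$ and all $(u_n)_{n\in\mathbb{N}}\subset L$ with $u_n\searrow0$. If $\mathscr{S}$ is continuous from above on $\mathrm{Lip}_{\rm b}$, then each $\mathscr{S}(t)|_{\mathrm{Lip}_{\rm b}}$ extends uniquely to a (sublinear, monotone) operator $\mathscr{S}(t)\colon\mathrm{C}_{\rm b}\to\mathrm{C}_{\rm b}$ that is again continuous from above, and for $v\in\mathrm{C}_{\rm b}(M^{n+1})$ the map $(x_1,\dots,x_n,x_{n+1})\mapsto(\mathscr{S}(t)v(x_1,\dots,x_n,\,\cdot\,))(x_{n+1})$ is bounded and continuous. In the claim, $\mathscr{S}(t)$ on $\mathrm{C}_{\rm b}$ denotes this extension. Sublinear expectations: for a measurable space $(\Omega,\mathcal{F})$, $\mathcal{L}^\infty(\Omega,\mathcal{F})$ is the space of bounded $\mathcal{F}$-measurable functions $\Omega\to\mathbb{R}$, ordered pointwise. A functional $\mathcal{E}\colon\mathcal{L}^\infty(\Omega,\mathcal{F})\to\mathbb{R}$ is a sublinear expectation if $\mathcal{E}(X)\le\mathcal{E}(Y)$ for $X\le Y$, $\mathcal{E}(a)=a$ for constants $a\in\mathbb{R}$, $\mathcal{E}(X+Y)\le\mathcal{E}(X)+\mathcal{E}(Y)$ and $\mathcal{E}(cX)=c\,\mathcal{E}(X)$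 for $c>0$. $(\Omega,\mathcal{F},\mathcal{E})$ is a sublinear expectation space if there is a set $\mathcal{P}$ of probability measures on $(\Omega,\mathcal{F})$ with $\mathcal{E}(X)=\sup_{\mathbb{P}\in\mathcal{P}}\mathbb{E}_{\mathbb{P}}(X)$ for all $X\in\mathcal{L}^\infty(\Omega,\mathcal{F})$. *)

theory Defs
  imports "HOL-Probability.Probability"
begin

section \<open>Function spaces\<close>

text \<open>The state space is a type of class metric_space and second_countable_topology; for metric
  spaces the latter is separability. Norms take values in the extended reals, so that they are
  infinite where the mathematical norm is.\<close>

definition sup_norm :: "('a \<Rightarrow> real) \<Rightarrow> ereal" where
  "sup_norm u = (SUP x. ereal \<bar>u x\<bar>)"

definition kappa_norm :: "('a \<Rightarrow> real) \<Rightarrow> ('a \<Rightarrow> real) \<Rightarrow> ereal" where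
  "kappa_norm \<kappa> u = sup_norm (\<lambda>x. \<kappa> x * u x)"

definition lip_norm :: "('a::metric_space \<Rightarrow> real) \<Rightarrow> ereal" where
  "lip_norm u = Inf (ereal ` {L. L-lipschitz_on UNIV u})"

definition Cb :: "('a::metric_space \<Rightarrow> real) set" where
  "Cb = {u. continuous_on UNIV u \<and> bounded (range u)}"

text \<open>Points of the power \<open>M\<^sup>k\<close> are the functions in \<open>{1..k} \<rightarrow>\<^sub>E UNIV\<close>, i.e. those equal to
  \<open>undefined\<close> outside \<open>{1..k}\<close>.\<close>

definition Cb_power :: "nat \<Rightarrow> ((nat \<Rightarrow> 'a::metric_space) \<Rightarrow> real) set" where
  "Cb_power k = {v. continuous_map (product_topology (\<lambda>_. euclidean) {1..k}) euclideanreal v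
                    \<and> bounded (v ` ({1..k} \<rightarrow>\<^sub>E UNIV))}"

definition C_kappa :: "('a::metric_space \<Rightarrow> real) \<Rightarrow> ('a \<Rightarrow> real) set" where
  "C_kappa \<kappa> = {u. continuous_on UNIV u \<and> kappa_norm \<kappa> u < \<infinity>}"

definition Lip_b :: "('a::metric_space \<Rightarrow> real) set" where
  "Lip_b = {u. bounded (range u) \<and> (\<exists>L. L-lipschitz_on UNIV u)}"

definition UC_kappa :: "('a::metric_space \<Rightarrow> real) \<Rightarrow> ('a \<Rightarrow> real) set" where
  "UC_kappa \<kappa> = {u \<in> C_kappa \<kappa>. \<forall>\<epsilon>>0. \<exists>w\<in>Lip_b. kappa_norm \<kappa> (\<lambda>x. u x - w x) < ereal \<epsilon>}"

section \<open>Monotone convergence and operators\<close>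

definition increases_to :: "(nat \<Rightarrow> 'a \<Rightarrow> real) \<Rightarrow> ('a \<Rightarrow> real) \<Rightarrow> bool" where
  "increases_to us u \<longleftrightarrow> (\<forall>x. incseq (\<lambda>n. us n x) \<and> (\<lambda>n. us n x) \<longlonglongrightarrow> u x)"

definition decreases_to :: "(nat \<Rightarrow> 'a \<Rightarrow> real) \<Rightarrow> ('a \<Rightarrow> real) \<Rightarrow> bool" where
  "decreases_to us u \<longleftrightarrow> (\<forall>x. decseq (\<lambda>n. us n x) \<and> (\<lambda>n. us n x) \<longlonglongrightarrow> u x)"

text \<open>Operators are total functions on \<open>'a \<Rightarrow> real\<close>; all properties are relative to a space \<open>D\<close>
  of functions on which the operator is meaningful.\<close>

definition monotone_op :: "('a \<Rightarrow> real) set \<Rightarrow> (('a \<Rightarrow> real) \<Rightarrow> 'a \<Rightarrow> real) \<Rightarrow> bool" where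
  "monotone_op D T \<longleftrightarrow> (\<forall>u\<in>D. \<forall>v\<in>D. (\<forall>x. u x \<le> v x) \<longrightarrow> (\<forall>x. T u x \<le> T v x))"

definition linear_op :: "('a \<Rightarrow> real) set \<Rightarrow> (('a \<Rightarrow> real) \<Rightarrow> 'a \<Rightarrow> real) \<Rightarrow> bool" where
  "linear_op D T \<longleftrightarrow>
     (\<forall>u\<in>D. \<forall>v\<in>D. \<forall>x. T (\<lambda>y. u y + v y) x = T u x + T v x) \<and>
     (\<forall>u\<in>D. \<forall>c. \<forall>x. T (\<lambda>y. c * u y) x = c * T u x)"

definition sublinear_op :: "('a \<Rightarrow> real) set \<Rightarrow> (('a \<Rightarrow> real) \<Rightarrow> 'a \<Rightarrow> real) \<Rightarrow> bool" where
  "sublinear_op D T \<longleftrightarrow>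
     (\<forall>u\<in>D. \<forall>v\<in>D. \<forall>x. T (\<lambda>y. u y + v y) x \<le> T u x + T v x) \<and>
     (\<forall>u\<in>D. \<forall>c>0. \<forall>x. T (\<lambda>y. c * u y) x = c * T u x)"

definition continuous_from_below_op ::
    "('a \<Rightarrow> real) set \<Rightarrow> (('a \<Rightarrow> real) \<Rightarrow> 'a \<Rightarrow> real) \<Rightarrow> bool" where
  "continuous_from_below_op D T \<longleftrightarrow>
     (\<forall>us u. (\<forall>n. us n \<in> D) \<and> u \<in> D \<and> increases_to us u \<longrightarrow> increases_to (\<lambda>n. T (us n)) (T u))"

definition continuous_from_above_op ::
    "('a \<Rightarrow> real) set \<Rightarrow> (('a \<Rightarrow> real) \<Rightarrow> 'a \<Rightarrow> real) \<Rightarrow> bool" where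
  "continuous_from_above_op D T \<longleftrightarrow>
     (\<forall>us. (\<forall>n. us n \<in> D) \<and> decreases_to us (\<lambda>_. 0) \<longrightarrow> decreases_to (\<lambda>n. T (us n)) (\<lambda>_. 0))"

definition continuous_from_above ::
    "('a \<Rightarrow> real) set \<Rightarrow> (real \<Rightarrow> ('a \<Rightarrow> real) \<Rightarrow> 'a \<Rightarrow> real) \<Rightarrow> bool" where
  "continuous_from_above D T \<longleftrightarrow> (\<forall>t\<ge>0. continuous_from_above_op D (T t))"

definition kappa_continuous_op ::
    "('a::metric_space \<Rightarrow> real) \<Rightarrow> (('a \<Rightarrow> real) \<Rightarrow> 'a \<Rightarrow> real) \<Rightarrow> bool" where
  "kappa_continuous_op \<kappa> T \<longleftrightarrow>
     (\<forall>u\<in>UC_kappa \<kappa>. \<forall>\<epsilon>>0. \<exists>\<delta>>0. \<forall>v\<in>UC_kappa \<kappa>.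
        kappa_norm \<kappa> (\<lambda>x. v x - u x) < ereal \<delta> \<longrightarrow>
        kappa_norm \<kappa> (\<lambda>x. T v x - T u x) < ereal \<epsilon>)"

definition feller_semigroup ::
    "('a::metric_space \<Rightarrow> real) \<Rightarrow> (real \<Rightarrow> ('a \<Rightarrow> real) \<Rightarrow> 'a \<Rightarrow> real) \<Rightarrow> bool" where
  "feller_semigroup \<kappa> T \<longleftrightarrow>
     (\<forall>t\<ge>0. T t \<in> UC_kappa \<kappa> \<rightarrow> UC_kappa \<kappa> \<and> kappa_continuous_op \<kappa> (T t)) \<and>
     (\<forall>u\<in>UC_kappa \<kappa>. T 0 u = u) \<and>
     (\<forall>s\<ge>0. \<forall>t\<ge>0. \<forall>u\<in>UC_kappa \<kappa>. T (s + t) u = T s (T t u)) \<and>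
     (\<forall>t\<ge>0. monotone_op (UC_kappa \<kappa>) (T t) \<and> continuous_from_below_op (UC_kappa \<kappa>) (T t))"

section \<open>The semigroup envelope\<close>

text \<open>The suprema below are suprema of reals. They are used only for functions in \<open>UC_kappa \<kappa>\<close>,
  where the uniform bounds on the semigroups make the sets bounded.\<close>

definition step_op ::
    "'l set \<Rightarrow> ('l \<Rightarrow> real \<Rightarrow> ('a \<Rightarrow> real) \<Rightarrow> 'a \<Rightarrow> real) \<Rightarrow> real \<Rightarrow> ('a \<Rightarrow> real) \<Rightarrow> 'a \<Rightarrow> real" where
  "step_op \<Lambda> S h u x = (SUP l\<in>\<Lambda>. S l h u x)"

definition partitions :: "real \<Rightarrow> real set set" where
  "partitions t = {\<pi>. finite \<pi> \<and> \<pi> \<subseteq> {0..} \<and> 0 \<in> \<pi> \<and> Max \<pi> = t}"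

text \<open>\<open>chain_op \<Lambda> S [t\<^sub>0, \<dots>, t\<^sub>m]\<close> is the composition of the step operators with lengths
  \<open>t\<^sub>1 - t\<^sub>0, \<dots>, t\<^sub>m - t\<^sub>m\<^sub>-\<^sub>1\<close>, the last one being applied first.\<close>

fun chain_op ::
    "'l set \<Rightarrow> ('l \<Rightarrow> real \<Rightarrow> ('a \<Rightarrow> real) \<Rightarrow> 'a \<Rightarrow> real) \<Rightarrow> real list \<Rightarrow> ('a \<Rightarrow> real) \<Rightarrow> 'a \<Rightarrow> real" where
  "chain_op \<Lambda> S [] u = u"
| "chain_op \<Lambda> S [s] u = u"
| "chain_op \<Lambda> S (s # t # ts) u = step_op \<Lambda> S (t - s) (chain_op \<Lambda> S (t # ts) u)"

definition partition_op ::
    "'l set \<Rightarrow> ('l \<Rightarrow> real \<Rightarrow> ('a \<Rightarrow> real) \<Rightarrow> 'a \<Rightarrow> real) \<Rightarrow> real set \<Rightarrow> ('a \<Rightarrow> real) \<Rightarrow> 'a \<Rightarrow> real" where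
  "partition_op \<Lambda> S \<pi> = chain_op \<Lambda> S (sorted_list_of_set \<pi>)"

definition envelope ::
    "'l set \<Rightarrow> ('l \<Rightarrow> real \<Rightarrow> ('a \<Rightarrow> real) \<Rightarrow> 'a \<Rightarrow> real) \<Rightarrow> real \<Rightarrow> ('a \<Rightarrow> real) \<Rightarrow> 'a \<Rightarrow> real" where
  "envelope \<Lambda> S t u x = (SUP \<pi>\<in>partitions t. partition_op \<Lambda> S \<pi> u x)"

text \<open>The extension of an operator from \<open>Lip_b\<close> to \<open>Cb\<close>. Extensionality (\<open>\<rightarrow>\<^sub>E\<close>) fixes the value of
  the extension outside \<open>Cb\<close>, so that a unique operator on \<open>Cb\<close> is a unique HOL function. The
  description is informative only if such an extension exists and is unique.\<close>

definition Cb_extension ::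
    "(('a::metric_space \<Rightarrow> real) \<Rightarrow> 'a \<Rightarrow> real) \<Rightarrow> ('a \<Rightarrow> real) \<Rightarrow> 'a \<Rightarrow> real" where
  "Cb_extension A = (THE T. T \<in> Cb \<rightarrow>\<^sub>E Cb \<and> (\<forall>u\<in>Lip_b. T u = A u) \<and>
      sublinear_op Cb T \<and> monotone_op Cb T \<and> continuous_from_above_op Cb T)"

section \<open>Sublinear expectations\<close>

text \<open>Of the measure \<open>\<Omega>\<close> only the measurable space (\<open>space \<Omega>\<close>, \<open>sets \<Omega>\<close>) is relevant. Functions on
  \<open>space \<Omega>\<close> are represented by functions on the whole type.\<close>

definition L_infty :: "'w measure \<Rightarrow> ('w \<Rightarrow> real) set" where
  "L_infty \<Omega> = {X \<in> borel_measurable \<Omega>. bounded (X ` space \<Omega>)}"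

definition sublinear_expectation :: "'w measure \<Rightarrow> (('w \<Rightarrow> real) \<Rightarrow> real) \<Rightarrow> bool" where
  "sublinear_expectation \<Omega> E \<longleftrightarrow>
     (\<forall>X\<in>L_infty \<Omega>. \<forall>Y\<in>L_infty \<Omega>. (\<forall>\<omega>\<in>space \<Omega>. X \<omega> \<le> Y \<omega>) \<longrightarrow> E X \<le> E Y) \<and>
     (\<forall>a. E (\<lambda>_. a) = a) \<and>
     (\<forall>X\<in>L_infty \<Omega>. \<forall>Y\<in>L_infty \<Omega>. E (\<lambda>\<omega>. X \<omega> + Y \<omega>) \<le> E X + E Y) \<and>
     (\<forall>X\<in>L_infty \<Omega>. \<forall>c>0. E (\<lambda>\<omega>. c * X \<omega>) = c * E X)"

definition sublinear_expectation_space :: "'w measure \<Rightarrow> (('w \<Rightarrow> real) \<Rightarrow> real) \<Rightarrow> bool" where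
  "sublinear_expectation_space \<Omega> E \<longleftrightarrow>
     sublinear_expectation \<Omega> E \<and>
     (\<exists>P. P \<noteq> {} \<and> (\<forall>p\<in>P. prob_space p \<and> sets p = sets \<Omega>) \<and>
          (\<forall>X\<in>L_infty \<Omega>. E X = (SUP p\<in>P. integral\<^sup>L p X)))"

end

theory Submission
  imports Defs
begin

text \<open>
  The construction reduces the nonlinear Markov property to the linear Hahn-Banach theorem. Let
  \<open>T t\<close> be the extension of the envelope to bounded continuous functions. A bounded continuous
  functional \<open>f\<close> of the path at finitely many times \<open>0 = t\<^sub>0 < \<dots> < t\<^sub>n\<close> can be integrated out one
  variable at a time, the last time first: freeze the path up to \<open>t\<^sub>i\<^sub>-\<^sub>1\<close>, apply \<open>T (t\<^sub>i - t\<^sub>i\<^sub>-\<^sub>1)\<close> in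
  the variable at time \<open>t\<^sub>i\<close> and evaluate at the position at time \<open>t\<^sub>i\<^sub>-\<^sub>1\<close> (\<open>cond_op\<close>). Started from
  \<open>x\<close> this gives a sublinear functional \<open>path_exp x\<close> on cylinder functions. It is well defined,
  because the semigroup law allows superfluous times to be inserted (\<open>path_op_consistent\<close>), and it
  has the Markov property by construction (\<open>path_exp_cond_op\<close>).

  It remains to write \<open>path_exp x\<close> as a supremum of expectations. For every cylinder function \<open>f\<close>
  the Hahn-Banach theorem gives a linear functional below \<open>path_exp x\<close> that agrees with it at \<open>f\<close>
  (\<open>supporting_functional\<close>). Such a functional inherits continuity from above and is therefore
  integration with respect to a probability measure on path space (\<open>integral_daniell_measure\<close>). The
  supremum over all probability measures dominated by \<open>path_exp x\<close> thus equals \<open>path_exp x\<close> on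
  cylinder functions, and the same supremum is meaningful for all bounded measurable functions.

  Continuity from above is needed for sequences of cylinder functions whose sets of times grow. This
  is where completeness of the state space enters: the one-dimensional marginals are tight
  (\<open>tight_functions\<close>), so that up to a small error the paths lie in a compact product, on which
  monotone convergence is uniform (\<open>cylinder_functional.above\<close>). The Daniell integral over the whole
  path space then takes the place of Kolmogorov's extension theorem.

  The operators \<open>T t\<close> have to be constructed first. On bounded Lipschitz functions the envelope is a
  semigroup of sublinear operators, because all functions involved have a common Lipschitz constant
  and suprema over partitions can be approximated along sequences (\<open>env_add\<close>). Continuity from above
  extends it to bounded continuous functions, by means of their Lipschitz majorants. For \<open>cond_op\<close> to
  preserve continuity, \<open>T t\<close> must moreover be stable under locally uniform convergence
  (\<open>tendsto_continuous_convergence\<close>).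
\<close>


section \<open>Bounded Lipschitz and bounded continuous functions\<close>

lemma CbI: "continuous_on UNIV u \<Longrightarrow> (\<And>x. \<bar>u x\<bar> \<le> C) \<Longrightarrow> u \<in> Cb"
  unfolding Cb_def by (auto intro!: boundedI[of _ C])

lemma CbE:
  assumes "u \<in> Cb"
  obtains C where "continuous_on UNIV u" "\<And>x. \<bar>u x\<bar> \<le> C" "C > 0"
  using assms unfolding Cb_def bounded_pos by auto

lemma Lip_bI: "L-lipschitz_on UNIV u \<Longrightarrow> (\<And>x. \<bar>u x\<bar> \<le> C) \<Longrightarrow> u \<in> Lip_b"
  unfolding Lip_b_def by (auto intro!: boundedI[of _ C])

lemma Lip_bE:
  assumes "u \<in> Lip_b"
  obtains L C where "L-lipschitz_on UNIV u" "\<And>x. \<bar>u x\<bar> \<le> C" "C > 0"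
  using assms unfolding Lip_b_def bounded_pos by auto

lemma Lip_b_subset_Cb: "Lip_b \<subseteq> Cb"
  by (auto elim!: Lip_bE intro!: CbI lipschitz_on_continuous_on)

lemma Cb_add: "u \<in> Cb \<Longrightarrow> v \<in> Cb \<Longrightarrow> (\<lambda>x. u x + v x) \<in> Cb"
proof (elim CbE)
  fix C D
  assume "continuous_on UNIV u" "\<And>x. \<bar>u x\<bar> \<le> C" "continuous_on UNIV v" "\<And>x. \<bar>v x\<bar> \<le> D"
  then show ?thesis
    by (intro CbI[of _ "C + D"] continuous_intros order_trans[OF abs_triangle_ineq] add_mono) auto
qed

lemma Cb_cmult: "u \<in> Cb \<Longrightarrow> (\<lambda>x. c * u x) \<in> Cb"
proof (elim CbE)
  fix C
  assume "continuous_on UNIV u" "\<And>x. \<bar>u x\<bar> \<le> C"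
  then show ?thesis
    by (intro CbI[of _ "\<bar>c\<bar> * C"] continuous_intros) (auto simp: abs_mult mult_left_mono)
qed

lemma Lip_b_add: "u \<in> Lip_b \<Longrightarrow> v \<in> Lip_b \<Longrightarrow> (\<lambda>x. u x + v x) \<in> Lip_b"
proof (elim Lip_bE)
  fix L C K D
  assume "L-lipschitz_on UNIV u" "\<And>x. \<bar>u x\<bar> \<le> C" "K-lipschitz_on UNIV v" "\<And>x. \<bar>v x\<bar> \<le> D"
  then show ?thesis
    by (intro Lip_bI[OF lipschitz_on_add, of L _ K _ "C + D"] order_trans[OF abs_triangle_ineq]
        add_mono) auto
qed

lemma Lip_b_cmult: "u \<in> Lip_b \<Longrightarrow> (\<lambda>x. c * u x) \<in> Lip_b"
proof (elim Lip_bE)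
  fix L C
  assume "L-lipschitz_on UNIV u" "\<And>x. \<bar>u x\<bar> \<le> C"
  then show ?thesis
    by (intro Lip_bI[OF lipschitz_on_cmult_real, of L _ _ "\<bar>c\<bar> * C"])
       (auto simp: abs_mult mult_left_mono)
qed

lemma lipschitz_on_pos_part:
  fixes u :: "'a::metric_space \<Rightarrow> real"
  assumes "L-lipschitz_on UNIV u"
  shows "L-lipschitz_on UNIV (\<lambda>x. max 0 (u x))"
proof (rule lipschitz_onI)
  fix x y
  have "dist (max 0 (u x)) (max 0 (u y)) \<le> dist (u x) (u y)"
    by (auto simp: dist_real_def)
  also have "\<dots> \<le> L * dist x y"
    using assms by (auto intro: lipschitz_onD)
  finally show "dist (max 0 (u x)) (max 0 (u y)) \<le> L * dist x y" .
qed (use assms lipschitz_on_nonneg in auto)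

lemma Lip_b_pos_part: "u \<in> Lip_b \<Longrightarrow> (\<lambda>x. max 0 (u x)) \<in> Lip_b"
proof (elim Lip_bE)
  fix L C
  assume "L-lipschitz_on UNIV u" "\<And>x. \<bar>u x\<bar> \<le> C" "C > 0"
  then show ?thesis
    by (intro Lip_bI[OF lipschitz_on_pos_part, of L _ C]) (auto simp: abs_le_iff)
qed

lemma lipschitz_on_SUP:
  fixes f :: "'i \<Rightarrow> 'a::metric_space \<Rightarrow> real"
  assumes ne: "I \<noteq> {}" and L: "\<And>i. i \<in> I \<Longrightarrow> L-lipschitz_on UNIV (f i)"
    and C: "\<And>i x. i \<in> I \<Longrightarrow> f i x \<le> C"
  shows "L-lipschitz_on UNIV (\<lambda>x. SUP i\<in>I. f i x)"
proof (rule lipschitz_onI)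
  have bdd: "bdd_above ((\<lambda>i. f i x) ` I)" for x
    using C by (auto intro!: bdd_aboveI2)
  have *: "(SUP i\<in>I. f i x) \<le> (SUP i\<in>I. f i y) + L * dist x y" for x y
  proof (rule cSUP_least[OF ne])
    fix i assume i: "i \<in> I"
    have "\<bar>f i x - f i y\<bar> \<le> L * dist x y"
      using lipschitz_onD[OF L[OF i], of x y] by (simp add: dist_real_def)
    moreover have "f i y \<le> (SUP i\<in>I. f i y)"
      using cSUP_upper[OF i bdd] .
    ultimately show "f i x \<le> (SUP i\<in>I. f i y) + L * dist x y" by linarith
  qed
  show "dist (SUP i\<in>I. f i x) (SUP i\<in>I. f i y) \<le> L * dist x y" for x y
    using *[of x y] *[of y x] by (auto simp: dist_real_def abs_le_iff dist_commute)
  obtain i where "i \<in> I" using ne by auto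
  then show "0 \<le> L" using L lipschitz_on_nonneg by blast
qed

text \<open>The sup-convolution of \<open>u\<close> with the cone of slope \<open>n\<close>, which is the least \<open>n\<close>-Lipschitz
  majorant of \<open>u\<close>.\<close>

definition lip_majorant :: "nat \<Rightarrow> ('a::metric_space \<Rightarrow> real) \<Rightarrow> 'a \<Rightarrow> real" where
  "lip_majorant n u x = (SUP y. u y - real n * dist x y)"

lemma
  assumes "u \<in> Cb"
  shows lip_majorant_bdd: "bdd_above (range (\<lambda>y. u y - real n * dist x y))"
    and lip_majorant_ge: "u x \<le> lip_majorant n u x"
    and lip_majorant_in_Lip_b: "lip_majorant n u \<in> Lip_b"
proof -
  obtain K where u: "continuous_on UNIV u" "\<And>x. \<bar>u x\<bar> \<le> K"
    using assms by (rule CbE) blast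
  have le: "u y - real n * dist x y \<le> C" if "\<And>x. u x \<le> C" for n x y C
  proof -
    have "0 \<le> real n * dist x y" by simp
    with that[of y] show ?thesis by linarith
  qed
  have bdd: "bdd_above (range (\<lambda>y. u y - real n * dist x y))" for n x
    using u(2) by (intro bdd_aboveI2[where M=K] le) (auto simp: abs_le_iff)
  have ge: "u x \<le> lip_majorant n u x" for n x
    using cSUP_upper[OF _ bdd[of n x], of x] by (simp add: lip_majorant_def)
  have lC: "(\<And>x. u x \<le> C) \<Longrightarrow> lip_majorant n u x \<le> C" for n x C
    unfolding lip_majorant_def by (intro cSUP_least le) auto
  have "(real n)-lipschitz_on UNIV (\<lambda>x. SUP y. u y - real n * dist x y)"
  proof (rule lipschitz_on_SUP)
    show "(real n)-lipschitz_on UNIV (\<lambda>x. u y - real n * dist x y)" for y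
    proof (rule lipschitz_onI)
      fix x z
      have "\<bar>dist x y - dist z y\<bar> \<le> dist x z"
        by (metis abs_dist_diff_le dist_commute)
      then show "dist (u y - real n * dist x y) (u y - real n * dist z y) \<le> real n * dist x z"
        by (simp add: dist_real_def flip: right_diff_distrib)
          (metis abs_minus_commute abs_mult abs_of_nat mult_left_mono of_nat_0_le_iff)
    qed simp
    show "u y - real n * dist x y \<le> K" for y x
      using u(2) by (intro le) (auto simp: abs_le_iff)
  qed simp
  then have "(real n)-lipschitz_on UNIV (lip_majorant n u)"
    by (simp add: lip_majorant_def[abs_def])
  moreover have "\<bar>lip_majorant n u x\<bar> \<le> K" for x
    using ge[of x n] lC[of K n x, OF abs_le_D1[OF u(2)]] u(2)[of x] by linarith
  ultimately show "lip_majorant n u \<in> Lip_b" by (rule Lip_bI)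
  show "bdd_above (range (\<lambda>y. u y - real n * dist x y))" "u x \<le> lip_majorant n u x"
    by (fact bdd ge)+
qed

lemma lip_majorant_mono:
  assumes "u \<in> Cb" "v \<in> Cb" "\<And>x. u x \<le> v x" "m \<le> n"
  shows "lip_majorant n u x \<le> lip_majorant m v x"
  unfolding lip_majorant_def
proof (rule cSUP_mono)
  show "bdd_above (range (\<lambda>y. v y - real m * dist x y))"
    using lip_majorant_bdd[OF assms(2)] .
  show "\<exists>k\<in>UNIV. u y - real n * dist x y \<le> v k - real m * dist x k" for y
    using assms(3)[of y] assms(4) by (intro bexI[of _ y]) (auto simp: diff_mono mult_right_mono)
qed simp

lemma lip_majorant_decreases:
  assumes "u \<in> Cb"
  shows "decreases_to (\<lambda>n. lip_majorant n u) u"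
  unfolding decreases_to_def
proof (intro allI conjI)
  fix x
  show "decseq (\<lambda>n. lip_majorant n u x)"
    using lip_majorant_mono[OF assms assms] by (auto simp: decseq_def)
  obtain K where u: "continuous_on UNIV u" "\<And>x. \<bar>u x\<bar> \<le> K" "K > 0"
    using assms by (rule CbE) blast
  show "(\<lambda>n. lip_majorant n u x) \<longlonglongrightarrow> u x"
  proof (rule tendstoI)
    fix e :: real assume e: "e > 0"
    from u(1) obtain d where d: "d > 0" "\<And>y. dist y x < d \<Longrightarrow> dist (u y) (u x) < e/2"
      using e unfolding continuous_on_iff by (metis UNIV_I half_gt_zero)
    obtain N where N: "real N * d > 2 * K"
      using reals_Archimedean3[OF d(1)] by blast
    have "dist (lip_majorant n u x) (u x) < e" if n: "n \<ge> N" for n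
    proof -
      \<comment> \<open>points farther than \<open>d\<close> are beaten by the slope, nearer ones by continuity\<close>
      have "u y - real n * dist x y \<le> u x + e/2" for y
      proof (cases "dist y x < d")
        case True
        have "0 \<le> real n * dist x y" by simp
        then show ?thesis using d(2)[OF True] unfolding dist_real_def by linarith
      next
        case False
        have "real N * d \<le> real n * dist x y"
          using False n d(1) by (intro mult_mono) (auto simp: dist_commute)
        then show ?thesis using u(2)[of x] u(2)[of y] N e by linarith
      qed
      then have "lip_majorant n u x \<le> u x + e/2"
        unfolding lip_majorant_def by (intro cSUP_least) auto
      then show ?thesis
        using lip_majorant_ge[OF assms, of x n] e by (simp add: dist_real_def)
    qed
    then show "\<forall>\<^sub>F n in sequentially. dist (lip_majorant n u x) (u x) < e"
      by (auto simp: eventually_sequentially)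
  qed
qed

section \<open>Sublinear Markov operators\<close>

locale function_space =
  fixes D :: "('a \<Rightarrow> real) set"
  assumes const [simp]: "(\<lambda>_. c) \<in> D"
    and add: "u \<in> D \<Longrightarrow> v \<in> D \<Longrightarrow> (\<lambda>x. u x + v x) \<in> D"
    and cmult: "u \<in> D \<Longrightarrow> (\<lambda>x. c * u x) \<in> D"
begin

lemma diff: "u \<in> D \<Longrightarrow> v \<in> D \<Longrightarrow> (\<lambda>x. u x - v x) \<in> D"
  using add[of u "\<lambda>x. -1 * v x"] cmult[of v "-1"] by simp

lemma uminus: "u \<in> D \<Longrightarrow> (\<lambda>x. - u x) \<in> D"
  using cmult[of u "-1"] by simp

lemma sum: "finite I \<Longrightarrow> (\<And>i. i \<in> I \<Longrightarrow> u i \<in> D) \<Longrightarrow> (\<lambda>x. \<Sum>i\<in>I. u i x) \<in> D"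
  by (induction I rule: finite_induct) (auto intro: add)

end

interpretation Cb: function_space Cb
proof
  show "(\<lambda>_. c) \<in> Cb" for c :: real by (rule CbI[of _ "\<bar>c\<bar>"]) auto
qed (auto intro: Cb_add Cb_cmult)

interpretation Lip_b: function_space Lip_b
proof
  show "(\<lambda>_. c) \<in> Lip_b" for c :: real
    by (rule Lip_bI[OF lipschitz_on_constant, of _ "\<bar>c\<bar>"]) auto
qed (auto intro: Lip_b_add Lip_b_cmult)

text \<open>What the given semigroups, their suprema, the extension to \<open>Cb\<close> and the operators on path
  functionals have in common.\<close>

definition sublinear_markov :: "('a \<Rightarrow> real) set \<Rightarrow> (('a \<Rightarrow> real) \<Rightarrow> 'a \<Rightarrow> real) \<Rightarrow> bool" where
  "sublinear_markov D A \<longleftrightarrow>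
     A \<in> D \<rightarrow> D \<and> sublinear_op D A \<and> monotone_op D A \<and> (\<forall>c. A (\<lambda>_. c) = (\<lambda>_. c))"

lemma
  assumes "sublinear_markov D A"
  shows sublinear_markov_in: "u \<in> D \<Longrightarrow> A u \<in> D"
    and sublinear_markov_add: "u \<in> D \<Longrightarrow> v \<in> D \<Longrightarrow> A (\<lambda>y. u y + v y) x \<le> A u x + A v x"
    and sublinear_markov_cmult: "u \<in> D \<Longrightarrow> c > 0 \<Longrightarrow> A (\<lambda>y. c * u y) x = c * A u x"
    and sublinear_markov_mono: "u \<in> D \<Longrightarrow> v \<in> D \<Longrightarrow> (\<And>x. u x \<le> v x) \<Longrightarrow> A u x \<le> A v x"
    and sublinear_markov_const: "A (\<lambda>_. c) = (\<lambda>_. c)"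
  using assms unfolding sublinear_markov_def sublinear_op_def monotone_op_def by auto

context function_space
begin

text \<open>Since \<open>c\<close> can be replaced by \<open>1 / c\<close>, an inequality suffices for homogeneity.\<close>

lemma sublinear_markovI:
  assumes D: "\<And>u. u \<in> D \<Longrightarrow> A u \<in> D"
    and add: "\<And>u v x. u \<in> D \<Longrightarrow> v \<in> D \<Longrightarrow> A (\<lambda>y. u y + v y) x \<le> A u x + A v x"
    and cm: "\<And>u c x. u \<in> D \<Longrightarrow> c > 0 \<Longrightarrow> A (\<lambda>y. c * u y) x \<le> c * A u x"
    and mono: "\<And>u v x. u \<in> D \<Longrightarrow> v \<in> D \<Longrightarrow> (\<And>x. u x \<le> v x) \<Longrightarrow> A u x \<le> A v x"
    and const: "\<And>c x. A (\<lambda>_. c) x = c"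
  shows "sublinear_markov D A"
proof -
  have "A (\<lambda>y. c * u y) x = c * A u x" if u: "u \<in> D" and c: "c > 0" for u c x
  proof (rule antisym)
    have "A (\<lambda>y. (1/c) * (c * u y)) x \<le> (1/c) * A (\<lambda>y. c * u y) x"
      using c by (intro cm cmult u) auto
    then show "c * A u x \<le> A (\<lambda>y. c * u y) x"
      using c by (simp add: field_simps)
  qed (rule cm[OF that])
  then show ?thesis
    unfolding sublinear_markov_def sublinear_op_def monotone_op_def
    using D add mono const by auto
qed

lemma sublinear_markov_comp:
  assumes A: "sublinear_markov D A" and B: "sublinear_markov D B"
  shows "sublinear_markov D (\<lambda>u. A (B u))"
proof (rule sublinear_markovI)
  note in_D = sublinear_markov_in[OF A] sublinear_markov_in[OF B]
  fix u v x assume u: "u \<in> D"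
  show "A (B u) \<in> D" using u by (intro in_D)
  { assume v: "v \<in> D"
    have "A (B (\<lambda>y. u y + v y)) x \<le> A (\<lambda>y. B u y + B v y) x"
      using u v by (intro sublinear_markov_mono[OF A] sublinear_markov_add[OF B] in_D add)
    also have "\<dots> \<le> A (B u) x + A (B v) x"
      using u v by (intro sublinear_markov_add[OF A] in_D)
    finally show "A (B (\<lambda>y. u y + v y)) x \<le> A (B u) x + A (B v) x" .
    assume "\<And>x. u x \<le> v x"
    then show "A (B u) x \<le> A (B v) x"
      using u v by (intro sublinear_markov_mono[OF A] sublinear_markov_mono[OF B] in_D) }
  fix c :: real assume c: "c > 0"
  have "B (\<lambda>y. c * u y) = (\<lambda>y. c * B u y)"
    using sublinear_markov_cmult[OF B u c] by auto
  then show "A (B (\<lambda>y. c * u y)) x \<le> c * A (B u) x"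
    using sublinear_markov_cmult[OF A in_D(2)[OF u] c] by simp
qed (simp add: sublinear_markov_const[OF A] sublinear_markov_const[OF B])

lemma sublinear_markov_id: "sublinear_markov D (\<lambda>u. u)"
  by (rule sublinear_markovI) auto

lemma sublinear_markov_diff:
  assumes A: "sublinear_markov D A" and "u \<in> D" "v \<in> D"
  shows "A u x - A v x \<le> A (\<lambda>x. u x - v x) x"
  using sublinear_markov_add[OF A diff[OF assms(2,3)] assms(3), of x] by simp

lemma sublinear_markov_le:
  assumes "sublinear_markov D A" "u \<in> D" "\<And>x. u x \<le> c"
  shows "A u x \<le> c"
  using sublinear_markov_mono[OF assms(1,2) const assms(3)] sublinear_markov_const[OF assms(1)]
  by simp

lemma sublinear_markov_ge:
  assumes "sublinear_markov D A" "u \<in> D" "\<And>x. c \<le> u x"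
  shows "c \<le> A u x"
  using sublinear_markov_mono[OF assms(1) const assms(2,3)] sublinear_markov_const[OF assms(1)]
  by simp

lemma sublinear_markov_abs_le:
  assumes "sublinear_markov D A" "u \<in> D" "\<And>x. \<bar>u x\<bar> \<le> c"
  shows "\<bar>A u x\<bar> \<le> c"
proof -
  have "- c \<le> A u x"
  proof (rule sublinear_markov_ge[OF assms(1,2)])
    show "- c \<le> u x" for x using assms(3)[of x] by linarith
  qed
  then show ?thesis
    using sublinear_markov_le[OF assms(1,2) abs_le_D1[OF assms(3)], of x] by linarith
qed

lemma sublinear_markov_bdd_above:
  assumes A: "\<And>i. i \<in> I \<Longrightarrow> sublinear_markov D (A i)" and u: "u \<in> D" "bounded (range u)"
  shows "bdd_above ((\<lambda>i. A i u x) ` I)"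
proof -
  obtain C where "\<And>x. \<bar>u x\<bar> \<le> C"
    using u(2) by (auto simp: bounded_iff)
  then show ?thesis
    using sublinear_markov_abs_le[OF A u(1), of _ C]
    by (intro bdd_aboveI2[of _ _ C]) (rule abs_le_D1, blast)
qed

lemma sublinear_markov_SUP:
  assumes ne: "I \<noteq> {}" and A: "\<And>i. i \<in> I \<Longrightarrow> sublinear_markov D (A i)"
    and in_D: "\<And>u. u \<in> D \<Longrightarrow> (\<lambda>x. SUP i\<in>I. A i u x) \<in> D"
    and bounded: "\<And>u. u \<in> D \<Longrightarrow> bounded (range u)"
  shows "sublinear_markov D (\<lambda>u x. SUP i\<in>I. A i u x)"
proof (rule sublinear_markovI)
  note bdd = sublinear_markov_bdd_above[OF A _ bounded]
  fix u v x assume u: "u \<in> D"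
  have le: "A i u x \<le> (SUP i\<in>I. A i u x)" if "i \<in> I" "u \<in> D" for i u
    using that by (intro cSUP_upper bdd)
  { assume v: "v \<in> D"
    show "(SUP i\<in>I. A i (\<lambda>y. u y + v y) x) \<le> (SUP i\<in>I. A i u x) + (SUP i\<in>I. A i v x)"
    proof (rule cSUP_least[OF ne])
      fix i assume i: "i \<in> I"
      show "A i (\<lambda>y. u y + v y) x \<le> (SUP i\<in>I. A i u x) + (SUP i\<in>I. A i v x)"
        using sublinear_markov_add[OF A[OF i] u v, of x] le[OF i u] le[OF i v] by linarith
    qed
    assume "\<And>x. u x \<le> v x"
    then show "(SUP i\<in>I. A i u x) \<le> (SUP i\<in>I. A i v x)"
      using sublinear_markov_mono[OF A u v] by (intro cSUP_mono[OF ne bdd[OF _ v v]]) blast+ }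
  fix c :: real assume c: "c > 0"
  show "(SUP i\<in>I. A i (\<lambda>y. c * u y) x) \<le> c * (SUP i\<in>I. A i u x)"
    using sublinear_markov_cmult[OF A u c] le[OF _ u] c
    by (intro cSUP_least[OF ne]) simp
qed (use ne in \<open>auto simp: sublinear_markov_const[OF A] in_D cong: SUP_cong\<close>)

end

section \<open>The envelope on bounded Lipschitz functions\<close>

abbreviation increasing_list :: "real list \<Rightarrow> bool" where
  "increasing_list xs \<equiv> sorted_wrt (<) xs \<and> xs \<noteq> []"

lemma sorted_between:
  fixes x :: "'a::linorder"
  shows "sorted xs \<Longrightarrow> x \<in> set xs \<Longrightarrow> hd xs \<le> x \<and> x \<le> last xs"
proof (induction xs)
  case (Cons a xs)
  then show ?case
    using last_in_set[of xs] by (cases "xs = []") auto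
qed simp

text \<open>Partitions correspond to strictly increasing lists: \<open>chain_op\<close> is defined by recursion on lists,
  whereas common refinements are unions of sets.\<close>

lemma sorted_list_of_partition:
  assumes "\<pi> \<in> partitions t"
  shows "increasing_list (sorted_list_of_set \<pi>)" "hd (sorted_list_of_set \<pi>) = 0"
    "last (sorted_list_of_set \<pi>) = t"
proof -
  let ?xs = "sorted_list_of_set \<pi>"
  have \<pi>: "finite \<pi>" "\<pi> \<noteq> {}" "\<pi> \<subseteq> {0..}" "0 \<in> \<pi>" "Max \<pi> = t"
    using assms by (auto simp: partitions_def)
  show inc: "increasing_list ?xs"
    using \<pi> by auto
  have "Min \<pi> = 0"
    using \<pi> by (intro Min_eqI) auto
  then show "hd ?xs = 0"
    using sorted_list_of_set_nonempty[OF \<pi>(1,2)] by simp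
  show "last ?xs = t"
  proof (rule antisym)
    show "last ?xs \<le> t"
      using last_in_set[of ?xs] inc \<pi> Max_ge[OF \<pi>(1)] by auto
    have "t \<in> set ?xs" using \<pi> Max_in[OF \<pi>(1,2)] by auto
    then show "t \<le> last ?xs" using sorted_between[of ?xs t] by auto
  qed
qed

lemma partition_of_list:
  assumes "increasing_list xs" "hd xs = 0" "last xs = t"
  shows "set xs \<in> partitions t" "sorted_list_of_set (set xs) = xs"
proof -
  have sorted: "sorted xs" "distinct xs"
    using assms(1) strict_sorted_iff by auto
  show "sorted_list_of_set (set xs) = xs"
    using sorted by (simp add: sorted_list_of_set.idem_if_sorted_distinct)
  show "set xs \<in> partitions t"
  proof -
    have "Max (set xs) = t"
      using assms sorted_between[OF sorted(1)] last_in_set[of xs] by (intro Max_eqI) auto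
    then show ?thesis
      unfolding partitions_def using assms sorted_between[OF sorted(1)] hd_in_set[of xs] by auto
  qed
qed

lemma partitions_Un: "\<pi> \<in> partitions t \<Longrightarrow> \<rho> \<in> partitions t \<Longrightarrow> \<pi> \<union> \<rho> \<in> partitions t"
  using Max_Un[of \<pi> \<rho>] unfolding partitions_def by auto

lemma partitions_nonempty: "t \<ge> 0 \<Longrightarrow> {0, t} \<in> partitions t"
  unfolding partitions_def by auto

text \<open>The restriction of the semigroups to \<open>Lip_b\<close>. The Lipschitz constants grow at a rate \<open>\<beta>\<close> that is
  the same for all indices, so that suprema over indices and over partitions stay in \<open>Lip_b\<close>.\<close>

locale markov_family =
  fixes \<Lambda> :: "'l set" and S :: "'l \<Rightarrow> real \<Rightarrow> ('a::{metric_space, second_countable_topology} \<Rightarrow> real) \<Rightarrow> 'a \<Rightarrow> real"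
    and \<beta> :: real
  assumes index_nonempty: "\<Lambda> \<noteq> {}"
    and linear_markov: "l \<in> \<Lambda> \<Longrightarrow> t \<ge> 0 \<Longrightarrow> sublinear_markov Lip_b (S l t)"
    and lipschitz: "l \<in> \<Lambda> \<Longrightarrow> t \<ge> 0 \<Longrightarrow> u \<in> Lip_b \<Longrightarrow> L-lipschitz_on UNIV u \<Longrightarrow>
      (exp (\<beta> * t) * L)-lipschitz_on UNIV (S l t u)"
    and semigroup_add: "l \<in> \<Lambda> \<Longrightarrow> s \<ge> 0 \<Longrightarrow> t \<ge> 0 \<Longrightarrow> u \<in> Lip_b \<Longrightarrow> S l (s + t) u = S l s (S l t u)"
begin

abbreviation step where "step \<equiv> step_op \<Lambda> S"
abbreviation chain where "chain \<equiv> chain_op \<Lambda> S"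
abbreviation part where "part \<equiv> partition_op \<Lambda> S"
abbreviation env where "env \<equiv> envelope \<Lambda> S"
lemma
  fixes A :: "'i \<Rightarrow> ('a \<Rightarrow> real) \<Rightarrow> 'a \<Rightarrow> real"
  assumes ne: "I \<noteq> {}" and A: "\<And>i. i \<in> I \<Longrightarrow> sublinear_markov Lip_b (A i)"
    and lip: "\<And>i u L. i \<in> I \<Longrightarrow> u \<in> Lip_b \<Longrightarrow> L-lipschitz_on UNIV u \<Longrightarrow> (c * L)-lipschitz_on UNIV (A i u)"
  shows SUP_sublinear_markov: "sublinear_markov Lip_b (\<lambda>u x. SUP i\<in>I. A i u x)"
    and SUP_lipschitz: "u \<in> Lip_b \<Longrightarrow> L-lipschitz_on UNIV u \<Longrightarrow>
      (c * L)-lipschitz_on UNIV (\<lambda>x. SUP i\<in>I. A i u x)"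
    and SUP_markov_upper: "u \<in> Lip_b \<Longrightarrow> i \<in> I \<Longrightarrow> A i u x \<le> (SUP i\<in>I. A i u x)"
proof -
  have bounded: "bounded (range u)" if "u \<in> Lip_b" for u :: "'a \<Rightarrow> real"
    using that by (simp add: Lip_b_def)
  show upper: "A i u x \<le> (SUP i\<in>I. A i u x)" if "u \<in> Lip_b" "i \<in> I" for u i x
    using that by (intro cSUP_upper Lip_b.sublinear_markov_bdd_above[OF A] bounded)
  have *: "(c * L)-lipschitz_on UNIV (\<lambda>x. SUP i\<in>I. A i u x) \<and> (\<lambda>x. SUP i\<in>I. A i u x) \<in> Lip_b"
    if u: "u \<in> Lip_b" "L-lipschitz_on UNIV u" for u L
  proof -
    obtain C where C: "\<And>x. \<bar>u x\<bar> \<le> C"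
      using u(1) by (rule Lip_bE) blast
    note le = Lip_b.sublinear_markov_abs_le[OF A u(1) C]
    have le_C: "A i u x \<le> C" if "i \<in> I" for i x
      by (rule abs_le_D1[OF le[OF that]])
    obtain i where i: "i \<in> I" using ne by auto
    have "\<bar>SUP i\<in>I. A i u x\<bar> \<le> C" for x
    proof -
      have "(SUP i\<in>I. A i u x) \<le> C"
        by (rule cSUP_least[OF ne le_C])
      then show ?thesis using le[OF i, of x] upper[OF u(1) i, of x] by linarith
    qed
    moreover have "(c * L)-lipschitz_on UNIV (\<lambda>x. SUP i\<in>I. A i u x)"
      by (rule lipschitz_on_SUP[OF ne lip[OF _ u] le_C])
    ultimately show ?thesis by (blast intro: Lip_bI)
  qed
  then show "u \<in> Lip_b \<Longrightarrow> L-lipschitz_on UNIV u \<Longrightarrow>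
      (c * L)-lipschitz_on UNIV (\<lambda>x. SUP i\<in>I. A i u x)"
    by blast
  show "sublinear_markov Lip_b (\<lambda>u x. SUP i\<in>I. A i u x)"
  proof (rule Lip_b.sublinear_markov_SUP[OF ne A])
    show "(\<lambda>x. SUP i\<in>I. A i u x) \<in> Lip_b" if "u \<in> Lip_b" for u
      using * that by (auto simp: Lip_b_def)
  qed (auto intro: bounded)
qed

lemma
  assumes h: "h \<ge> 0"
  shows step_lipschitz: "u \<in> Lip_b \<Longrightarrow> L-lipschitz_on UNIV u \<Longrightarrow>
      (exp (\<beta> * h) * L)-lipschitz_on UNIV (step h u)"
    and step_sublinear_markov: "sublinear_markov Lip_b (step h)"
    and step_upper: "u \<in> Lip_b \<Longrightarrow> l \<in> \<Lambda> \<Longrightarrow> S l h u x \<le> step h u x"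
proof -
  have eq: "step h = (\<lambda>u x. SUP l\<in>\<Lambda>. S l h u x)"
    by (simp add: step_op_def fun_eq_iff)
  note sup = index_nonempty linear_markov[OF _ h] lipschitz[OF _ h]
  show "u \<in> Lip_b \<Longrightarrow> L-lipschitz_on UNIV u \<Longrightarrow> (exp (\<beta> * h) * L)-lipschitz_on UNIV (step h u)"
    "sublinear_markov Lip_b (step h)" "u \<in> Lip_b \<Longrightarrow> l \<in> \<Lambda> \<Longrightarrow> S l h u x \<le> step h u x"
    unfolding eq by (rule SUP_lipschitz[OF sup] SUP_sublinear_markov[OF sup] SUP_markov_upper[OF sup]; assumption?)+
qed

text \<open>On the right-hand side the index may change between the two parts of the step.\<close>

lemma step_add_le:
  assumes "h \<ge> 0" "k \<ge> 0" "u \<in> Lip_b"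
  shows "step (h + k) u x \<le> step h (step k u) x"
  unfolding step_op_def[of _ _ "h + k"]
proof (rule cSUP_least[OF index_nonempty])
  fix l assume l: "l \<in> \<Lambda>"
  note in_Lip = sublinear_markov_in[OF linear_markov[OF l]] sublinear_markov_in[OF step_sublinear_markov]
  have "S l (h + k) u x = S l h (S l k u) x"
    using semigroup_add[OF l assms] by simp
  also have "\<dots> \<le> S l h (step k u) x"
    using assms l by (intro sublinear_markov_mono[OF linear_markov] in_Lip step_upper)
  also have "\<dots> \<le> step h (step k u) x"
    using assms l by (intro step_upper in_Lip)
  finally show "S l (h + k) u x \<le> step h (step k u) x" .
qed

lemma chain:
  assumes "increasing_list xs"
  shows chain_lipschitz: "u \<in> Lip_b \<Longrightarrow> L-lipschitz_on UNIV u \<Longrightarrow>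
      (exp (\<beta> * (last xs - hd xs)) * L)-lipschitz_on UNIV (chain xs u)" (is "_ \<Longrightarrow> _ \<Longrightarrow> ?L xs")
    and chain_sublinear_markov: "sublinear_markov Lip_b (chain xs)"
proof -
  have "(u \<in> Lip_b \<longrightarrow> L-lipschitz_on UNIV u \<longrightarrow> ?L xs) \<and> sublinear_markov Lip_b (chain xs)"
    using assms
  proof (induction xs rule: induct_list012)
    case (2 s)
    then show ?case using Lip_b.sublinear_markov_id by simp
  next
    case (3 s t ts)
    have st: "t - s \<ge> 0" and inc: "increasing_list (t # ts)" using 3 by auto
    have eq: "chain (s # t # ts) = (\<lambda>u. step (t - s) (chain (t # ts) u))" by (simp add: fun_eq_iff)
    note IH = "3.IH"(2)[OF inc]
    have m: "sublinear_markov Lip_b (chain (s # t # ts))"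
      unfolding eq
      by (rule Lip_b.sublinear_markov_comp[OF step_sublinear_markov[OF st] conjunct2[OF IH]])
    moreover have "?L (s # t # ts)" if u: "u \<in> Lip_b" "L-lipschitz_on UNIV u"
    proof -
      have "(exp (\<beta> * (t - s)) * (exp (\<beta> * (last (t # ts) - hd (t # ts))) * L))-lipschitz_on UNIV (step (t - s) (chain (t # ts) u))"
        using IH u sublinear_markov_in[OF conjunct2[OF IH], of u]
        by (intro step_lipschitz[OF st]) simp_all
      moreover have "\<beta> * (last (s # t # ts) - hd (s # t # ts)) =
          \<beta> * (t - s) + \<beta> * (last (t # ts) - hd (t # ts))"
        by (simp add: algebra_simps)
      ultimately show ?thesis
        by (simp only: eq exp_add mult.assoc)
    qed
    ultimately show ?case by blast
  qed simp
  then show "u \<in> Lip_b \<Longrightarrow> L-lipschitz_on UNIV u \<Longrightarrow> ?L xs" "sublinear_markov Lip_b (chain xs)"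
    by auto
qed

text \<open>A new partition point \<open>s\<close> in the interval \<open>[a, b]\<close> replaces \<open>step (b - a)\<close> by
  \<open>step (s - a) \<circ> step (b - s)\<close>, which is at least as large.\<close>

lemma chain_insort:
  assumes "increasing_list xs" "hd xs < s" "s < last xs" "s \<notin> set xs" and u: "u \<in> Lip_b"
  shows "chain xs u x \<le> chain (insort s xs) u x"
  using assms(1-4)
proof (induction xs arbitrary: x rule: induct_list012)
  case (3 a b ts)
  have inc: "increasing_list (b # ts)" "a < b" using "3.prems" by auto
  note in_Lip = sublinear_markov_in[OF chain_sublinear_markov u]
  show ?case
  proof (cases "s < b")
    case True
    have "chain (a # b # ts) u x = step ((s - a) + (b - s)) (chain (b # ts) u) x" by simp
    also have "\<dots> \<le> step (s - a) (step (b - s) (chain (b # ts) u)) x"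
      using True "3.prems" inc by (intro step_add_le in_Lip) auto
    finally show ?thesis using True "3.prems" by simp
  next
    case False
    then have sb: "b < s" using "3.prems" by auto
    have ne: "insort s (b # ts) = b # insort s ts" "insort s (a # b # ts) = a # insort s (b # ts)"
      using sb inc by auto
    have "increasing_list (insort s (b # ts))"
      using "3.prems" by (auto simp: strict_sorted_iff sorted_insort distinct_insort simp del: insort_key.simps)
    moreover have "chain (b # ts) u y \<le> chain (insort s (b # ts)) u y" for y
      using "3.prems" sb inc by (intro "3.IH"(2)) auto
    ultimately have "step (b - a) (chain (b # ts) u) x \<le> step (b - a) (chain (insort s (b # ts)) u) x"
      using inc by (intro sublinear_markov_mono[OF step_sublinear_markov] in_Lip) auto
    then show ?thesis by (simp only: ne chain_op.simps)
  qed
qed auto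

lemma partition_op_refine:
  assumes "\<pi> \<in> partitions t" "\<rho> \<in> partitions t" "u \<in> Lip_b"
  shows "part \<pi> u x \<le> part (\<pi> \<union> \<rho>) u x"
proof -
  have "\<pi> \<union> \<sigma> \<in> partitions t \<and> part \<pi> u x \<le> part (\<pi> \<union> \<sigma>) u x"
    if "finite \<sigma>" "\<sigma> \<subseteq> {0..t}" for \<sigma>
    using that
  proof (induction \<sigma> rule: finite_induct)
    case (insert s \<sigma>)
    let ?\<pi> = "\<pi> \<union> \<sigma>"
    have IH: "?\<pi> \<in> partitions t" "part \<pi> u x \<le> part ?\<pi> u x"
      using insert by auto
    have fin: "finite ?\<pi>" "0 \<in> ?\<pi>" "t \<in> ?\<pi>"
      using IH(1) Max_in[of ?\<pi>] unfolding partitions_def by auto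
    show ?case
    proof (cases "s \<in> ?\<pi>")
      case True
      then show ?thesis using IH by (simp add: insert_absorb)
    next
      case False
      then have s: "0 < s" "s < t"
        using fin insert(4) by (auto simp: less_le)
      have "Max (insert s ?\<pi>) = t"
        using IH(1) s unfolding partitions_def by (subst Max_insert) auto
      then have "insert s ?\<pi> \<in> partitions t"
        using IH(1) s unfolding partitions_def by auto
      moreover have "part ?\<pi> u x \<le> part (insert s ?\<pi>) u x"
        unfolding partition_op_def sorted_list_of_set_insert[OF fin(1) False]
        using sorted_list_of_partition[OF IH(1)] s False fin(1)
        by (intro chain_insort assms(3)) auto
      ultimately show ?thesis using IH(2) by simp
    qed
  qed (use assms in auto)
  moreover have "finite \<rho>" "\<rho> \<subseteq> {0..t}"
    using assms(2) unfolding partitions_def by auto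
  ultimately show ?thesis by blast
qed

lemma chain_append: "chain (xs @ s # ys) u = chain (xs @ [s]) (chain (s # ys) u)"
  by (induction xs rule: induct_list012) auto

lemma chain_shift: "chain (map ((+) c) xs) u = chain xs u"
  by (induction xs rule: induct_list012) auto

lemma
  assumes t: "t \<ge> 0"
  shows partition_op_sublinear_markov: "\<pi> \<in> partitions t \<Longrightarrow> sublinear_markov Lip_b (part \<pi>)"
    and env_sublinear_markov: "sublinear_markov Lip_b (env t)"
    and env_upper: "u \<in> Lip_b \<Longrightarrow> \<pi> \<in> partitions t \<Longrightarrow> part \<pi> u x \<le> env t u x"
    and partition_op_lipschitz: "\<pi> \<in> partitions t \<Longrightarrow> u \<in> Lip_b \<Longrightarrow> L-lipschitz_on UNIV u \<Longrightarrow>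
      (exp (\<beta> * t) * L)-lipschitz_on UNIV (part \<pi> u)"
    and env_lipschitz: "u \<in> Lip_b \<Longrightarrow> L-lipschitz_on UNIV u \<Longrightarrow> (exp (\<beta> * t) * L)-lipschitz_on UNIV (env t u)"
proof -
  have ne: "partitions t \<noteq> {}" using partitions_nonempty[OF t] by auto
  have eq: "env t = (\<lambda>u x. SUP \<pi>\<in>partitions t. part \<pi> u x)"
    by (simp add: envelope_def fun_eq_iff)
  show m: "sublinear_markov Lip_b (part \<pi>)" if "\<pi> \<in> partitions t" for \<pi>
    unfolding partition_op_def using sorted_list_of_partition[OF that] by (intro chain_sublinear_markov)
  show lip: "(exp (\<beta> * t) * L)-lipschitz_on UNIV (part \<pi> u)"
    if "\<pi> \<in> partitions t" "u \<in> Lip_b" "L-lipschitz_on UNIV u" for \<pi> u L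
    using chain_lipschitz[OF sorted_list_of_partition(1)[OF that(1)] that(2,3)]
      sorted_list_of_partition[OF that(1)] by (simp add: partition_op_def)
  note sup = ne m lip
  show "u \<in> Lip_b \<Longrightarrow> L-lipschitz_on UNIV u \<Longrightarrow> (exp (\<beta> * t) * L)-lipschitz_on UNIV (env t u)"
    "sublinear_markov Lip_b (env t)" "u \<in> Lip_b \<Longrightarrow> \<pi> \<in> partitions t \<Longrightarrow> part \<pi> u x \<le> env t u x"
    unfolding eq by (rule SUP_lipschitz[OF sup] SUP_sublinear_markov[OF sup] SUP_markov_upper[OF sup]; assumption?)+
qed

lemma partitions_zero: "partitions 0 = {{0}}"
proof (rule equalityI; rule subsetI)
  fix \<pi> :: "real set" assume "\<pi> \<in> partitions 0"
  then have \<pi>: "finite \<pi>" "\<pi> \<subseteq> {0..}" "0 \<in> \<pi>" "Max \<pi> = 0"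
    by (simp_all add: partitions_def)
  have "x = 0" if "x \<in> \<pi>" for x
    using Max_ge[OF \<pi>(1) that] \<pi>(2) that unfolding \<pi>(4) by fastforce
  then show "\<pi> \<in> {{0}}" using \<pi>(3) by blast
next
  fix \<pi> :: "real set" assume "\<pi> \<in> {{0}}"
  then show "\<pi> \<in> partitions 0" by (simp add: partitions_def)
qed

lemma env_zero: "env 0 u = u"
  unfolding envelope_def partitions_zero by (simp add: partition_op_def)

end

lemma decreases_toI:
  assumes "\<And>n x. us (Suc n) x \<le> us n x" "\<And>x. (\<lambda>n. us n x) \<longlonglongrightarrow> u x"
  shows "decreases_to us u"
  using assms by (simp add: decreases_to_def decseq_Suc_iff)

lemma
  assumes "decreases_to us u"
  shows decreases_to_decseq: "decseq (\<lambda>n. us n x)"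
    and decreases_to_lim: "(\<lambda>n. us n x) \<longlonglongrightarrow> u x"
    and decreases_to_ge: "u x \<le> us n x"
    and decreases_to_Suc: "us (Suc n) x \<le> us n x"
  using assms decseq_ge[of "\<lambda>n. us n x" "u x" n] by (simp_all add: decreases_to_def decseq_Suc_iff)

lemma continuous_from_above_opD:
  "continuous_from_above_op D T \<Longrightarrow> (\<And>n. us n \<in> D) \<Longrightarrow> decreases_to us (\<lambda>_. 0) \<Longrightarrow>
    decreases_to (\<lambda>n. T (us n)) (\<lambda>_. 0)"
  by (simp add: continuous_from_above_op_def)

context markov_family
begin

text \<open>Partitions that come close to the supremum at finitely many points of a countable dense set are
  combined by unions. Away from the dense set the convergence follows from the common Lipschitz
  constant.\<close>

lemma env_approx:
  assumes t: "t \<ge> 0" and u: "u \<in> Lip_b"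
  obtains \<pi> where "\<And>n. \<pi> n \<in> partitions t" "increases_to (\<lambda>n. part (\<pi> n) u) (env t u)"
proof -
  let ?P = "\<lambda>\<pi>. part \<pi> u"
  obtain D :: "'a set" where D: "countable D" "\<And>X. open X \<Longrightarrow> X \<noteq> {} \<Longrightarrow> \<exists>d\<in>D. d \<in> X"
    using countable_dense_exists by blast
  have "D \<noteq> {}" using D(2)[of UNIV] by auto
  define q where "q = from_nat_into D"
  have q: "range q = D" unfolding q_def using D(1) \<open>D \<noteq> {}\<close> by (simp add: range_from_nat_into)
  have ne: "partitions t \<noteq> {}" using partitions_nonempty[OF t] by auto
  have bdd: "bdd_above ((\<lambda>\<pi>. ?P \<pi> x) ` partitions t)" for x
    using env_upper[OF t u] by (intro bdd_aboveI2[of _ _ "env t u x"]) auto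
  have "\<exists>\<rho>\<in>partitions t. env t u (q k) - 1 / real (Suc m) < ?P \<rho> (q k)" for k m :: nat
    using less_cSUP_iff[OF ne bdd, of "env t u (q k) - 1 / real (Suc m)" "q k"]
    by (simp add: envelope_def)
  then obtain \<rho> where \<rho>: "\<And>k m. \<rho> k m \<in> partitions t"
    "\<And>k m. env t u (q k) - 1 / real (Suc m) < ?P (\<rho> k m) (q k)"
    by metis
  define \<pi> where "\<pi> n = (\<Union>j\<le>n. case prod_decode j of (k, m) \<Rightarrow> \<rho> k m)" for n
  have \<pi>_Suc: "\<pi> (Suc n) = \<pi> n \<union> (case prod_decode (Suc n) of (k, m) \<Rightarrow> \<rho> k m)" for n
    unfolding \<pi>_def atMost_Suc by auto
  have case_in: "(case p of (k, m) \<Rightarrow> \<rho> k m) \<in> partitions t" for p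
    using \<rho>(1) by (cases p) auto
  have \<pi>: "\<pi> n \<in> partitions t" for n
  proof (induction n)
    case 0 show ?case using case_in by (simp add: \<pi>_def)
  next
    case (Suc n) then show ?case unfolding \<pi>_Suc by (intro partitions_Un case_in)
  qed
  have mono: "incseq (\<lambda>n. ?P (\<pi> n) x)" for x
    unfolding incseq_Suc_iff \<pi>_Suc by (auto intro: partition_op_refine[OF \<pi> case_in u])
  have dense: "env t u (q k) - 1 / real (Suc m) < ?P (\<pi> n) (q k)"
    if n: "n \<ge> prod_encode (k, m)" for n k m
  proof -
    have "\<rho> k m \<subseteq> \<pi> n"
      unfolding \<pi>_def using n by (intro UN_I[of "prod_encode (k, m)"] subsetI) auto
    then have "\<rho> k m \<union> \<pi> n = \<pi> n" by auto
    then have "?P (\<rho> k m) (q k) \<le> ?P (\<pi> n) (q k)"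
      using partition_op_refine[OF \<rho>(1) \<pi>[of n] u] by metis
    then show ?thesis using \<rho>(2)[of k m] by linarith
  qed
  obtain L where L: "L-lipschitz_on UNIV u" using u by (auto simp: Lip_b_def)
  define K where "K = exp (\<beta> * t) * L"
  have K: "K-lipschitz_on UNIV (env t u)" "K-lipschitz_on UNIV (?P (\<pi> n))" for n
    unfolding K_def by (intro env_lipschitz partition_op_lipschitz t u L \<pi>)+
  have K0: "K \<ge> 0" using K(1) lipschitz_on_nonneg by blast
  have lim: "(\<lambda>n. ?P (\<pi> n) x) \<longlonglongrightarrow> env t u x" for x
  proof (rule tendstoI)
    fix e :: real assume e: "e > 0"
    obtain m where m: "1 / real (Suc m) < e / 2"
      using reals_Archimedean[of "e/2"] e by (auto simp: inverse_eq_divide)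
    have "0 < e / (4 * K + 4)" using e K0 by (intro divide_pos_pos) auto
    then have "ball x (e / (4 * K + 4)) \<noteq> {}" by (simp add: not_le)
    then obtain k where "q k \<in> ball x (e / (4 * K + 4))"
      using D(2)[of "ball x (e / (4 * K + 4))"] q by auto
    then have "dist x (q k) * (4 * K + 4) < e" using e K0 by (simp add: pos_less_divide_eq)
    moreover have "dist x (q k) * (4 * K + 4) = 4 * (K * dist x (q k)) + 4 * dist x (q k)" by (simp add: algebra_simps)
    ultimately have k: "K * dist x (q k) < e / 4"
      using zero_le_dist[of x "q k"] by linarith
    have "dist (?P (\<pi> n) x) (env t u x) < e" if "n \<ge> prod_encode (k, m)" for n
    proof -
      have "dist (env t u x) (env t u (q k)) \<le> K * dist x (q k)"
        "dist (?P (\<pi> n) x) (?P (\<pi> n) (q k)) \<le> K * dist x (q k)"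
        using K by (auto intro: lipschitz_onD)
      moreover have "?P (\<pi> n) x \<le> env t u x" by (intro env_upper t u \<pi>)
      ultimately show ?thesis
        using dense[OF that] k m unfolding dist_real_def by linarith
    qed
    then show "\<forall>\<^sub>F n in sequentially. dist (?P (\<pi> n) x) (env t u x) < e"
      unfolding eventually_sequentially by blast
  qed
  show thesis
    by (rule that[of \<pi>]) (simp_all add: increases_to_def mono lim \<pi>)
qed

lemma partition_op_concat:
  assumes "\<pi> \<in> partitions s" "\<rho> \<in> partitions t"
  shows "\<exists>\<sigma>\<in>partitions (s + t). part \<sigma> u = part \<pi> (part \<rho> u)"
proof -
  let ?xs = "sorted_list_of_set \<pi>" and ?ys = "sorted_list_of_set \<rho>"
  note xs = sorted_list_of_partition[OF assms(1)] and ys = sorted_list_of_partition[OF assms(2)]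
  obtain zs where zs: "?ys = 0 # zs" using ys by (cases ?ys) auto
  obtain as where as: "?xs = as @ [s]" using xs by (cases ?xs rule: rev_cases) auto
  \<comment> \<open>the last point of the first list is the first point of the shifted second list\<close>
  let ?l = "as @ s # map ((+) s) zs"
  have inc: "increasing_list ?l"
    using xs(1) ys(1) unfolding as zs by (fastforce simp: sorted_wrt_append sorted_wrt_map)
  have hd: "hd ?l = 0"
    using xs(2) unfolding as by (cases as) auto
  have last: "last ?l = s + t"
    using ys(3) unfolding zs by (auto simp: last_map split: if_splits)
  have "chain ?l u = chain (as @ [s]) (chain (map ((+) s) (0 # zs)) u)"
    by (subst chain_append) simp
  also have "\<dots> = part \<pi> (part \<rho> u)"
    unfolding chain_shift partition_op_def as zs ..
  finally show ?thesis
    using partition_of_list[OF inc hd last]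
    by (intro bexI[of _ "set ?l"]) (auto simp only: partition_op_def)
qed

lemma partition_op_split:
  assumes "\<sigma> \<in> partitions (s + t)" "s \<in> \<sigma>"
  shows "\<exists>\<pi>\<in>partitions s. \<exists>\<rho>\<in>partitions t. part \<sigma> u = part \<pi> (part \<rho> u)"
proof -
  let ?l = "sorted_list_of_set \<sigma>"
  note l = sorted_list_of_partition[OF assms(1)]
  have "s \<in> set ?l" using assms by (simp add: partitions_def)
  then obtain as bs where eq: "?l = as @ s # bs"
    by (meson split_list)
  let ?ys = "map ((+) (- s)) (s # bs)"
  have xs: "increasing_list (as @ [s])" "hd (as @ [s]) = 0" "last (as @ [s]) = s"
    using l unfolding eq by (auto simp: sorted_wrt_append hd_append)
  have ys: "increasing_list ?ys" "hd ?ys = 0" "last ?ys = t"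
    using l(1,3) unfolding eq by (auto simp: sorted_wrt_append sorted_wrt_map last_map)
  have "chain ?l u = chain (as @ [s]) (chain ?ys u)"
    unfolding eq chain_shift by (rule chain_append)
  then have "part \<sigma> u = part (set (as @ [s])) (part (set ?ys) u)"
    unfolding partition_op_def partition_of_list(2)[OF xs] partition_of_list(2)[OF ys] .
  then show ?thesis
    using partition_of_list(1)[OF xs] partition_of_list(1)[OF ys] by blast
qed

text \<open>A partition of \<open>[0, s + t]\<close> that contains \<open>s\<close> splits at \<open>s\<close>, which gives \<open>\<le>\<close>. For the converse, the
  supremum inside \<open>env s (env t u)\<close> is approximated by an increasing sequence \<open>part (\<rho> n) u\<close>; the
  differences \<open>z n\<close> decrease to zero, and continuity from above makes \<open>env s (z n)\<close> negligible.\<close>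

lemma env_add:
  assumes s: "s \<ge> 0" and t: "t \<ge> 0" and u: "u \<in> Lip_b"
    and above: "continuous_from_above_op Lip_b (env s)"
  shows "env (s + t) u = env s (env t u)"
proof
  fix x
  note P_in = sublinear_markov_in[OF partition_op_sublinear_markov[OF t] u]
  note env_in = sublinear_markov_in[OF env_sublinear_markov[OF t] u]
  have st: "s + t \<ge> 0" using s t by simp
  show "env (s + t) u x = env s (env t u) x"
  proof (rule antisym)
    have "part \<sigma> u x \<le> env s (env t u) x" if \<sigma>: "\<sigma> \<in> partitions (s + t)" for \<sigma>
    proof -
      have s_part: "{0, s, s + t} \<in> partitions (s + t)"
        using s t unfolding partitions_def by auto
      obtain \<pi> \<rho> where \<pi>: "\<pi> \<in> partitions s" and \<rho>: "\<rho> \<in> partitions t"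
        and eq: "part (\<sigma> \<union> {0, s, s + t}) u = part \<pi> (part \<rho> u)"
        using partition_op_split[OF partitions_Un[OF \<sigma> s_part]] by blast
      have "part \<sigma> u x \<le> part \<pi> (part \<rho> u) x"
        using partition_op_refine[OF \<sigma> s_part u, of x] by (simp only: eq)
      also have "\<dots> \<le> part \<pi> (env t u) x"
        by (intro sublinear_markov_mono[OF partition_op_sublinear_markov[OF s \<pi>]] P_in[OF \<rho>] env_in
            env_upper t u \<rho>)
      also have "\<dots> \<le> env s (env t u) x"
        by (intro env_upper s env_in \<pi>)
      finally show ?thesis .
    qed
    then show "env (s + t) u x \<le> env s (env t u) x"
      unfolding envelope_def[of _ _ "s + t"] using partitions_nonempty[OF st]
      by (intro cSUP_least) auto
  next
    obtain \<rho> where \<rho>: "\<And>n. \<rho> n \<in> partitions t" and inc: "increases_to (\<lambda>n. part (\<rho> n) u) (env t u)"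
      using env_approx[OF t u] by blast
    define z where "z n = (\<lambda>y. env t u y - part (\<rho> n) u y)" for n
    have z_in: "z n \<in> Lip_b" for n
      unfolding z_def by (intro Lip_b.diff env_in P_in \<rho>)
    have "decreases_to z (\<lambda>_. 0)"
      unfolding decreases_to_def z_def
    proof (intro allI conjI)
      fix y
      have inc_y: "incseq (\<lambda>n. part (\<rho> n) u y)" "(\<lambda>n. part (\<rho> n) u y) \<longlonglongrightarrow> env t u y"
        using inc by (auto simp: increases_to_def)
      show "decseq (\<lambda>n. env t u y - part (\<rho> n) u y)"
        using inc_y(1) unfolding decseq_def incseq_def by (simp add: diff_left_mono)
      show "(\<lambda>n. env t u y - part (\<rho> n) u y) \<longlonglongrightarrow> 0"
        using tendsto_diff[OF tendsto_const inc_y(2), of "env t u y"] by simp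
    qed
    then have lim: "(\<lambda>n. env s (z n) x) \<longlonglongrightarrow> 0"
      by (rule decreases_to_lim[OF continuous_from_above_opD[OF above z_in]])
    have "part \<pi> (env t u) x \<le> env (s + t) u x" if \<pi>: "\<pi> \<in> partitions s" for \<pi>
    proof -
      have "part \<pi> (env t u) x \<le> env (s + t) u x + env s (z n) x" for n
      proof -
        obtain \<sigma> where \<sigma>: "\<sigma> \<in> partitions (s + t)" "part \<sigma> u = part \<pi> (part (\<rho> n) u)"
          using partition_op_concat[OF \<pi> \<rho>] by blast
        have "part \<pi> (part (\<rho> n) u) x \<le> env (s + t) u x"
          using env_upper[OF st u \<sigma>(1), of x] by (simp only: \<sigma>(2))
        moreover have "part \<pi> (env t u) x - part \<pi> (part (\<rho> n) u) x \<le> part \<pi> (z n) x"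
          unfolding z_def
          by (intro Lip_b.sublinear_markov_diff[OF partition_op_sublinear_markov[OF s \<pi>]] env_in P_in \<rho>)
        moreover have "part \<pi> (z n) x \<le> env s (z n) x"
          by (intro env_upper s z_in \<pi>)
        ultimately show ?thesis by linarith
      qed
      moreover have "(\<lambda>n. env (s + t) u x + env s (z n) x) \<longlonglongrightarrow> env (s + t) u x"
        using tendsto_add[OF tendsto_const lim, of "env (s + t) u x"] by simp
      ultimately show ?thesis
        by (intro LIMSEQ_le_const[where X="\<lambda>n. env (s + t) u x + env s (z n) x"]) auto
    qed
    then show "env s (env t u) x \<le> env (s + t) u x"
      unfolding envelope_def[of _ _ s] using partitions_nonempty[OF s]
      by (intro cSUP_least) auto
  qed
qed

end

section \<open>Extension from bounded Lipschitz to bounded continuous functions\<close>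

text \<open>An operator on \<open>Cb\<close> that is continuous from above is determined by its values on the Lipschitz
  majorants; this gives both the uniqueness of the extension and its semigroup law.\<close>

lemma tendsto_lip_majorant:
  assumes T: "sublinear_op Cb T" "monotone_op Cb T" "continuous_from_above_op Cb T" and u: "u \<in> Cb"
  shows "(\<lambda>n. T (lip_majorant n u) x) \<longlonglongrightarrow> T u x"
proof -
  define z where "z n = (\<lambda>y. lip_majorant n u y - u y)" for n
  have maj: "lip_majorant n u \<in> Cb" for n
    using lip_majorant_in_Lip_b[OF u] Lip_b_subset_Cb by auto
  have z_in: "z n \<in> Cb" for n
    unfolding z_def by (intro Cb.diff maj u)
  note dec = lip_majorant_decreases[OF u]
  have "decreases_to z (\<lambda>_. 0)"
    unfolding z_def using decreases_to_Suc[OF dec] tendsto_diff[OF decreases_to_lim[OF dec] tendsto_const]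
    by (intro decreases_toI) (simp, metis diff_self)
  then have z0: "(\<lambda>n. T (z n) x) \<longlonglongrightarrow> 0"
    by (rule decreases_to_lim[OF continuous_from_above_opD[OF T(3) z_in]])
  show ?thesis
  proof (rule tendsto_sandwich[OF _ _ tendsto_const])
    have "T u x \<le> T (lip_majorant n u) x" for n
      using T(2) maj u lip_majorant_ge[OF u] unfolding monotone_op_def by blast
    then show "\<forall>\<^sub>F n in sequentially. T u x \<le> T (lip_majorant n u) x" by simp
    have "T (\<lambda>y. z n y + u y) x \<le> T (z n) x + T u x" for n
      using T(1) z_in u unfolding sublinear_op_def by blast
    then have "T (lip_majorant n u) x \<le> T (z n) x + T u x" for n
      by (simp add: z_def)
    then show "\<forall>\<^sub>F n in sequentially. T (lip_majorant n u) x \<le> T (z n) x + T u x" by simp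
    show "(\<lambda>n. T (z n) x + T u x) \<longlonglongrightarrow> T u x"
      using tendsto_add[OF z0 tendsto_const, of "T u x"] by simp
  qed
qed

locale lipschitz_operator =
  fixes A :: "('a::metric_space \<Rightarrow> real) \<Rightarrow> 'a \<Rightarrow> real"
  assumes markov: "sublinear_markov Lip_b A"
    and above: "continuous_from_above_op Lip_b A"
begin

definition ext :: "('a \<Rightarrow> real) \<Rightarrow> 'a \<Rightarrow> real" where
  "ext u x = (INF n. A (lip_majorant n u) x)"

lemmas A_in = sublinear_markov_in[OF markov]
lemmas A_mono = sublinear_markov_mono[OF markov]

lemma ext_tendsto:
  assumes u: "u \<in> Cb"
  shows "(\<lambda>n. A (lip_majorant n u) x) \<longlonglongrightarrow> ext u x" and "ext u x \<le> A (lip_majorant n u) x"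
proof -
  obtain C where C: "\<And>x. \<bar>u x\<bar> \<le> C" using u by (rule CbE) blast
  have "- C \<le> lip_majorant n u y" for n y
    using lip_majorant_ge[OF u, of y n] C[of y] by linarith
  then have "- C \<le> A (lip_majorant n u) x" for n
    by (intro Lip_b.sublinear_markov_ge[OF markov] lip_majorant_in_Lip_b u)
  then have bdd: "bdd_below (range (\<lambda>n. A (lip_majorant n u) x))"
    by (intro bdd_belowI2)
  have "decseq (\<lambda>n. A (lip_majorant n u) x)"
    unfolding decseq_def by (auto intro!: A_mono lip_majorant_in_Lip_b u lip_majorant_mono)
  from LIMSEQ_decseq_INF[OF bdd this]
  show "(\<lambda>n. A (lip_majorant n u) x) \<longlonglongrightarrow> ext u x" by (simp add: ext_def)
  show "ext u x \<le> A (lip_majorant n u) x"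
    unfolding ext_def by (rule cINF_lower[OF bdd]) simp
qed

text \<open>With \<open>w \<ge> u\<close> the functions \<open>(lip_majorant n u - w)\<^sup>+\<close> decrease to zero.\<close>

lemma ext_le:
  assumes u: "u \<in> Cb" and w: "w \<in> Lip_b" and le: "\<And>y. u y \<le> w y"
  shows "ext u x \<le> A w x"
proof -
  define z where "z n = (\<lambda>y. max 0 (lip_majorant n u y - w y))" for n
  note maj = lip_majorant_in_Lip_b[OF u] and dec = lip_majorant_decreases[OF u]
  have z_in: "z n \<in> Lip_b" for n
    unfolding z_def by (intro Lip_b_pos_part Lip_b.diff maj w)
  have "decreases_to z (\<lambda>_. 0)"
  proof (rule decreases_toI)
    show "z (Suc n) y \<le> z n y" for n y
      using decreases_to_Suc[OF dec, of n y] by (auto simp: z_def)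
    have "(\<lambda>n. z n y) \<longlonglongrightarrow> max 0 (u y - w y)" for y
      unfolding z_def by (intro tendsto_intros decreases_to_lim[OF dec])
    moreover have "max 0 (u y - w y) = 0" for y
      using le[of y] by simp
    ultimately show "(\<lambda>n. z n y) \<longlonglongrightarrow> 0" for y by metis
  qed
  then have z0: "(\<lambda>n. A (z n) x) \<longlonglongrightarrow> 0"
    by (rule decreases_to_lim[OF continuous_from_above_opD[OF above z_in]])
  have "ext u x \<le> A w x + A (z n) x" for n
  proof -
    have "ext u x \<le> A (lip_majorant n u) x" by (rule ext_tendsto(2)[OF u])
    also have "\<dots> \<le> A (\<lambda>y. w y + z n y) x"
      by (intro A_mono maj Lip_b.add w z_in) (simp add: z_def)
    also have "\<dots> \<le> A w x + A (z n) x"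
      by (intro sublinear_markov_add[OF markov] w z_in)
    finally show ?thesis .
  qed
  moreover have "(\<lambda>n. A w x + A (z n) x) \<longlonglongrightarrow> A w x"
    using tendsto_add[OF tendsto_const z0, of "A w x"] by simp
  ultimately show ?thesis
    by (intro LIMSEQ_le_const[where X="\<lambda>n. A w x + A (z n) x"]) auto
qed

lemma ext_mono:
  assumes u: "u \<in> Cb" and v: "v \<in> Cb" and le: "\<And>y. u y \<le> v y"
  shows "ext u x \<le> ext v x"
proof (rule LIMSEQ_le_const[OF ext_tendsto(1)[OF v]], intro exI allI impI)
  fix n
  show "ext u x \<le> A (lip_majorant n v) x"
    using le lip_majorant_ge[OF v] by (intro ext_le u lip_majorant_in_Lip_b v) (rule order_trans)
qed

lemma ext_eq:
  assumes u: "u \<in> Lip_b"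
  shows "ext u = A u"
proof
  fix x
  have u': "u \<in> Cb" using u Lip_b_subset_Cb by auto
  have "A u x \<le> ext u x"
  proof (rule LIMSEQ_le_const[OF ext_tendsto(1)[OF u']], intro exI allI impI)
    show "A u x \<le> A (lip_majorant n u) x" for n
      by (intro A_mono u lip_majorant_in_Lip_b u' lip_majorant_ge)
  qed
  with ext_le[OF u' u, of x] show "ext u x = A u x" by simp
qed

text \<open>\<open>ext u\<close> is an infimum of continuous functions, hence upper semicontinuous. It is also the
  supremum of the \<open>A v\<close> over Lipschitz minorants \<open>v\<close>, because \<open>A\<close> applied to majorant minus minorant
  tends to zero, hence it is lower semicontinuous.\<close>

lemma ext_continuous:
  assumes u: "u \<in> Cb"
  shows "continuous_on UNIV (ext u)"
proof (rule continuous_at_imp_continuous_on, intro ballI)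
  fix x
  define p where "p n = lip_majorant n u" for n
  define v where "v n = (\<lambda>y. - lip_majorant n (\<lambda>y. - u y) y)" for n
  have u': "(\<lambda>y. - u y) \<in> Cb" using Cb.uminus[OF u] .
  have p_in: "p n \<in> Lip_b" and v_in: "v n \<in> Lip_b" for n
    unfolding p_def v_def by (intro Lip_b.uminus lip_majorant_in_Lip_b u u')+
  have v_le: "v n y \<le> u y" for n y
    using lip_majorant_ge[OF u', of y n] by (simp add: v_def)
  have Av_le: "A (v n) y \<le> ext u y" for n y
  proof -
    have "v n \<in> Cb" using v_in Lip_b_subset_Cb by auto
    from ext_mono[OF this u v_le] show ?thesis unfolding ext_eq[OF v_in] .
  qed
  have le_Ap: "ext u y \<le> A (p n) y" for n y
    unfolding p_def by (rule ext_tendsto(2)[OF u])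
  have A_cont: "continuous_on UNIV (A w)" if "w \<in> Lip_b" for w
    using A_in[OF that] Lip_b_subset_Cb by (auto simp: Cb_def)
  have "decreases_to (\<lambda>n y. p n y - v n y) (\<lambda>_. 0)"
  proof (rule decreases_toI)
    note d = lip_majorant_decreases[OF u] lip_majorant_decreases[OF u']
    show "p (Suc n) y - v (Suc n) y \<le> p n y - v n y" for n y
      using decreases_to_Suc[OF d(1), of n y] decreases_to_Suc[OF d(2), of n y]
      unfolding p_def v_def by linarith
    have "(\<lambda>n. p n y - v n y) \<longlonglongrightarrow> u y - (- (- u y))" for y
      unfolding p_def v_def by (intro tendsto_intros decreases_to_lim[OF d(1)] decreases_to_lim[OF d(2)])
    then show "(\<lambda>n. p n y - v n y) \<longlonglongrightarrow> 0" for y by simp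
  qed
  then have lim: "(\<lambda>n. A (\<lambda>y. p n y - v n y) x) \<longlonglongrightarrow> 0"
    by (intro decreases_to_lim[OF continuous_from_above_opD[OF above]] Lip_b.diff p_in v_in)
  show "isCont (ext u) x"
    unfolding isCont_def
  proof (rule tendstoI)
    fix e :: real assume e: "e > 0"
    obtain n where "A (\<lambda>y. p n y - v n y) x < e / 2"
      using order_tendstoD(2)[OF lim, of "e/2"] e by (auto simp: eventually_sequentially)
    then have gap: "A (p n) x - A (v n) x < e / 2"
      using Lip_b.sublinear_markov_diff[OF markov p_in[of n] v_in[of n], of x] by linarith
    have "(A (p n) \<longlongrightarrow> A (p n) x) (at x)" "(A (v n) \<longlongrightarrow> A (v n) x) (at x)"
      using A_cont[OF p_in, of n] A_cont[OF v_in, of n]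
      by (auto simp: continuous_on_eq_continuous_at isCont_def)
    then have "\<forall>\<^sub>F y in at x. A (p n) y < A (p n) x + e / 2" "\<forall>\<^sub>F y in at x. A (v n) y > A (v n) x - e / 2"
      using e by (auto intro: order_tendstoD)
    then show "\<forall>\<^sub>F y in at x. dist (ext u y) (ext u x) < e"
    proof eventually_elim
      case (elim y)
      then show ?case
        using gap Av_le[of n x] Av_le[of n y] le_Ap[of x n] le_Ap[of y n] e
        unfolding dist_real_def by linarith
    qed
  qed
qed

lemma ext_abs_le:
  assumes u: "u \<in> Cb" and C: "\<And>x. \<bar>u x\<bar> \<le> C"
  shows "\<bar>ext u x\<bar> \<le> C"
proof -
  have "ext u x \<le> ext (\<lambda>_. C) x" "ext (\<lambda>_. - C) x \<le> ext u x"
    using C by (auto intro!: ext_mono u simp: abs_le_iff) (metis C abs_le_D2 minus_le_iff)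
  then show ?thesis by (simp add: ext_eq sublinear_markov_const[OF markov] abs_le_iff)
qed

lemma ext_markov: "sublinear_markov Cb ext"
proof (rule Cb.sublinear_markovI)
  fix u v :: "'a \<Rightarrow> real" and x and c :: real assume u: "u \<in> Cb"
  obtain C where "\<And>x. \<bar>u x\<bar> \<le> C" using u by (rule CbE) blast
  then show "ext u \<in> Cb"
    by (intro CbI[of _ C] ext_continuous u ext_abs_le) auto
  note maj = lip_majorant_in_Lip_b
  { assume v: "v \<in> Cb"
    show "ext (\<lambda>y. u y + v y) x \<le> ext u x + ext v x"
    proof (rule LIMSEQ_le_const[OF tendsto_add[OF ext_tendsto(1)[OF u] ext_tendsto(1)[OF v]]], intro exI allI impI)
      fix n
      have "ext (\<lambda>y. u y + v y) x \<le> A (\<lambda>y. lip_majorant n u y + lip_majorant n v y) x"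
        by (intro ext_le Cb.add Lip_b.add u v maj add_mono lip_majorant_ge)
      also have "\<dots> \<le> A (lip_majorant n u) x + A (lip_majorant n v) x"
        by (intro sublinear_markov_add[OF markov] maj u v)
      finally show "ext (\<lambda>y. u y + v y) x \<le> A (lip_majorant n u) x + A (lip_majorant n v) x" .
    qed
    assume "\<And>x. u x \<le> v x"
    then show "ext u x \<le> ext v x" by (intro ext_mono u v) }
  assume c: "c > 0"
  show "ext (\<lambda>y. c * u y) x \<le> c * ext u x"
  proof (rule LIMSEQ_le_const[OF tendsto_mult[OF tendsto_const ext_tendsto(1)[OF u]]], intro exI allI impI)
    fix n
    have "ext (\<lambda>y. c * u y) x \<le> A (\<lambda>y. c * lip_majorant n u y) x"
      using c by (intro ext_le Cb.cmult Lip_b.cmult u maj mult_left_mono lip_majorant_ge) auto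
    also have "\<dots> = c * A (lip_majorant n u) x"
      by (intro sublinear_markov_cmult[OF markov] maj u c)
    finally show "ext (\<lambda>y. c * u y) x \<le> c * A (lip_majorant n u) x" .
  qed
qed (simp add: ext_eq sublinear_markov_const[OF markov])

lemma ext_above: "continuous_from_above_op Cb ext"
  unfolding continuous_from_above_op_def
proof (intro allI impI; elim conjE)
  fix us :: "nat \<Rightarrow> 'a \<Rightarrow> real"
  assume us: "\<forall>n. us n \<in> Cb" and dec: "decreases_to us (\<lambda>_. 0)"
  note us = us[rule_format]
  \<comment> \<open>the diagonal sequence dominates \<open>us\<close> and still decreases to zero\<close>
  define w where "w n = lip_majorant n (us n)" for n
  have w_in: "w n \<in> Lip_b" for n
    unfolding w_def by (intro lip_majorant_in_Lip_b us)
  have us_mono: "us n y \<le> us m y" if "m \<le> n" for m n y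
    using decreases_to_decseq[OF dec] that by (auto simp: decseq_def)
  have "decreases_to w (\<lambda>_. 0)"
  proof (rule decreases_toI)
    show "w (Suc n) y \<le> w n y" for n y
      unfolding w_def by (intro lip_majorant_mono us us_mono) auto
    show "(\<lambda>n. w n y) \<longlonglongrightarrow> 0" for y
    proof (rule order_tendstoI)
      have w_ge: "0 \<le> w n y" for n
        unfolding w_def by (rule order_trans[OF decreases_to_ge[OF dec] lip_majorant_ge[OF us]])
      then show "\<forall>\<^sub>F n in sequentially. e < w n y" if "e < 0" for e
        using that w_ge by (intro always_eventually allI) (rule less_le_trans)
      fix e :: real assume "0 < e"
      then have "\<forall>\<^sub>F i in sequentially. us i y < e"
        by (rule order_tendstoD(2)[OF decreases_to_lim[OF dec]])
      then obtain i where i: "us i y < e" by (auto simp: eventually_sequentially)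
      have "\<forall>\<^sub>F n in sequentially. lip_majorant n (us i) y < e"
        by (rule order_tendstoD(2)[OF decreases_to_lim[OF lip_majorant_decreases[OF us]] i])
      then show "\<forall>\<^sub>F n in sequentially. w n y < e"
        using eventually_ge_at_top[of i]
      proof eventually_elim
        case (elim n)
        have "w n y \<le> lip_majorant n (us i) y"
          unfolding w_def using elim by (intro lip_majorant_mono us us_mono) auto
        then show ?case using elim by simp
      qed
    qed
  qed
  then have w0: "(\<lambda>n. A (w n) y) \<longlonglongrightarrow> 0" for y
    by (rule decreases_to_lim[OF continuous_from_above_opD[OF above w_in]])
  show "decreases_to (\<lambda>n. ext (us n)) (\<lambda>_. 0)"
  proof (rule decreases_toI)
    show "ext (us (Suc n)) y \<le> ext (us n) y" for n y
      by (intro ext_mono us us_mono) simp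
    fix y
    have "0 \<le> ext (us n) y" for n
      by (rule Cb.sublinear_markov_ge[OF ext_markov us decreases_to_ge[OF dec]])
    moreover have "ext (us n) y \<le> A (w n) y" for n
      unfolding w_def by (rule ext_tendsto(2)[OF us])
    ultimately show "(\<lambda>n. ext (us n) y) \<longlonglongrightarrow> 0"
      by (intro tendsto_sandwich[OF _ _ tendsto_const w0[of y]]) auto
  qed
qed

text \<open>The operator \<open>ext\<close> is an extension, and by \<open>tendsto_lip_majorant\<close> it is the only one, so that the
  definite description in \<open>Cb_extension\<close> denotes it.\<close>

lemma
  shows Cb_extension_markov: "sublinear_markov Cb (Cb_extension A)"
    and Cb_extension_above: "continuous_from_above_op Cb (Cb_extension A)"
    and Cb_extension_eq: "u \<in> Lip_b \<Longrightarrow> Cb_extension A u = A u"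
proof -
  let ?prop = "\<lambda>T. T \<in> Cb \<rightarrow>\<^sub>E Cb \<and> (\<forall>u\<in>Lip_b. T u = A u) \<and>
      sublinear_op Cb T \<and> monotone_op Cb T \<and> continuous_from_above_op Cb T"
  define T where "T = restrict ext Cb"
  have T: "T u = ext u" if "u \<in> Cb" for u
    using that by (simp add: T_def)
  have m: "sublinear_markov Cb T"
  proof (rule Cb.sublinear_markovI)
    fix u v :: "'a \<Rightarrow> real" and c :: real and x assume u: "u \<in> Cb"
    show "T u \<in> Cb" using T[OF u] sublinear_markov_in[OF ext_markov u] by simp
    show "T (\<lambda>y. u y + v y) x \<le> T u x + T v x" if "v \<in> Cb"
      using sublinear_markov_add[OF ext_markov u that, of x] by (simp add: T u that Cb.add)
    show "T u x \<le> T v x" if "v \<in> Cb" "\<And>x. u x \<le> v x"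
      using ext_mono[OF u that] by (simp add: T u that)
    show "T (\<lambda>y. c * u y) x \<le> c * T u x" if "c > 0"
      using sublinear_markov_cmult[OF ext_markov u that, of x] by (simp add: T u Cb.cmult)
  qed (simp add: T sublinear_markov_const[OF ext_markov])
  have above_T: "continuous_from_above_op Cb T"
    using ext_above unfolding continuous_from_above_op_def by (simp add: T)
  have T_prop: "?prop T"
  proof -
    have "T \<in> Cb \<rightarrow>\<^sub>E Cb"
      unfolding T_def restrict_PiE_iff using sublinear_markov_in[OF ext_markov] by (rule ballI)
    moreover have "T u = A u" if "u \<in> Lip_b" for u
      using that T[of u] ext_eq[of u] Lip_b_subset_Cb by auto
    ultimately show ?thesis
      using m above_T unfolding sublinear_markov_def by simp
  qed
  moreover have "T' = T" if "?prop T'" for T'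
  proof
    fix u
    show "T' u = T u"
    proof (cases "u \<in> Cb")
      case True
      have same: "T' (lip_majorant n u) = T (lip_majorant n u)" for n
        using that T_prop lip_majorant_in_Lip_b[OF True] by simp
      show ?thesis
      proof
        fix x
        have "(\<lambda>n. T' (lip_majorant n u) x) \<longlonglongrightarrow> T' u x"
          using that by (intro tendsto_lip_majorant True) auto
        moreover have "(\<lambda>n. T (lip_majorant n u) x) \<longlonglongrightarrow> T u x"
          using T_prop by (intro tendsto_lip_majorant True) auto
        ultimately show "T' u x = T u x"
          unfolding same by (rule LIMSEQ_unique)
      qed
    next
      case False
      have "T' u = undefined" "T u = undefined"
        using that T_prop False by (simp_all add: PiE_def extensional_def)
      then show ?thesis by simp
    qed
  qed
  ultimately have eq: "Cb_extension A = T"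
    unfolding Cb_extension_def by (rule the_equality)
  show "sublinear_markov Cb (Cb_extension A)" "continuous_from_above_op Cb (Cb_extension A)"
    "u \<in> Lip_b \<Longrightarrow> Cb_extension A u = A u"
    unfolding eq using m above_T T_prop by auto
qed

end

section \<open>The semigroup on bounded continuous functions\<close>

locale Cb_semigroup =
  fixes T :: "real \<Rightarrow> ('a::metric_space \<Rightarrow> real) \<Rightarrow> 'a \<Rightarrow> real"
  assumes markov: "t \<ge> 0 \<Longrightarrow> sublinear_markov Cb (T t)"
    and above: "t \<ge> 0 \<Longrightarrow> continuous_from_above_op Cb (T t)"
    and zero: "u \<in> Cb \<Longrightarrow> T 0 u = u"
    and add: "s \<ge> 0 \<Longrightarrow> t \<ge> 0 \<Longrightarrow> u \<in> Cb \<Longrightarrow> T (s + t) u = T s (T t u)"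

text \<open>The semigroup laws hold on Lipschitz majorants and pass to their limits.\<close>

lemma (in markov_family) Cb_semigroup_envelope:
  assumes above: "continuous_from_above Lip_b env"
  shows "Cb_semigroup (\<lambda>t. Cb_extension (env t))"
proof -
  let ?T = "\<lambda>t. Cb_extension (env t)"
  have A: "lipschitz_operator (env t)" if "t \<ge> 0" for t
    using env_sublinear_markov[OF that] above that
    by (simp add: lipschitz_operator_def continuous_from_above_def)
  note m = lipschitz_operator.Cb_extension_markov[OF A]
    and ab = lipschitz_operator.Cb_extension_above[OF A]
    and eq = lipschitz_operator.Cb_extension_eq[OF A]
  note lim = tendsto_lip_majorant[OF _ _ ab]
  have sub: "sublinear_op Cb B \<and> monotone_op Cb B" if "sublinear_markov Cb B" for B :: "('a \<Rightarrow> real) \<Rightarrow> 'a \<Rightarrow> real"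
    using that by (simp add: sublinear_markov_def)
  show ?thesis
  proof
    fix s t :: real and u :: "'a \<Rightarrow> real" assume u: "u \<in> Cb"
    note maj = lip_majorant_in_Lip_b[OF u]
    show "?T 0 u = u"
    proof
      fix x
      have "(\<lambda>n. ?T 0 (lip_majorant n u) x) \<longlonglongrightarrow> ?T 0 u x"
        using sub[OF m[of 0]] ab[of 0] by (intro tendsto_lip_majorant u) auto
      then have "(\<lambda>n. lip_majorant n u x) \<longlonglongrightarrow> ?T 0 u x"
        using eq[OF _ maj] env_zero by simp
      then show "?T 0 u x = u x"
        by (rule LIMSEQ_unique) (rule decreases_to_lim[OF lip_majorant_decreases[OF u]])
    qed
    assume st: "s \<ge> 0" "t \<ge> 0"
    have comp: "sublinear_markov Cb (\<lambda>u. ?T s (?T t u))"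
      by (rule Cb.sublinear_markov_comp[OF m[OF st(1)] m[OF st(2)]])
    have comp_above: "continuous_from_above_op Cb (\<lambda>u. ?T s (?T t u))"
      unfolding continuous_from_above_op_def
      using continuous_from_above_opD[OF ab[OF st(1)] sublinear_markov_in[OF m[OF st(2)]]
          continuous_from_above_opD[OF ab[OF st(2)]]] by blast
    show "?T (s + t) u = ?T s (?T t u)"
    proof
      fix x
      have *: "?T (s + t) (lip_majorant n u) = ?T s (?T t (lip_majorant n u))" for n
      proof -
        have above_s: "continuous_from_above_op Lip_b (env s)"
          using above st by (simp add: continuous_from_above_def)
        show ?thesis
          using st env_add[OF st maj above_s] sublinear_markov_in[OF env_sublinear_markov[OF st(2)] maj]
          by (simp add: eq maj)
      qed
      have "(\<lambda>n. ?T (s + t) (lip_majorant n u) x) \<longlonglongrightarrow> ?T (s + t) u x"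
        using sub[OF m[of "s + t"]] ab[of "s + t"] st by (intro tendsto_lip_majorant u) auto
      moreover have "(\<lambda>n. ?T s (?T t (lip_majorant n u)) x) \<longlonglongrightarrow> ?T s (?T t u) x"
        using sub[OF comp] comp_above by (intro tendsto_lip_majorant[where T="\<lambda>u. ?T s (?T t u)"] u) auto
      ultimately show "?T (s + t) u x = ?T s (?T t u) x"
        unfolding * by (rule LIMSEQ_unique)
    qed
  qed (rule m ab; assumption)+
qed

section \<open>Stability under continuous convergence\<close>

text \<open>The tail suprema of \<open>\<bar>u\<^sub>m - v\<bar>\<close> are continuous: the terms with small index are finitely many
  continuous functions, and the others are locally uniformly small. They decrease to zero, so
  continuity from above applies to them.\<close>

lemma tail_sup:
  fixes u :: "nat \<Rightarrow> 'a::metric_space \<Rightarrow> real"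
  assumes u: "\<And>n. continuous_on UNIV (u n)" "\<And>n y. \<bar>u n y\<bar> \<le> C"
    and v: "v \<in> Cb"
    and conv: "\<And>y. ((\<lambda>(n, z). u n z) \<longlongrightarrow> v y) (sequentially \<times>\<^sub>F nhds y)"
  obtains w where "\<And>n. w n \<in> Cb" "decreases_to w (\<lambda>_. 0)" "\<And>m n y. n \<le> m \<Longrightarrow> \<bar>u m y - v y\<bar> \<le> w n y"
proof -
  obtain D where D: "continuous_on UNIV v" "\<And>y. \<bar>v y\<bar> \<le> D" using v by (rule CbE) blast
  define g where "g n y = \<bar>u n y - v y\<bar>" for n y
  define w where "w n y = (SUP m\<in>{n..}. g m y)" for n y
  have g_le: "g n y \<le> C + D" for n y
    unfolding g_def using u(2)[of n y] D(2)[of y] by linarith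
  have g_cont: "continuous_on UNIV (g n)" for n
    unfolding g_def by (intro continuous_intros u D)
  have bdd: "bdd_above ((\<lambda>m. g m y) ` {n..})" for n y
    using g_le by (intro bdd_aboveI2)
  have g_w: "g m y \<le> w n y" if "n \<le> m" for m n y
    unfolding w_def using that by (intro cSUP_upper bdd) auto
  have w_le: "w n y \<le> c" if "\<And>m. m \<ge> n \<Longrightarrow> g m y \<le> c" for n y c
    unfolding w_def using that by (intro cSUP_least) auto
  have w0: "0 \<le> w n y" for n y
    using g_w[of n n y] by (simp add: g_def)
  have small: "\<exists>N. \<forall>\<^sub>F z in nhds y. \<forall>n\<ge>N. g n z < e" if e: "e > 0" for y e
  proof -
    have "\<forall>\<^sub>F p in sequentially \<times>\<^sub>F nhds y. dist (u (fst p) (snd p)) (v y) < e / 2"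
      using tendstoD[OF conv[of y], of "e/2"] e by (simp add: case_prod_beta)
    then obtain P Q where P: "eventually P sequentially" "eventually Q (nhds y)"
      "\<And>n z. P n \<Longrightarrow> Q z \<Longrightarrow> dist (u n z) (v y) < e / 2"
      unfolding eventually_prod_filter by auto
    obtain N where N: "\<And>n. n \<ge> N \<Longrightarrow> P n" using P(1) by (auto simp: eventually_sequentially)
    have "isCont v y" using D(1) by (simp add: continuous_on_eq_continuous_at)
    then have "(v \<longlongrightarrow> v y) (nhds y)"
      unfolding isCont_def tendsto_at_iff_tendsto_nhds .
    then have "\<forall>\<^sub>F z in nhds y. dist (v z) (v y) < e / 2"
      using e by (intro tendstoD) simp_all
    then have "\<forall>\<^sub>F z in nhds y. \<forall>n\<ge>N. g n z < e"
      using P(2)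
    proof eventually_elim
      case (elim z)
      show ?case
      proof (intro allI impI)
        fix n assume "n \<ge> N"
        then have "dist (u n z) (v y) < e / 2" using P(3) N elim by blast
        then show "g n z < e" using elim unfolding g_def dist_real_def by linarith
      qed
    qed
    then show ?thesis by blast
  qed
  have w_cont: "continuous_on UNIV (w n)" for n
  proof (rule continuous_at_imp_continuous_on, intro ballI)
    fix y
    show "isCont (w n) y"
      unfolding isCont_def tendsto_at_iff_tendsto_nhds
    proof (rule tendstoI)
      fix e :: real assume "e > 0"
      then have e: "e / 2 > 0" by simp
      obtain N where N: "\<forall>\<^sub>F z in nhds y. \<forall>n\<ge>N. g n z < e / 2" using small[OF e] by blast
      have "(g k \<longlongrightarrow> g k y) (nhds y)" for k
        using g_cont[of k] unfolding continuous_on_eq_continuous_at[OF open_UNIV] isCont_def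
          tendsto_at_iff_tendsto_nhds by simp
      then have "\<forall>\<^sub>F z in nhds y. dist (g k z) (g k y) < e / 2" for k
        by (rule tendstoD[OF _ e])
      then have "\<forall>\<^sub>F z in nhds y. \<forall>k\<in>{..<N}. dist (g k z) (g k y) < e / 2"
        by (intro eventually_ball_finite) auto
      with N show "\<forall>\<^sub>F z in nhds y. dist (w n z) (w n y) < e"
      proof eventually_elim
        case (elim z)
        have y: "\<forall>n\<ge>N. g n y < e / 2" using eventually_nhds_x_imp_x[OF N] .
        have near: "\<bar>g k z - g k y\<bar> \<le> e / 2" for k
        proof (cases "k < N")
          case True then show ?thesis using elim by (auto simp: dist_real_def intro: less_imp_le)
        next
          case False
          then have "g k z < e / 2" "g k y < e / 2" using elim y by auto
          moreover have "g k z \<ge> 0" "g k y \<ge> 0" by (auto simp: g_def)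
          ultimately show ?thesis by linarith
        qed
        have "w n z \<le> w n y + e / 2"
        proof (rule w_le)
          show "g m z \<le> w n y + e / 2" if "m \<ge> n" for m
            using near[of m] g_w[OF that, of y] by linarith
        qed
        moreover have "w n y \<le> w n z + e / 2"
        proof (rule w_le)
          show "g m y \<le> w n z + e / 2" if "m \<ge> n" for m
            using near[of m] g_w[OF that, of z] by linarith
        qed
        ultimately show ?case using \<open>e > 0\<close> unfolding dist_real_def by linarith
      qed
    qed
  qed
  show thesis
  proof
    fix n
    have "\<bar>w n y\<bar> \<le> C + D" for y
      using w_le[of n y "C + D"] g_le w0[of n y] by simp
    then show "w n \<in> Cb" by (intro CbI[OF w_cont])
    show "\<bar>u m y - v y\<bar> \<le> w n y" if "n \<le> m" for m y
      using g_w[OF that, of y] by (simp add: g_def)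
  next
    show "decreases_to w (\<lambda>_. 0)"
    proof (rule decreases_toI)
      show "w (Suc n) y \<le> w n y" for n y
        by (rule w_le) (auto intro: g_w)
      show "(\<lambda>n. w n y) \<longlonglongrightarrow> 0" for y
      proof (rule tendstoI)
        fix e :: real assume "e > 0"
        then have e: "e / 2 > 0" by simp
        obtain N where "\<forall>\<^sub>F z in nhds y. \<forall>n\<ge>N. g n z < e / 2" using small[OF e] by blast
        then have N: "\<forall>n\<ge>N. g n y < e / 2" by (rule eventually_nhds_x_imp_x)
        have "dist (w n y) 0 < e" if "n \<ge> N" for n
        proof -
          have "w n y \<le> e / 2" using N that by (intro w_le less_imp_le) auto
          then show ?thesis using w0[of n y] \<open>e > 0\<close> by simp
        qed
        then show "\<forall>\<^sub>F n in sequentially. dist (w n y) 0 < e"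
          unfolding eventually_sequentially by blast
      qed
    qed
  qed
qed

text \<open>Freezing all but one coordinate of a continuous functional gives functions that depend on the
  frozen coordinates continuously in the sense of \<open>conv\<close>, but in general not uniformly.\<close>

lemma tendsto_continuous_convergence:
  fixes u :: "nat \<Rightarrow> 'a::metric_space \<Rightarrow> real"
  assumes A: "sublinear_markov Cb A" and above: "continuous_from_above_op Cb A"
    and u: "\<And>n. continuous_on UNIV (u n)" "\<And>n y. \<bar>u n y\<bar> \<le> C"
    and v: "v \<in> Cb"
    and conv: "\<And>y. ((\<lambda>(n, z). u n z) \<longlongrightarrow> v y) (sequentially \<times>\<^sub>F nhds y)"
    and x: "x \<longlonglongrightarrow> x0"
  shows "(\<lambda>n. A (u n) (x n)) \<longlonglongrightarrow> A v x0"
proof -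
  obtain w where w: "\<And>n. w n \<in> Cb" "decreases_to w (\<lambda>_. 0)"
    "\<And>m n y. n \<le> m \<Longrightarrow> \<bar>u m y - v y\<bar> \<le> w n y"
    by (rule tail_sup[OF u v conv]) blast
  have u_in: "u n \<in> Cb" for n by (rule CbI[OF u])
  have near: "\<bar>A (u m) y - A v y\<bar> \<le> A (w n) y" if "n \<le> m" for m n y
  proof -
    have "A (u m) y - A v y \<le> A (\<lambda>y. u m y - v y) y"
      by (rule Cb.sublinear_markov_diff[OF A u_in v])
    also have "\<dots> \<le> A (w n) y"
      using w(3)[OF that] by (intro sublinear_markov_mono[OF A] Cb.diff u_in v w(1)) (rule abs_le_D1)
    finally have 1: "A (u m) y - A v y \<le> A (w n) y" .
    have "A v y - A (u m) y \<le> A (\<lambda>y. v y - u m y) y"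
      by (rule Cb.sublinear_markov_diff[OF A v u_in])
    also have "\<dots> \<le> A (w n) y"
      using w(3)[OF that] by (intro sublinear_markov_mono[OF A] Cb.diff u_in v w(1)) (metis abs_le_D2 minus_diff_eq)
    finally show ?thesis using 1 by linarith
  qed
  have lim: "(\<lambda>n. A f (x n)) \<longlonglongrightarrow> A f x0" if "f \<in> Cb" for f
  proof -
    have "isCont (A f) x0"
      using sublinear_markov_in[OF A that] by (simp add: Cb_def continuous_on_eq_continuous_at)
    then show ?thesis using x by (rule isCont_tendsto_compose)
  qed
  show ?thesis
  proof (rule tendstoI)
    fix e :: real assume e: "e > 0"
    have "(\<lambda>n. A (w n) x0) \<longlonglongrightarrow> 0"
      by (rule decreases_to_lim[OF continuous_from_above_opD[OF above w(1,2)]])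
    from order_tendstoD(2)[OF this, of "e/2"] e obtain n where "A (w n) x0 < e / 2"
      by (auto simp: eventually_sequentially)
    with lim[OF w(1)] have "\<forall>\<^sub>F m in sequentially. A (w n) (x m) < e / 2"
      by (rule order_tendstoD(2))
    moreover have "\<forall>\<^sub>F m in sequentially. dist (A v (x m)) (A v x0) < e / 2"
      using e by (intro tendstoD[OF lim[OF v]]) simp
    moreover note eventually_ge_at_top[of n]
    ultimately show "\<forall>\<^sub>F m in sequentially. dist (A (u m) (x m)) (A v x0) < e"
    proof eventually_elim
      case (elim m)
      then show ?case using near[of n m "x m"] unfolding dist_real_def by linarith
    qed
  qed
qed

section \<open>Cylinder functions\<close>

definition depends_on :: "((real \<Rightarrow> 'a) \<Rightarrow> 'b) \<Rightarrow> real set \<Rightarrow> bool" where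
  "depends_on f J \<longleftrightarrow> (\<forall>p p'. (\<forall>t\<in>J. p t = p' t) \<longrightarrow> f p = f p')"

text \<open>Paths are indexed by all real numbers, because the topology of the function type is then the
  product topology and continuity on path space is \<open>continuous_on UNIV\<close>. Only nonnegative times are
  allowed in \<open>Cyl\<close>.\<close>

definition cyl :: "real set \<Rightarrow> ((real \<Rightarrow> 'a::metric_space) \<Rightarrow> real) set" where
  "cyl J = {f. continuous_on UNIV f \<and> bounded (range f) \<and> depends_on f J}"

definition Cyl :: "((real \<Rightarrow> 'a::metric_space) \<Rightarrow> real) set" where
  "Cyl = (\<Union>J\<in>{J. finite J \<and> J \<subseteq> {0..}}. cyl J)"

lemma depends_onD: "depends_on f J \<Longrightarrow> (\<And>t. t \<in> J \<Longrightarrow> p t = p' t) \<Longrightarrow> f p = f p'"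
  by (simp add: depends_on_def)

lemma depends_on_upd: "depends_on f J \<Longrightarrow> t \<notin> J \<Longrightarrow> f (p(t := y)) = f p"
  by (erule depends_onD) auto

lemma cyl_mono: "J \<subseteq> K \<Longrightarrow> cyl J \<subseteq> cyl K"
  unfolding cyl_def depends_on_def by blast

lemma CylI: "f \<in> cyl J \<Longrightarrow> finite J \<Longrightarrow> J \<subseteq> {0..} \<Longrightarrow> f \<in> Cyl"
  unfolding Cyl_def by blast

lemma CylE:
  assumes "f \<in> Cyl"
  obtains J where "f \<in> cyl J" "finite J" "J \<subseteq> {0..}"
  using assms unfolding Cyl_def by blast

lemma cylI:
  assumes "continuous_on UNIV f" "\<And>p. \<bar>f p\<bar> \<le> C" "depends_on f J"
  shows "f \<in> cyl J"
  using assms unfolding cyl_def by (auto intro!: boundedI[of _ C])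

lemma cylD:
  assumes "f \<in> cyl J"
  shows "continuous_on UNIV f" "depends_on f J" "\<exists>C. \<forall>p. \<bar>f p\<bar> \<le> C"
  using assms unfolding cyl_def bounded_iff by auto

lemma cyl_combine:
  fixes g :: "real \<Rightarrow> real \<Rightarrow> real"
  assumes f: "f \<in> cyl J" and h: "h \<in> cyl J"
    and g: "continuous_on UNIV (\<lambda>z. g (fst z) (snd z))"
    and b: "\<And>C D. \<exists>B. \<forall>a b. \<bar>a\<bar> \<le> C \<longrightarrow> \<bar>b\<bar> \<le> D \<longrightarrow> \<bar>g a b\<bar> \<le> B"
  shows "(\<lambda>p. g (f p) (h p)) \<in> cyl J"
proof -
  obtain C D where C: "\<And>p. \<bar>f p\<bar> \<le> C" "\<And>p. \<bar>h p\<bar> \<le> D"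
    using cylD(3)[OF f] cylD(3)[OF h] by blast
  obtain B where B: "\<And>a b. \<bar>a\<bar> \<le> C \<Longrightarrow> \<bar>b\<bar> \<le> D \<Longrightarrow> \<bar>g a b\<bar> \<le> B"
    using b[of C D] by blast
  have "continuous_on UNIV (\<lambda>p. (\<lambda>z. g (fst z) (snd z)) (f p, h p))"
    by (rule continuous_on_compose2[OF g])
      (auto intro!: continuous_on_Pair cylD(1)[OF f] cylD(1)[OF h])
  moreover have "depends_on (\<lambda>p. g (f p) (h p)) J"
    using cylD(2)[OF f] cylD(2)[OF h] unfolding depends_on_def by metis
  ultimately show ?thesis using C by (intro cylI[of _ B] B) simp_all
qed

lemma cyl_const: "(\<lambda>_. c) \<in> cyl J"
  by (rule cylI[of _ "\<bar>c\<bar>"]) (auto simp: depends_on_def)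

lemma cyl_add: "f \<in> cyl J \<Longrightarrow> h \<in> cyl J \<Longrightarrow> (\<lambda>p. f p + h p) \<in> cyl J"
proof (rule cyl_combine[where g="(+)"], assumption+)
  show "\<exists>B. \<forall>a b. \<bar>a\<bar> \<le> C \<longrightarrow> \<bar>b\<bar> \<le> D \<longrightarrow> \<bar>a + b\<bar> \<le> B" for C D :: real
    by (rule exI[of _ "C + D"]) linarith
qed (intro continuous_intros)

lemma cyl_mult: "f \<in> cyl J \<Longrightarrow> h \<in> cyl J \<Longrightarrow> (\<lambda>p. f p * h p) \<in> cyl J"
proof (rule cyl_combine[where g="(*)"], assumption+)
  show "\<exists>B. \<forall>a b. \<bar>a\<bar> \<le> C \<longrightarrow> \<bar>b\<bar> \<le> D \<longrightarrow> \<bar>a * b\<bar> \<le> B" for C D :: real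
    by (rule exI[of _ "C * D"]) (auto simp: abs_mult intro: mult_mono')
qed (intro continuous_intros)

lemma cyl_max: "f \<in> cyl J \<Longrightarrow> h \<in> cyl J \<Longrightarrow> (\<lambda>p. max (f p) (h p)) \<in> cyl J"
proof (rule cyl_combine[where g="max"], assumption+)
  show "\<exists>B. \<forall>a b. \<bar>a\<bar> \<le> C \<longrightarrow> \<bar>b\<bar> \<le> D \<longrightarrow> \<bar>max a b\<bar> \<le> B" for C D :: real
    by (rule exI[of _ "max C D"]) linarith
qed (intro continuous_intros)

lemma cyl_coordinate:
  assumes "u \<in> Cb"
  shows "(\<lambda>p. u (p t)) \<in> cyl {t}"
proof -
  obtain C where C: "continuous_on UNIV u" "\<And>x. \<bar>u x\<bar> \<le> C" using assms by (rule CbE) blast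
  have "continuous_on UNIV (\<lambda>p. u (p t))"
    by (rule continuous_on_compose2[OF C(1)]) (auto intro: continuous_on_product_coordinates)
  then show ?thesis using C(2) by (intro cylI[of _ C]) (auto simp: depends_on_def)
qed

interpretation cyl: function_space "cyl J"
proof
  fix u :: "(real \<Rightarrow> 'a) \<Rightarrow> real" and c assume "u \<in> cyl J"
  then show "(\<lambda>x. c * u x) \<in> cyl J"
    using cyl_mult[OF cyl_const] by blast
qed (auto intro: cyl_const cyl_add)

lemma Cyl_common:
  assumes "f \<in> Cyl" "h \<in> Cyl"
  obtains J where "f \<in> cyl J" "h \<in> cyl J" "finite J" "J \<subseteq> {0..}"
proof -
  obtain J K where "f \<in> cyl J" "finite J" "J \<subseteq> {0..}" "h \<in> cyl K" "finite K" "K \<subseteq> {0..}"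
    using assms by (meson CylE)
  moreover from this have "f \<in> cyl (J \<union> K)" "h \<in> cyl (J \<union> K)"
    using cyl_mono[of J "J \<union> K"] cyl_mono[of K "J \<union> K"] by auto
  ultimately show thesis by (intro that[of "J \<union> K"]) auto
qed

interpretation Cyl: function_space Cyl
proof
  fix f h :: "(real \<Rightarrow> 'a) \<Rightarrow> real" and c :: real
  show "(\<lambda>_. c) \<in> Cyl" by (rule CylI[of _ "{}"]) (auto intro: cyl_const)
  assume f: "f \<in> Cyl"
  show "(\<lambda>x. c * f x) \<in> Cyl"
    using f by (rule CylE) (blast intro: CylI cyl.cmult)
  assume "h \<in> Cyl"
  with f show "(\<lambda>x. f x + h x) \<in> Cyl"
    by (rule Cyl_common) (blast intro: CylI cyl_add)
qed

lemma Cyl_mult: "f \<in> Cyl \<Longrightarrow> h \<in> Cyl \<Longrightarrow> (\<lambda>p. f p * h p) \<in> Cyl"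
  by (rule Cyl_common, assumption+) (blast intro: CylI cyl_mult)

lemma Cyl_max: "f \<in> Cyl \<Longrightarrow> h \<in> Cyl \<Longrightarrow> (\<lambda>p. max (f p) (h p)) \<in> Cyl"
  by (rule Cyl_common, assumption+) (blast intro: CylI cyl_max)

lemma Cyl_bounded: "f \<in> Cyl \<Longrightarrow> \<exists>C. \<forall>p. \<bar>f p\<bar> \<le> C"
  by (auto elim: CylE dest: cylD)

lemma tendsto_fun:
  fixes X :: "'b \<Rightarrow> 'i \<Rightarrow> 'a::topological_space"
  assumes "\<And>i. ((\<lambda>n. X n i) \<longlongrightarrow> p i) F"
  shows "(X \<longlongrightarrow> p) F"
proof -
  have "limitin (product_topology (\<lambda>_. euclidean) UNIV) X p F"
    using assms by (simp add: limitin_componentwise limitin_canonical_iff)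
  then show ?thesis
    by (simp add: euclidean_product_topology limitin_canonical_iff)
qed

text \<open>A function of finitely many coordinates factors through the metrizable space of sequences,
  so that its continuity can be checked on sequences.\<close>

lemma continuous_on_depends_on:
  fixes f :: "(real \<Rightarrow> 'a::metric_space) \<Rightarrow> real"
  assumes J: "finite J" "depends_on f J"
    and seq: "\<And>X p. (\<And>t. (\<lambda>n. X n t) \<longlonglongrightarrow> p t) \<Longrightarrow> (\<lambda>n. f (X n)) \<longlonglongrightarrow> f p"
  shows "continuous_on UNIV f"
proof (cases "J = {}")
  case True
  then have "f = (\<lambda>_. f undefined)" using J(2) by (auto simp: depends_on_def)
  then show ?thesis by (metis continuous_on_const)
next
  case False
  define \<tau> where "\<tau> = from_nat_into J"
  define \<iota> :: "(nat \<Rightarrow> 'a) \<Rightarrow> real \<Rightarrow> 'a" where "\<iota> z t = z (to_nat_on J t)" for z t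
  have "\<tau> (to_nat_on J t) = t" if "t \<in> J" for t
    unfolding \<tau>_def using that J(1) by (simp add: from_nat_into_to_nat_on countable_finite)
  then have f: "f p = f (\<iota> (\<lambda>n. p (\<tau> n)))" for p
    by (intro depends_onD[OF J(2)]) (simp add: \<iota>_def)
  have "continuous_on UNIV (f \<circ> \<iota>)"
  proof (rule continuous_at_imp_continuous_on, intro ballI)
    fix z
    show "isCont (f \<circ> \<iota>) z"
      unfolding continuous_at_sequentially
    proof (intro allI impI)
      fix Z :: "nat \<Rightarrow> nat \<Rightarrow> 'a" assume Z: "Z \<longlonglongrightarrow> z"
      have "(\<lambda>n. Z n i) \<longlonglongrightarrow> z i" for i
        using continuous_on_tendsto_compose[OF continuous_on_product_coordinates Z, of i] by simp
      then show "(f \<circ> \<iota> \<circ> Z) \<longlonglongrightarrow> (f \<circ> \<iota>) z"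
        using seq[of "\<lambda>n. \<iota> (Z n)" "\<iota> z"] by (simp add: o_def \<iota>_def)
    qed
  qed
  then have "continuous_on UNIV (\<lambda>p. (f \<circ> \<iota>) (\<lambda>n. p (\<tau> n)))"
    by (rule continuous_on_compose2)
      (auto intro!: continuous_on_coordinatewise_then_product continuous_on_product_coordinates)
  then show ?thesis using f by (simp add: o_def)
qed

section \<open>The operators on path functionals\<close>

text \<open>The conditional expectation at time \<open>s\<close> of a functional that depends on the times up to \<open>s\<close>
  and on a single later time \<open>t\<close>.\<close>

definition cond_op ::
    "(real \<Rightarrow> ('a \<Rightarrow> real) \<Rightarrow> 'a \<Rightarrow> real) \<Rightarrow> real \<Rightarrow> real \<Rightarrow> ((real \<Rightarrow> 'a) \<Rightarrow> real) \<Rightarrow> (real \<Rightarrow> 'a) \<Rightarrow> real" where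
  "cond_op T s t f p = T (t - s) (\<lambda>y. f (p(t := y))) (p s)"

text \<open>All variables except the one at the first time are integrated out, the last one first.\<close>

fun path_op ::
    "(real \<Rightarrow> ('a \<Rightarrow> real) \<Rightarrow> 'a \<Rightarrow> real) \<Rightarrow> real list \<Rightarrow> ((real \<Rightarrow> 'a) \<Rightarrow> real) \<Rightarrow> (real \<Rightarrow> 'a) \<Rightarrow> real" where
  "path_op T [] f = f"
| "path_op T [s] f = f"
| "path_op T (s # t # ts) f = cond_op T s t (path_op T (t # ts) f)"

lemma section_in_Cb:
  fixes f :: "(real \<Rightarrow> 'a::metric_space) \<Rightarrow> real"
  assumes "f \<in> cyl J"
  shows "(\<lambda>y. f (p(t := y))) \<in> Cb"
proof -
  obtain C where C: "\<And>p. \<bar>f p\<bar> \<le> C" using cylD(3)[OF assms] by blast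
  have "continuous_on UNIV (\<lambda>y. p(t := y))"
  proof (rule continuous_on_coordinatewise_then_product)
    show "continuous_on UNIV (\<lambda>y. (p(t := y)) i)" for i
      by (cases "i = t") (auto intro!: continuous_intros)
  qed
  then have "continuous_on UNIV (\<lambda>y. f (p(t := y)))"
    by (intro continuous_on_compose2[OF cylD(1)[OF assms]]) auto
  then show ?thesis by (rule CbI) (rule C)
qed

lemma depends_on_cond_op:
  assumes "depends_on f K"
  shows "depends_on (cond_op T s t f) (insert s (K - {t}))"
  unfolding depends_on_def
proof (intro allI impI)
  fix p p' :: "real \<Rightarrow> 'a" assume eq: "\<forall>r\<in>insert s (K - {t}). p r = p' r"
  then have "f (p(t := y)) = f (p'(t := y))" for y
    by (intro depends_onD[OF assms]) auto
  then show "cond_op T s t f p = cond_op T s t f p'"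
    using eq by (simp add: cond_op_def)
qed

context Cb_semigroup
begin

text \<open>Moving the path moves both the point of evaluation and the section of \<open>f\<close>. The sections converge
  continuously because \<open>f\<close> is continuous.\<close>

lemma cond_op_in_cyl:
  assumes f: "f \<in> cyl K" and K: "finite K" and st: "s \<le> t"
  shows "cond_op T s t f \<in> cyl (insert s (K - {t}))"
proof -
  have h: "t - s \<ge> 0" using st by simp
  obtain C where C: "\<And>p. \<bar>f p\<bar> \<le> C" using cylD(3)[OF f] by blast
  have "continuous_on UNIV (cond_op T s t f)"
  proof (rule continuous_on_depends_on[OF _ depends_on_cond_op[OF cylD(2)[OF f]]])
    fix X :: "nat \<Rightarrow> real \<Rightarrow> 'a" and p assume X: "\<And>r. (\<lambda>n. X n r) \<longlonglongrightarrow> p r"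
    show "(\<lambda>n. cond_op T s t f (X n)) \<longlonglongrightarrow> cond_op T s t f p"
      unfolding cond_op_def
    proof (rule tendsto_continuous_convergence[OF markov[OF h] above[OF h] _ C section_in_Cb[OF f] _ X])
      show "continuous_on UNIV (\<lambda>y. f ((X n)(t := y)))" for n
        using section_in_Cb[OF f, of "X n" t] by (simp add: Cb_def)
      fix y
      have "((\<lambda>q. (X (fst q))(t := snd q)) \<longlongrightarrow> p(t := y)) (sequentially \<times>\<^sub>F nhds y)"
      proof (rule tendsto_fun)
        fix i
        show "((\<lambda>q. ((X (fst q))(t := snd q)) i) \<longlongrightarrow> (p(t := y)) i) (sequentially \<times>\<^sub>F nhds y)"
          using filterlim_compose[OF X[of i] filterlim_fst] filterlim_snd[of "nhds y" sequentially]
          by (cases "i = t") auto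
      qed
      then have "((\<lambda>q. f ((X (fst q))(t := snd q))) \<longlongrightarrow> f (p(t := y))) (sequentially \<times>\<^sub>F nhds y)"
        by (intro continuous_on_tendsto_compose[OF cylD(1)[OF f]]) auto
      then show "((\<lambda>(n, z). f ((X n)(t := z))) \<longlongrightarrow> f (p(t := y))) (sequentially \<times>\<^sub>F nhds y)"
        by (simp only: case_prod_unfold)
    qed
  qed (use K in auto)
  moreover have "\<bar>cond_op T s t f p\<bar> \<le> C" for p
    unfolding cond_op_def
    by (rule Cb.sublinear_markov_abs_le[OF markov[OF h] section_in_Cb[OF f] C])
  ultimately show ?thesis
    by (rule cylI) (rule depends_on_cond_op[OF cylD(2)[OF f]])
qed

lemma section_in_Cb': "f \<in> Cyl \<Longrightarrow> (\<lambda>y. f (p(t := y))) \<in> Cb"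
  by (auto elim!: CylE intro: section_in_Cb)

lemma cond_op_markov:
  assumes st: "0 \<le> s" "s \<le> t"
  shows "sublinear_markov Cyl (cond_op T s t)"
proof (rule Cyl.sublinear_markovI)
  have h: "t - s \<ge> 0" using st by simp
  note m = markov[OF h]
  fix f g :: "(real \<Rightarrow> 'a) \<Rightarrow> real" and c :: real and p assume f: "f \<in> Cyl"
  show "cond_op T s t f \<in> Cyl"
    using f
  proof (rule CylE)
    fix J assume "f \<in> cyl J" "finite J" "J \<subseteq> {0..}"
    then show ?thesis
      using st by (intro CylI[OF cond_op_in_cyl[of f J]]) auto
  qed
  note [intro] = section_in_Cb'[OF f]
  show "cond_op T s t (\<lambda>p. f p + g p) p \<le> cond_op T s t f p + cond_op T s t g p" if "g \<in> Cyl"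
    unfolding cond_op_def using section_in_Cb'[OF that] by (intro sublinear_markov_add[OF m]) auto
  show "cond_op T s t (\<lambda>p. c * f p) p \<le> c * cond_op T s t f p" if "c > 0"
    unfolding cond_op_def using that sublinear_markov_cmult[OF m section_in_Cb'[OF f] that] by simp
  show "cond_op T s t f p \<le> cond_op T s t g p" if "g \<in> Cyl" "\<And>p. f p \<le> g p"
    unfolding cond_op_def using section_in_Cb'[OF that(1)] that(2) by (intro sublinear_markov_mono[OF m]) auto
qed (use st in \<open>simp add: cond_op_def sublinear_markov_const[OF markov]\<close>)

lemma cond_op_above:
  assumes st: "0 \<le> s" "s \<le> t"
  shows "continuous_from_above_op Cyl (cond_op T s t)"
  unfolding continuous_from_above_op_def
proof (intro allI impI; elim conjE)
  fix fs :: "nat \<Rightarrow> (real \<Rightarrow> 'a) \<Rightarrow> real"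
  assume fs: "\<forall>n. fs n \<in> Cyl" and dec: "decreases_to fs (\<lambda>_. 0)"
  have "decreases_to (\<lambda>n y. fs n (p(t := y))) (\<lambda>_. 0)" for p
    using decreases_to_Suc[OF dec] decreases_to_lim[OF dec] by (intro decreases_toI) auto
  then have d: "decreases_to (\<lambda>n. T (t - s) (\<lambda>y. fs n (p(t := y)))) (\<lambda>_. 0)" for p
    using st by (intro continuous_from_above_opD[OF above section_in_Cb'[OF fs[rule_format]]]) auto
  show "decreases_to (\<lambda>n. cond_op T s t (fs n)) (\<lambda>_. 0)"
    unfolding cond_op_def by (intro decreases_toI decreases_to_Suc[OF d] decreases_to_lim[OF d])
qed

lemma path_op_markov:
  assumes "increasing_list xs" "0 \<le> hd xs"
  shows "sublinear_markov Cyl (path_op T xs) \<and> continuous_from_above_op Cyl (path_op T xs)"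
  using assms
proof (induction xs rule: induct_list012)
  case (2 s)
  then show ?case using Cyl.sublinear_markov_id by (simp add: continuous_from_above_op_def)
next
  case (3 s t ts)
  have st: "0 \<le> s" "s \<le> t" and inc: "increasing_list (t # ts)" "0 \<le> hd (t # ts)"
    using "3.prems" by auto
  have eq: "path_op T (s # t # ts) = (\<lambda>f. cond_op T s t (path_op T (t # ts) f))"
    by (simp add: fun_eq_iff)
  have IH: "sublinear_markov Cyl (path_op T (t # ts))" "continuous_from_above_op Cyl (path_op T (t # ts))"
    using "3.IH"(2)[OF inc] by auto
  have "continuous_from_above_op Cyl (\<lambda>f. cond_op T s t (path_op T (t # ts) f))"
    unfolding continuous_from_above_op_def
    using continuous_from_above_opD[OF cond_op_above[OF st] sublinear_markov_in[OF IH(1)]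
        continuous_from_above_opD[OF IH(2)]] by blast
  then show ?case
    unfolding eq using Cyl.sublinear_markov_comp[OF cond_op_markov[OF st] IH(1)] by blast
qed simp

lemma path_op_in_cyl:
  assumes "increasing_list xs" "f \<in> cyl K" "finite K"
  shows "path_op T xs f \<in> cyl (insert (hd xs) (K - set (tl xs)))"
  using assms(1)
proof (induction xs rule: induct_list012)
  case (2 s)
  then show ?case using assms(2) cyl_mono[of K "insert s K"] by auto
next
  case (3 s t ts)
  have st: "s \<le> t" and inc: "increasing_list (t # ts)" using "3.prems" by auto
  let ?K = "insert t (K - set ts)"
  have "path_op T (t # ts) f \<in> cyl ?K" using "3.IH"(2)[OF inc] by simp
  then have "cond_op T s t (path_op T (t # ts) f) \<in> cyl (insert s (?K - {t}))"
    using assms(3) st by (intro cond_op_in_cyl) auto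
  moreover have "insert s (?K - {t}) = insert s (K - set (t # ts))" by auto
  ultimately show ?case by simp
qed simp

text \<open>The Chapman-Kolmogorov relation: a time on which \<open>g\<close> does not depend can be skipped.\<close>

lemma cond_op_cond_op:
  assumes g: "g \<in> cyl K" and r: "r \<notin> K" "s < r" "r < t"
  shows "cond_op T s r (cond_op T r t g) = cond_op T s t g"
proof
  fix p
  have upd: "g (p(r := z, t := y)) = g (p(t := y))" for z y
    using r by (intro depends_onD[OF cylD(2)[OF g]]) auto
  have "cond_op T s r (cond_op T r t g) p = T (r - s) (\<lambda>z. T (t - r) (\<lambda>y. g (p(t := y))) z) (p s)"
    unfolding cond_op_def by (simp add: upd)
  also have "\<dots> = T ((r - s) + (t - r)) (\<lambda>y. g (p(t := y))) (p s)"
    using r by (subst add[OF _ _ section_in_Cb[OF g]]) auto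
  finally show "cond_op T s r (cond_op T r t g) p = cond_op T s t g p"
    by (simp add: cond_op_def)
qed

text \<open>A new time between two others is skipped by \<open>cond_op_cond_op\<close>. A new last time is harmless because
  the section of \<open>f\<close> there is constant and constants are preserved.\<close>

lemma path_op_insort:
  assumes "increasing_list xs" "hd xs < r" "r \<notin> set xs"
    and f: "f \<in> cyl K" "finite K" "r \<notin> K"
  shows "path_op T (insort r xs) f = path_op T xs f"
  using assms(1-3)
proof (induction xs rule: induct_list012)
  case (2 s)
  then have "cond_op T s r f = f"
    using sublinear_markov_const[OF markov, of "r - s"]
    by (auto simp: cond_op_def fun_eq_iff depends_on_upd[OF cylD(2)[OF f(1)] f(3)])
  then show ?case using 2 by simp
next
  case (3 s t ts)
  have inc: "increasing_list (t # ts)" "s < t" using "3.prems" by auto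
  show ?case
  proof (cases "r < t")
    case True
    have "path_op T (t # ts) f \<in> cyl (insert t (K - set ts))"
      using path_op_in_cyl[OF inc(1) f(1,2)] by simp
    from cond_op_cond_op[OF this]
    have "cond_op T s r (cond_op T r t (path_op T (t # ts) f)) = cond_op T s t (path_op T (t # ts) f)"
      using True f(3) "3.prems" by auto
    then show ?thesis using True "3.prems" by simp
  next
    case False
    then have tr: "t < r" using "3.prems" by auto
    have ins: "insort r (t # ts) = t # insort r ts" "insort r (s # t # ts) = s # insort r (t # ts)"
      using tr inc by auto
    have "path_op T (insort r (t # ts)) f = path_op T (t # ts) f"
      using "3.prems" tr inc by (intro "3.IH"(2)) auto
    then show ?thesis by (simp only: ins path_op.simps)
  qed
qed simp

abbreviation times :: "real set \<Rightarrow> real list" where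
  "times J \<equiv> sorted_list_of_set J"

lemma times_props:
  assumes "finite J" "0 \<in> J" "J \<subseteq> {0..}"
  shows "increasing_list (times J)" "hd (times J) = 0"
proof -
  have "J \<in> partitions (Max J)" using assms by (simp add: partitions_def)
  then show "increasing_list (times J)" "hd (times J) = 0"
    by (rule sorted_list_of_partition)+
qed

lemma path_op_consistent:
  assumes J: "finite J" "0 \<in> J" "J \<subseteq> {0..}" and f: "f \<in> cyl J"
    and K: "finite K" "K \<subseteq> {0..}"
  shows "path_op T (times (J \<union> K)) f = path_op T (times J) f"
  using K
proof (induction K rule: finite_induct)
  case (insert r K)
  show ?case
  proof (cases "r \<in> J \<union> K")
    case True
    then show ?thesis using insert by (simp add: insert_absorb)
  next
    case False
    note t = times_props[of "J \<union> K"]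
    have "path_op T (times (insert r (J \<union> K))) f = path_op T (times (J \<union> K)) f"
      using insert J f False t
      by (subst sorted_list_of_set_insert, simp, simp)
        (rule path_op_insort[OF _ _ _ f J(1)], auto simp: less_le)
    then show ?thesis using insert by simp
  qed
qed simp

lemma path_op_snoc:
  "xs \<noteq> [] \<Longrightarrow> path_op T (xs @ [t]) f = path_op T xs (cond_op T (last xs) t f)"
  by (induction xs rule: induct_list012) auto

end

section \<open>Sublinear functionals\<close>

locale sublinear_functional = function_space D for D :: "('a \<Rightarrow> real) set" +
  fixes p :: "('a \<Rightarrow> real) \<Rightarrow> real"
  assumes sub_add: "f \<in> D \<Longrightarrow> g \<in> D \<Longrightarrow> p (\<lambda>x. f x + g x) \<le> p f + p g"
    and homogeneous: "f \<in> D \<Longrightarrow> c > 0 \<Longrightarrow> p (\<lambda>x. c * f x) = c * p f"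
    and mono: "f \<in> D \<Longrightarrow> g \<in> D \<Longrightarrow> (\<And>x. f x \<le> g x) \<Longrightarrow> p f \<le> p g"
    and p_const: "p (\<lambda>_. c) = c"
begin

lemma sub_sum:
  "finite I \<Longrightarrow> (\<And>i. i \<in> I \<Longrightarrow> f i \<in> D) \<Longrightarrow> p (\<lambda>x. \<Sum>i\<in>I. f i x) \<le> (\<Sum>i\<in>I. p (f i))"
proof (induction I rule: finite_induct)
  case (insert j I)
  have "p (\<lambda>x. f j x + (\<Sum>i\<in>I. f i x)) \<le> p (f j) + p (\<lambda>x. \<Sum>i\<in>I. f i x)"
    using insert by (intro sub_add sum) auto
  then show ?case using insert by simp
qed (simp add: p_const)

end

section \<open>Tightness\<close>

lemma open_cozero:
  fixes U :: "'a::metric_space set"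
  assumes "open U"
  obtains \<phi> :: "'a \<Rightarrow> real" where "continuous_on UNIV \<phi>" "\<And>x. 0 \<le> \<phi> x" "\<And>x. 0 < \<phi> x \<longleftrightarrow> x \<in> U"
proof (cases "U = UNIV")
  \<comment> \<open>the distance to the empty complement is zero by convention\<close>
  case True
  then show ?thesis by (intro that[of "\<lambda>_. 1"]) auto
next
  case False
  have "0 < infdist x (- U) \<longleftrightarrow> x \<in> U" for x
    using in_closed_iff_infdist_zero[of "- U" x] assms False infdist_nonneg[of x "- U"]
    by (auto simp: less_le)
  then show ?thesis
    by (intro that[of "\<lambda>x. infdist x (- U)"]) (auto intro!: continuous_intros infdist_nonneg)
qed

text \<open>With \<open>\<phi> i > 0\<close> exactly on \<open>U i\<close>, the sums of the first \<open>\<phi> i\<close> are eventually bounded below by a positive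
  number at every point, so that for large \<open>n\<close> they exceed \<open>1\<close> after multiplication by \<open>n\<close>.\<close>

lemma countable_cover_functions:
  fixes U :: "nat \<Rightarrow> 'a::metric_space set"
  assumes U: "\<And>i. open (U i)" "(\<Union>i. U i) = UNIV"
  obtains h where "\<And>n. h n \<in> Cb" "\<And>n x. 0 \<le> h n x" "decreases_to h (\<lambda>_. 0)"
    "\<And>n x. x \<notin> (\<Union>i\<le>n. U i) \<Longrightarrow> h n x = 1"
proof -
  have "\<exists>\<phi>::'a \<Rightarrow> real. continuous_on UNIV \<phi> \<and> (\<forall>x. 0 \<le> \<phi> x) \<and> (\<forall>x. 0 < \<phi> x \<longleftrightarrow> x \<in> U i)" for i
    by (rule open_cozero[OF U(1)[of i]]) blast
  then obtain \<phi> :: "nat \<Rightarrow> 'a \<Rightarrow> real" where \<phi>: "\<And>i. continuous_on UNIV (\<phi> i)" "\<And>i x. 0 \<le> \<phi> i x"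
    "\<And>i x. 0 < \<phi> i x \<longleftrightarrow> x \<in> U i"
    by metis
  define h where "h n x = max 0 (1 - real n * (\<Sum>i\<le>n. \<phi> i x))" for n x
  have s0: "0 \<le> (\<Sum>i\<le>n. \<phi> i x)" for n x by (intro sum_nonneg \<phi>)
  show thesis
  proof
    show "h n \<in> Cb" for n
    proof (rule CbI[of _ 1])
      show "continuous_on UNIV (h n)"
        unfolding h_def by (intro continuous_intros \<phi>)
      show "\<bar>h n x\<bar> \<le> 1" for x
        using s0[where n=n and x=x] by (simp add: h_def)
    qed
    show "0 \<le> h n x" for n x by (simp add: h_def)
    show "h n x = 1" if "x \<notin> (\<Union>i\<le>n. U i)" for n x
    proof -
      have "\<phi> i x = 0" if "i \<le> n" for i
        using \<open>x \<notin> (\<Union>i\<le>n. U i)\<close> that \<phi>(2)[of i x] \<phi>(3)[of i x] by fastforce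
      then show ?thesis by (simp add: h_def)
    qed
    show "decreases_to h (\<lambda>_. 0)"
    proof (rule decreases_toI)
      fix n x
      have "real n * (\<Sum>i\<le>n. \<phi> i x) \<le> real (Suc n) * (\<Sum>i\<le>Suc n. \<phi> i x)"
        using \<phi>(2) s0 by (intro mult_mono sum_mono2) auto
      then show "h (Suc n) x \<le> h n x" unfolding h_def by (intro max.mono diff_left_mono) auto
    next
      fix x
      obtain k where "x \<in> U k" using U(2) by blast
      then have k: "0 < \<phi> k x" using \<phi>(3) by simp
      obtain N where N: "1 < real N * \<phi> k x" using reals_Archimedean3[OF k] by blast
      have "h n x = 0" if n: "n \<ge> max N k" for n
      proof -
        have "\<phi> k x \<le> (\<Sum>i\<le>n. \<phi> i x)"
          using n by (intro member_le_sum \<phi>) auto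
        then have "real N * \<phi> k x \<le> real n * (\<Sum>i\<le>n. \<phi> i x)"
          using n k by (intro mult_mono) auto
        then show ?thesis using N by (simp add: h_def)
      qed
      then show "(\<lambda>n. h n x) \<longlonglongrightarrow> 0"
        by (intro tendsto_eventually eventually_sequentiallyI[of "max N k"])
    qed
  qed
qed

text \<open>Ulam's theorem, stated for a functional in place of a measure. For each \<open>j\<close>, finitely many balls of
  radius \<open>1 / (j + 1)\<close> carry everything up to an error \<open>\<epsilon> / 2\<^sup>j\<close>, and the points that lie in these balls
  for all \<open>j\<close> form a totally bounded set. The balls refer to a complete metric \<open>d\<close>, while the functions
  \<open>h\<close> are built from the metric of the type.\<close>

lemma tight_functions:
  fixes q :: "('a::{metric_space, second_countable_topology} \<Rightarrow> real) \<Rightarrow> real"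
  assumes Polish: "completely_metrizable_space (euclidean :: 'a topology)"
    and q: "\<And>h. (\<And>n. h n \<in> Cb) \<Longrightarrow> decreases_to h (\<lambda>_. 0) \<Longrightarrow> (\<lambda>n. q (h n)) \<longlonglongrightarrow> 0"
    and \<epsilon>: "\<epsilon> > 0"
  obtains K g where "compact K" "\<And>j. g j \<in> Cb" "\<And>j x. 0 \<le> g j x"
    "\<And>j. q (g j) \<le> \<epsilon> * (1/2) ^ j" "\<And>x. x \<notin> K \<Longrightarrow> \<exists>j. g j x = 1"
proof -
  obtain M d where "Metric_space M d" and complete: "Metric_space.mcomplete M d"
    and top: "(euclidean :: 'a topology) = Metric_space.mtopology M d"
    using Polish unfolding completely_metrizable_space_def by blast
  then interpret Metric_space M d by simp
  have M: "x \<in> M" for x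
    using arg_cong[OF top, of topspace] by simp
  have open_mball: "open (mball x r)" for x r
    using openin_mball[of x r] by (simp add: flip: top)
  obtain Q :: "'a set" where Q: "countable Q" "\<And>X. open X \<Longrightarrow> X \<noteq> {} \<Longrightarrow> \<exists>x\<in>Q. x \<in> X"
    using countable_dense_exists by blast
  have "Q \<noteq> {}" using Q(2)[of UNIV] by auto
  define e where "e = from_nat_into Q"
  have e: "range e = Q" unfolding e_def using Q(1) \<open>Q \<noteq> {}\<close> by (simp add: range_from_nat_into)
  define U where "U j i = mball (e i) (1 / real (Suc j))" for j i
  have U_open: "open (U j i)" for j i
    unfolding U_def by (rule open_mball)
  have cover: "(\<Union>i. U j i) = UNIV" for j
  proof -
    have "x \<in> (\<Union>i. U j i)" for x
    proof -
      have "x \<in> mball x (1 / real (Suc j))" by (simp add: M del: of_nat_Suc)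
      then obtain y where "y \<in> Q" "y \<in> mball x (1 / real (Suc j))"
        using Q(2)[OF open_mball, of x "1 / real (Suc j)"] by blast
      then show ?thesis using e by (auto simp: U_def M commute)
    qed
    then show ?thesis by auto
  qed
  have "\<exists>N g. g \<in> Cb \<and> (\<forall>x. 0 \<le> g x) \<and> q g \<le> \<epsilon> * (1/2) ^ j \<and> (\<forall>x. x \<notin> (\<Union>i\<le>N. U j i) \<longrightarrow> g x = 1)"
    for j
  proof -
    obtain h where h: "\<And>n. h n \<in> Cb" "\<And>n x. 0 \<le> h n x" "decreases_to h (\<lambda>_. 0)"
      "\<And>n x. x \<notin> (\<Union>i\<le>n. U j i) \<Longrightarrow> h n x = 1"
      by (rule countable_cover_functions[OF U_open cover, of j]) blast
    have "\<epsilon> * (1/2) ^ j > 0" using \<epsilon> by simp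
    from order_tendstoD(2)[OF q[OF h(1,3)] this] obtain n where "q (h n) < \<epsilon> * (1/2) ^ j"
      by (auto simp: eventually_sequentially)
    then show ?thesis using h(1,2,4) by (intro exI[of _ n] exI[of _ "h n"]) auto
  qed
  then obtain N g where g: "\<And>j. g j \<in> Cb" "\<And>j x. 0 \<le> g j x" "\<And>j. q (g j) \<le> \<epsilon> * (1/2) ^ j"
    "\<And>j x. x \<notin> (\<Union>i\<le>N j. U j i) \<Longrightarrow> g j x = 1"
    by metis
  define S where "S = {x. \<forall>j. x \<in> (\<Union>i\<le>N j. U j i)}"
  have "mtotally_bounded S"
    unfolding mtotally_bounded_def
  proof (intro allI impI)
    fix r :: real assume "r > 0"
    then obtain j where j: "1 / real (Suc j) < r / 2"
      using reals_Archimedean[of "r/2"] by (auto simp: inverse_eq_divide)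
    \<comment> \<open>the centres \<open>e i\<close> need not lie in \<open>S\<close>, so points of \<open>S\<close> in the same balls replace them\<close>
    define I where "I = {i. i \<le> N j \<and> S \<inter> U j i \<noteq> {}}"
    have "\<forall>i\<in>I. \<exists>s. s \<in> S \<inter> U j i" by (auto simp: I_def)
    then obtain s where s: "\<And>i. i \<in> I \<Longrightarrow> s i \<in> S \<inter> U j i" by metis
    have "x \<in> (\<Union>y\<in>s ` I. mball y r)" if x: "x \<in> S" for x
    proof -
      obtain i where i: "i \<le> N j" "x \<in> U j i" using x unfolding S_def by blast
      then have "i \<in> I" using x by (auto simp: I_def)
      have "d (e i) x < r / 2" "d (e i) (s i) < r / 2"
        using i s[OF \<open>i \<in> I\<close>] j by (auto simp: U_def)
      then have "d (s i) x < r"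
        using triangle[of "s i" "e i" x] commute[of "s i" "e i"] by (simp add: M)
      then show ?thesis using \<open>i \<in> I\<close> by (auto simp: M)
    qed
    then show "\<exists>K. finite K \<and> K \<subseteq> S \<and> S \<subseteq> (\<Union>x\<in>K. mball x r)"
      using s by (intro exI[of _ "s ` I"]) (auto simp: I_def)
  qed
  then have "compactin mtopology (mtopology closure_of S)"
    using mtotally_bounded_eq_compact_closure_of[OF complete] by blast
  then have "compact (closure S)"
    by (simp flip: top)
  moreover have "\<exists>j. g j x = 1" if "x \<notin> closure S" for x
  proof -
    have "x \<notin> S" using that closure_subset by blast
    then show ?thesis using g(4) unfolding S_def by blast
  qed
  ultimately show thesis using that[of "closure S" g] g by blast
qed

section \<open>Continuity from above on all cylinder functions\<close>

locale cylinder_functional = sublinear_functional Cyl p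
    for p :: "((real \<Rightarrow> 'a::{metric_space, second_countable_topology}) \<Rightarrow> real) \<Rightarrow> real" +
  assumes Polish: "completely_metrizable_space (euclidean :: 'a topology)"
    and above_cyl: "finite J \<Longrightarrow> J \<subseteq> {0..} \<Longrightarrow> (\<And>n. f n \<in> cyl J) \<Longrightarrow> decreases_to f (\<lambda>_. 0) \<Longrightarrow>
      (\<lambda>n. p (f n)) \<longlonglongrightarrow> 0"
begin

text \<open>If the supports of the \<open>f n\<close> increase, then up to a small error all coordinates lie in
  compact sets, and on the product of these sets the convergence is uniform by Tychonoff's
  theorem and Dini's argument. The errors at the countably many times involved are summable.\<close>

lemma above:
  assumes f: "\<And>n. f n \<in> Cyl" and dec: "decreases_to f (\<lambda>_. 0)"
  shows "(\<lambda>n. p (f n)) \<longlonglongrightarrow> 0"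
proof -
  have "\<exists>J. f n \<in> cyl J \<and> finite J \<and> J \<subseteq> {0..}" for n
    using f[of n] by (rule CylE) blast
  then obtain J where J: "\<And>n. f n \<in> cyl (J n)" "\<And>n. finite (J n)" "\<And>n. J n \<subseteq> {0..}"
    by metis
  define I where "I = (\<Union>n. J n)"
  have I: "countable I" "I \<subseteq> {0..}"
    unfolding I_def using J(2,3) by (auto intro: countable_finite)
  obtain C where C: "\<And>x. \<bar>f 0 x\<bar> \<le> C" using Cyl_bounded[OF f] by blast
  have f_le: "f n x \<le> C" for n x
    using decseqD[OF decreases_to_decseq[OF dec], of 0 n x] abs_le_D1[OF C[of x]] by simp
  have f_ge: "0 \<le> f n x" for n x using decreases_to_ge[OF dec] .
  have p_ge: "0 \<le> p (f n)" for n
    using mono[OF const f f_ge, of n] by (simp add: p_const)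
  have C0: "0 \<le> C" using f_le[of 0 undefined] f_ge[of 0 undefined] by linarith
  have small: "\<exists>n. p (f n) \<le> \<epsilon> + C * (4 * \<epsilon>) + \<epsilon>" if \<epsilon>: "\<epsilon> > 0" for \<epsilon>
  proof -
    define w where "w t = (1/2::real) ^ to_nat_on I t" for t
    define R where "R t K g \<longleftrightarrow> compact K \<and> (\<forall>j. g j \<in> Cb) \<and> (\<forall>j x. 0 \<le> g j x) \<and>
        (\<forall>j. p (\<lambda>\<omega>. g j (\<omega> t)) \<le> (\<epsilon> * w t) * (1/2) ^ j) \<and> (\<forall>x. x \<notin> K \<longrightarrow> (\<exists>j. g j x = 1))"
      for t K and g :: "nat \<Rightarrow> 'a \<Rightarrow> real"
    have "\<exists>K g. R t K g" if "t \<in> I" for t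
    proof (rule tight_functions[OF Polish, of "\<lambda>u. p (\<lambda>\<omega>. u (\<omega> t))" "\<epsilon> * w t"])
      fix h :: "nat \<Rightarrow> 'a \<Rightarrow> real"
      assume h: "\<And>n. h n \<in> Cb" "decreases_to h (\<lambda>_. 0)"
      then have "decreases_to (\<lambda>n \<omega>. h n (\<omega> t)) (\<lambda>_. 0)"
        by (simp add: decreases_to_def)
      then show "(\<lambda>n. p (\<lambda>\<omega>. h n (\<omega> t))) \<longlonglongrightarrow> 0"
        using that I(2) by (intro above_cyl[of "{t}"] cyl_coordinate h) auto
    next
      show "0 < \<epsilon> * w t" using \<epsilon> by (simp add: w_def)
    next
      fix K g
      assume "compact K" "\<And>j. g j \<in> Cb" "\<And>j x. 0 \<le> g j x" "\<And>x. x \<notin> K \<Longrightarrow> \<exists>j. g j x = 1"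
        "\<And>j. p (\<lambda>\<omega>. g j (\<omega> t)) \<le> (\<epsilon> * w t) * (1/2) ^ j"
      then have "R t K g" unfolding R_def by simp
      then show ?thesis by blast
    qed
    then obtain K0 g where R: "\<And>t. t \<in> I \<Longrightarrow> R t (K0 t) (g t)" by metis
    have K0: "\<And>t. t \<in> I \<Longrightarrow> compact (K0 t)"
      and g: "\<And>t j. t \<in> I \<Longrightarrow> g t j \<in> Cb" "\<And>t j x. t \<in> I \<Longrightarrow> 0 \<le> g t j x"
        "\<And>t j. t \<in> I \<Longrightarrow> p (\<lambda>\<omega>. g t j (\<omega> t)) \<le> (\<epsilon> * w t) * (1/2) ^ j"
        "\<And>t x. t \<in> I \<Longrightarrow> x \<notin> K0 t \<Longrightarrow> \<exists>j. g t j x = 1"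
      using R unfolding R_def by simp_all
    \<comment> \<open>a point is added to make the product nonempty\<close>
    define K where "K t = (if t \<in> I then insert undefined (K0 t) else {undefined})" for t
    define Q where "Q = {\<omega>. \<forall>t. \<omega> t \<in> K t}"
    have "compact (K t)" for t
      using K0 by (auto simp: K_def)
    then have "compactin (product_topology (\<lambda>_. euclidean) UNIV) (PiE UNIV K)"
      by (subst compactin_PiE) auto
    moreover have "PiE UNIV K = Q" by (auto simp: Q_def PiE_def)
    ultimately have "compact Q"
      by (simp add: euclidean_product_topology)
    have open_lt: "open {\<omega>. f n \<omega> < \<epsilon>}" for n
      using open_Collect_less[OF cylD(1)[OF J(1)] continuous_on_const, of n \<epsilon>] by simp
    have "Q \<subseteq> (\<Union>n. {\<omega>. f n \<omega> < \<epsilon>})"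
    proof
      fix \<omega>
      have "\<forall>\<^sub>F n in sequentially. f n \<omega> < \<epsilon>"
        by (rule order_tendstoD(2)[OF decreases_to_lim[OF dec] \<epsilon>])
      then show "\<omega> \<in> (\<Union>n. {\<omega>. f n \<omega> < \<epsilon>})" by (auto simp: eventually_sequentially)
    qed
    then obtain F where F: "finite F" "Q \<subseteq> (\<Union>n\<in>F. {\<omega>. f n \<omega> < \<epsilon>})"
      using compactE_image[OF \<open>compact Q\<close>, of UNIV "\<lambda>n. {\<omega>. f n \<omega> < \<epsilon>}"] open_lt by auto
    define n where "n = Max (insert 0 F)"
    have fQ: "f n \<omega> < \<epsilon>" if "\<omega> \<in> Q" for \<omega>
    proof -
      obtain m where "m \<in> F" "f m \<omega> < \<epsilon>" using F(2) \<open>\<omega> \<in> Q\<close> by blast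
      moreover have "m \<le> n" using \<open>m \<in> F\<close> F(1) by (simp add: n_def)
      ultimately show ?thesis
        using decseqD[OF decreases_to_decseq[OF dec], of m n \<omega>] by simp
    qed
    have Jn: "J n \<subseteq> I" by (auto simp: I_def)
    have alt: "f n \<omega> < \<epsilon> \<or> (\<exists>t\<in>J n. \<exists>j. g t j (\<omega> t) = 1)" for \<omega>
    proof (cases "\<forall>t\<in>J n. \<omega> t \<in> K0 t")
      case True
      define \<omega>' where "\<omega>' t = (if t \<in> J n then \<omega> t else undefined)" for t
      have "\<omega>' \<in> Q" using True Jn by (auto simp: Q_def K_def \<omega>'_def)
      moreover have "f n \<omega> = f n \<omega>'"
        by (rule depends_onD[OF cylD(2)[OF J(1)]]) (simp add: \<omega>'_def)
      ultimately show ?thesis using fQ by simp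
    next
      case False
      then show ?thesis using g(4) Jn by blast
    qed
    define G where "G N \<omega> = (\<Sum>t\<in>J n. \<Sum>j<N. g t j (\<omega> t))" for N \<omega>
    define h where "h N \<omega> = max 0 (f n \<omega> - (\<epsilon> + C * G N \<omega>))" for N \<omega>
    have g_cyl: "(\<lambda>\<omega>. g t j (\<omega> t)) \<in> cyl (J n)" if "t \<in> J n" for t j
      using cyl_coordinate[OF g(1), of t j t] cyl_mono[of "{t}" "J n"] that Jn by blast
    have G_cyl: "G N \<in> cyl (J n)" for N
      unfolding G_def by (intro cyl.sum g_cyl J(2)) auto
    have h_cyl: "h N \<in> cyl (J n)" for N
      unfolding h_def by (intro cyl_max cyl_const cyl.diff J(1) cyl_add cyl.cmult G_cyl)
    note in_Cyl = CylI[OF _ J(2)[of n] J(3)[of n]]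
    have "decreases_to h (\<lambda>_. 0)"
    proof (rule decreases_toI)
      fix N \<omega>
      have "G N \<omega> \<le> G (Suc N) \<omega>"
        unfolding G_def using g(2) Jn by (intro sum_mono) (auto simp: subset_iff)
      then have "C * G N \<omega> \<le> C * G (Suc N) \<omega>" using C0 by (rule mult_left_mono)
      then show "h (Suc N) \<omega> \<le> h N \<omega>" unfolding h_def by (intro max.mono) auto
    next
      fix \<omega>
      show "(\<lambda>N. h N \<omega>) \<longlonglongrightarrow> 0"
      proof (cases "f n \<omega> < \<epsilon>")
        case True
        have "h N \<omega> = 0" for N
        proof -
          have "0 \<le> G N \<omega>" unfolding G_def using g(2) Jn by (intro sum_nonneg) auto
          then have "0 \<le> C * G N \<omega>" using C0 by simp
          then show ?thesis using True by (simp add: h_def)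
        qed
        then show ?thesis by simp
      next
        case False
        then obtain t j where tj: "t \<in> J n" "g t j (\<omega> t) = 1" using alt by blast
        have "h N \<omega> = 0" if "N \<ge> Suc j" for N
        proof -
          have nn: "0 \<le> g t i (\<omega> t)" if "t \<in> J n" for t i using g(2) that Jn by blast
          have "1 \<le> (\<Sum>i<N. g t i (\<omega> t))"
            using member_le_sum[of j "{..<N}" "\<lambda>i. g t i (\<omega> t)"] that tj nn by simp
          also have "\<dots> \<le> G N \<omega>"
            unfolding G_def using tj(1) J(2) nn
            by (intro member_le_sum[of t "J n" "\<lambda>t. \<Sum>j<N. g t j (\<omega> t)"] sum_nonneg) auto
          finally have "C * 1 \<le> C * G N \<omega>" using C0 by (rule mult_left_mono)
          then show ?thesis using f_le[of n \<omega>] \<epsilon> by (simp add: h_def)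
        qed
        then show ?thesis
          by (intro tendsto_eventually eventually_sequentiallyI[of "Suc j"])
      qed
    qed
    then have "(\<lambda>N. p (h N)) \<longlonglongrightarrow> 0"
      by (rule above_cyl[OF J(2,3) h_cyl])
    from order_tendstoD(2)[OF this \<epsilon>] obtain N where N: "p (h N) < \<epsilon>"
      by (auto simp: eventually_sequentially)
    have "p (G N) \<le> 4 * \<epsilon>"
    proof -
      have geo: "(\<Sum>j<m. (1/2::real) ^ j) \<le> 2" for m
        by (simp add: geometric_sum)
      have "p (G N) \<le> (\<Sum>t\<in>J n. p (\<lambda>\<omega>. \<Sum>j<N. g t j (\<omega> t)))"
        unfolding G_def by (intro sub_sum J(2) Cyl.sum in_Cyl g_cyl) auto
      also have "\<dots> \<le> (\<Sum>t\<in>J n. \<Sum>j<N. p (\<lambda>\<omega>. g t j (\<omega> t)))"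
        by (intro sum_mono sub_sum in_Cyl g_cyl) auto
      also have "\<dots> \<le> (\<Sum>t\<in>J n. \<Sum>j<N. (\<epsilon> * w t) * (1/2) ^ j)"
        using g(3) Jn by (intro sum_mono) auto
      also have "\<dots> = \<epsilon> * ((\<Sum>t\<in>J n. w t) * (\<Sum>j<N. (1/2) ^ j))"
        unfolding sum_product by (simp add: sum_distrib_left mult.assoc)
      also have "\<dots> \<le> \<epsilon> * (2 * 2)"
      proof -
        have "(\<Sum>t\<in>J n. w t) = (\<Sum>k\<in>to_nat_on I ` J n. (1/2) ^ k)"
          unfolding w_def by (subst sum.reindex) (auto intro: inj_on_subset[OF inj_on_to_nat_on[OF I(1)] Jn])
        also have "\<dots> \<le> (\<Sum>k<Suc (Max (to_nat_on I ` J n)). (1/2) ^ k)"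
          using J(2) by (intro sum_mono2) (auto simp: less_Suc_eq_le)
        also have "\<dots> \<le> 2" by (rule geo)
        finally show ?thesis
          using \<epsilon> geo by (intro mult_left_mono mult_mono) (auto intro: sum_nonneg)
      qed
      finally show ?thesis by simp
    qed
    have "p (f n) \<le> p (\<lambda>\<omega>. (\<epsilon> + C * G N \<omega>) + h N \<omega>)"
      by (intro mono f Cyl.add const Cyl.cmult in_Cyl[OF G_cyl] in_Cyl[OF h_cyl]) (simp add: h_def)
    also have "\<dots> \<le> p (\<lambda>\<omega>. \<epsilon> + C * G N \<omega>) + p (h N)"
      by (intro sub_add Cyl.add const Cyl.cmult in_Cyl[OF G_cyl] in_Cyl[OF h_cyl])
    also have "p (\<lambda>\<omega>. \<epsilon> + C * G N \<omega>) \<le> p (\<lambda>_. \<epsilon>) + p (\<lambda>\<omega>. C * G N \<omega>)"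
      by (intro sub_add const Cyl.cmult in_Cyl[OF G_cyl])
    also have "p (\<lambda>\<omega>. C * G N \<omega>) = C * p (G N)"
      using C0 homogeneous[OF in_Cyl[OF G_cyl], of C N] by (cases "C = 0") (auto simp: p_const)
    finally have "p (f n) \<le> \<epsilon> + C * p (G N) + p (h N)" by (simp add: p_const)
    moreover have "C * p (G N) \<le> C * (4 * \<epsilon>)"
      using \<open>p (G N) \<le> 4 * \<epsilon>\<close> C0 by (rule mult_left_mono)
    ultimately show ?thesis using N by (intro exI[of _ n]) linarith
  qed
  show ?thesis
  proof (rule tendstoI)
    fix e :: real assume e: "e > 0"
    define \<epsilon> where "\<epsilon> = e / (4 * C + 3)"
    have pos: "4 * C + 3 > 0" using C0 by simp
    have \<epsilon>: "\<epsilon> > 0" "\<epsilon> * (4 * C + 3) = e"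
      using e pos by (auto simp: \<epsilon>_def)
    obtain n where n: "p (f n) \<le> \<epsilon> + C * (4 * \<epsilon>) + \<epsilon>" using small[OF \<epsilon>(1)] by blast
    have "\<epsilon> + C * (4 * \<epsilon>) + \<epsilon> < e"
      using \<epsilon> by (simp add: algebra_simps)
    then have "p (f m) < e" if "m \<ge> n" for m
      using n mono[OF f f decseqD[OF decreases_to_decseq[OF dec] that]] by simp
    then show "\<forall>\<^sub>F n in sequentially. dist (p (f n)) 0 < e"
      using p_ge by (auto simp: eventually_sequentially)
  qed
qed

end

section \<open>Dominated linear functionals\<close>

context function_space
begin

definition sublinear :: "(('a \<Rightarrow> real) \<Rightarrow> real) \<Rightarrow> bool" where
  "sublinear q \<longleftrightarrow> (\<forall>f\<in>D. \<forall>g\<in>D. q (\<lambda>x. f x + g x) \<le> q f + q g) \<and>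
     (\<forall>f\<in>D. \<forall>c>0. q (\<lambda>x. c * f x) = c * q f)"

lemma sublinearI:
  assumes "\<And>f g. f \<in> D \<Longrightarrow> g \<in> D \<Longrightarrow> q (\<lambda>x. f x + g x) \<le> q f + q g"
    and le: "\<And>f c. f \<in> D \<Longrightarrow> c > 0 \<Longrightarrow> q (\<lambda>x. c * f x) \<le> c * q f"
  shows "sublinear q"
proof -
  have "q (\<lambda>x. c * f x) = c * q f" if f: "f \<in> D" and c: "c > 0" for f c
  proof (rule antisym)
    have "q (\<lambda>x. (1/c) * (c * f x)) \<le> (1/c) * q (\<lambda>x. c * f x)"
      using c by (intro le cmult f) auto
    then show "c * q f \<le> q (\<lambda>x. c * f x)"
      using c by (simp add: field_simps)
  qed (rule le[OF that])
  then show ?thesis using assms(1) by (simp add: sublinear_def)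
qed

lemma
  assumes "sublinear q"
  shows sublinear_add: "f \<in> D \<Longrightarrow> g \<in> D \<Longrightarrow> q (\<lambda>x. f x + g x) \<le> q f + q g"
    and sublinear_cmult: "f \<in> D \<Longrightarrow> c > 0 \<Longrightarrow> q (\<lambda>x. c * f x) = c * q f"
    and sublinear_0: "q (\<lambda>_. 0) = 0"
    and sublinear_neg: "f \<in> D \<Longrightarrow> - q (\<lambda>x. - f x) \<le> q f"
proof -
  show add: "f \<in> D \<Longrightarrow> g \<in> D \<Longrightarrow> q (\<lambda>x. f x + g x) \<le> q f + q g" for f g
    using assms by (simp add: sublinear_def)
  show "f \<in> D \<Longrightarrow> c > 0 \<Longrightarrow> q (\<lambda>x. c * f x) = c * q f" for f c
    using assms by (simp add: sublinear_def)
  from this[of "\<lambda>_. 0" 2] show q0: "q (\<lambda>_. 0) = 0" by simp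
  show "- q (\<lambda>x. - f x) \<le> q f" if "f \<in> D"
    using add[OF that uminus[OF that]] q0 by simp
qed

text \<open>The greatest sublinear functional \<open>r \<le> q\<close> with \<open>r (- v) \<le> - q v\<close>.\<close>

definition shift :: "(('a \<Rightarrow> real) \<Rightarrow> real) \<Rightarrow> ('a \<Rightarrow> real) \<Rightarrow> ('a \<Rightarrow> real) \<Rightarrow> real" where
  "shift q v f = (INF c\<in>{0..}. q (\<lambda>x. f x + c * v x) - c * q v)"

lemma
  assumes q: "sublinear q" and v: "v \<in> D"
  shows shift_le: "f \<in> D \<Longrightarrow> shift q v f \<le> q f"
    and shift_neg: "shift q v (\<lambda>x. - v x) \<le> - q v"
    and sublinear_shift: "sublinear (shift q v)"
proof -
  have hom: "q (\<lambda>x. c * v x) = c * q v" if "c \<ge> 0" for c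
    using that sublinear_cmult[OF q v, of c] sublinear_0[OF q] by (cases "c = 0") auto
  have ge: "- q (\<lambda>x. - f x) \<le> q (\<lambda>x. f x + c * v x) - c * q v" if f: "f \<in> D" and c: "c \<ge> 0" for f c
    using sublinear_add[OF q add[OF f cmult[OF v]] uminus[OF f], of c] hom[OF c] by simp
  have bdd: "bdd_below ((\<lambda>c. q (\<lambda>x. f x + c * v x) - c * q v) ` {0..})" if "f \<in> D" for f
    using ge[OF that] by (intro bdd_belowI2[of _ "- q (\<lambda>x. - f x)"]) auto
  have le: "shift q v f \<le> q (\<lambda>x. f x + c * v x) - c * q v" if "f \<in> D" "c \<ge> 0" for f c
    unfolding shift_def using that by (intro cINF_lower bdd) auto
  have geI: "b \<le> shift q v f" if "\<And>c. c \<ge> 0 \<Longrightarrow> b \<le> q (\<lambda>x. f x + c * v x) - c * q v" for f b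
    unfolding shift_def using that by (intro cINF_greatest) auto
  show "shift q v f \<le> q f" if "f \<in> D" using le[OF that, of 0] by simp
  show "shift q v (\<lambda>x. - v x) \<le> - q v"
    using le[OF uminus[OF v], of 1] sublinear_0[OF q] by simp
  show "sublinear (shift q v)"
  proof (rule sublinearI)
    fix f g assume f: "f \<in> D" and g: "g \<in> D"
    have "shift q v (\<lambda>x. f x + g x) - (q (\<lambda>x. g x + d * v x) - d * q v) \<le> shift q v f" if d: "d \<ge> 0" for d
    proof (rule geI)
      fix c :: real assume c: "c \<ge> 0"
      have "shift q v (\<lambda>x. f x + g x) \<le> q (\<lambda>x. f x + g x + (c + d) * v x) - (c + d) * q v"
        using c d by (intro le add f g) auto
      moreover have "q (\<lambda>x. f x + g x + (c + d) * v x) \<le> q (\<lambda>x. f x + c * v x) + q (\<lambda>x. g x + d * v x)"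
        using sublinear_add[OF q add[OF f cmult[OF v]] add[OF g cmult[OF v]], of c d]
        by (simp add: algebra_simps)
      ultimately show "shift q v (\<lambda>x. f x + g x) - (q (\<lambda>x. g x + d * v x) - d * q v)
          \<le> q (\<lambda>x. f x + c * v x) - c * q v"
        by (simp add: algebra_simps)
    qed
    then have "shift q v (\<lambda>x. f x + g x) - shift q v f \<le> shift q v g"
      by (intro geI) (simp add: algebra_simps)
    then show "shift q v (\<lambda>x. f x + g x) \<le> shift q v f + shift q v g" by simp
  next
    fix f and a :: real assume f: "f \<in> D" and a: "a > 0"
    have "shift q v (\<lambda>x. a * f x) / a \<le> shift q v f"
    proof (rule geI)
      fix c :: real assume c: "c \<ge> 0"
      have "shift q v (\<lambda>x. a * f x) \<le> q (\<lambda>x. a * f x + (a * c) * v x) - (a * c) * q v"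
        using a c by (intro le cmult f) auto
      also have "q (\<lambda>x. a * f x + (a * c) * v x) = a * q (\<lambda>x. f x + c * v x)"
        using sublinear_cmult[OF q add[OF f cmult[OF v]] a, of c] by (simp add: algebra_simps)
      finally show "shift q v (\<lambda>x. a * f x) / a \<le> q (\<lambda>x. f x + c * v x) - c * q v"
        using a by (simp add: field_simps)
    qed
    then show "shift q v (\<lambda>x. a * f x) \<le> a * shift q v f"
      using a by (simp add: field_simps)
  qed
qed

text \<open>By Zorn's lemma. The pointwise infimum of a chain is finite because every \<open>q \<le> q0\<close> satisfies
  \<open>q f \<ge> - q (- f) \<ge> - q0 (- f)\<close>, and it is sublinear because any two members of the chain are
  comparable.\<close>

lemma minimal_sublinear:
  assumes q0: "sublinear q0"
  obtains q where "sublinear q" "\<And>f. f \<in> D \<Longrightarrow> q f \<le> q0 f"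
    "\<And>r f. sublinear r \<Longrightarrow> (\<And>f. f \<in> D \<Longrightarrow> r f \<le> q f) \<Longrightarrow> f \<in> D \<Longrightarrow> r f = q f"
proof -
  \<comment> \<open>values off \<open>D\<close> are fixed so that the pointwise order is antisymmetric\<close>
  define A where "A = {q. sublinear q \<and> (\<forall>f\<in>D. q f \<le> q0 f) \<and> (\<forall>f. f \<notin> D \<longrightarrow> q f = 0)}"
  define P where "P a b \<longleftrightarrow> (\<forall>f. b f \<le> a f)" for a b :: "('a \<Rightarrow> real) \<Rightarrow> real"
  have on: "(\<lambda>f. if f \<in> D then r f else 0) \<in> A" if "sublinear r" "\<And>f. f \<in> D \<Longrightarrow> r f \<le> q0 f" for r
    unfolding A_def sublinear_def using that by (auto simp: add cmult sublinear_add sublinear_cmult)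
  have "\<exists>m\<in>A. \<forall>a\<in>A. P m a \<longrightarrow> a = m"
  proof (rule predicate_Zorn)
    show "partial_order_on A (relation_of P A)"
      by (rule partial_order_on_relation_ofI) (auto simp: P_def fun_eq_iff intro: order_trans antisym)
    fix C assume "C \<in> Chains (relation_of P A)"
    then have C: "C \<subseteq> A" "\<And>a b. a \<in> C \<Longrightarrow> b \<in> C \<Longrightarrow> P a b \<or> P b a"
      unfolding Chains_def relation_of_def by auto
    show "\<exists>u\<in>A. \<forall>a\<in>C. P a u"
    proof (cases "C = {}")
      case True
      then show ?thesis using on[OF q0] by auto
    next
      case False
      define u where "u f = (INF q\<in>C. q f)" for f
      have sub: "sublinear q" "\<And>f. f \<in> D \<Longrightarrow> q f \<le> q0 f" "\<And>f. f \<notin> D \<Longrightarrow> q f = 0" if "q \<in> C" for q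
        using that C(1) by (auto simp: A_def)
      have bdd: "bdd_below ((\<lambda>q. q f) ` C)" for f
      proof (cases "f \<in> D")
        case True
        have "- q0 (\<lambda>x. - f x) \<le> q f" if "q \<in> C" for q
          using sublinear_neg[OF sub(1)[OF that] True] sub(2)[OF that uminus[OF True]] by linarith
        then show ?thesis by (rule bdd_belowI2)
      next
        case False
        have "0 \<le> q f" if "q \<in> C" for q
          using sub(3)[OF that False] by simp
        then show ?thesis by (rule bdd_belowI2)
      qed
      have le: "u f \<le> q f" if "q \<in> C" for q f
        unfolding u_def using that bdd by (rule cINF_lower[rotated])
      have geI: "b \<le> u f" if "\<And>q. q \<in> C \<Longrightarrow> b \<le> q f" for b f
        unfolding u_def using False that by (rule cINF_greatest)
      have "sublinear u"
      proof (rule sublinearI)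
        fix f g assume f: "f \<in> D" and g: "g \<in> D"
        have "u (\<lambda>x. f x + g x) \<le> q f + r g" if "q \<in> C" "r \<in> C" for q r
        proof -
          obtain s where s: "s \<in> C" "s f \<le> q f" "s g \<le> r g"
            using C(2)[OF \<open>q \<in> C\<close> \<open>r \<in> C\<close>] \<open>q \<in> C\<close> \<open>r \<in> C\<close> unfolding P_def by blast
          have "u (\<lambda>x. f x + g x) \<le> s (\<lambda>x. f x + g x)" by (rule le[OF s(1)])
          also have "\<dots> \<le> s f + s g" by (rule sublinear_add[OF sub(1)[OF s(1)] f g])
          finally show ?thesis using s by linarith
        qed
        then have "u (\<lambda>x. f x + g x) - r g \<le> u f" if "r \<in> C" for r
          using that by (intro geI) (simp add: algebra_simps)
        then have "u (\<lambda>x. f x + g x) - u f \<le> u g"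
          by (intro geI) (simp add: algebra_simps)
        then show "u (\<lambda>x. f x + g x) \<le> u f + u g" by simp
      next
        fix f and c :: real assume f: "f \<in> D" and c: "c > 0"
        have "u (\<lambda>x. c * f x) / c \<le> u f"
        proof (rule geI)
          fix q assume q: "q \<in> C"
          have "u (\<lambda>x. c * f x) \<le> c * q f"
            using le[OF q] sublinear_cmult[OF sub(1)[OF q] f c] by metis
          then show "u (\<lambda>x. c * f x) / c \<le> q f" using c by (simp add: field_simps)
        qed
        then show "u (\<lambda>x. c * f x) \<le> c * u f" using c by (simp add: field_simps)
      qed
      moreover have "u f \<le> q0 f" if "f \<in> D" for f
      proof -
        obtain q where "q \<in> C" using False by blast
        then show ?thesis using le sub(2) that by (meson order_trans)
      qed
      moreover have "u f = 0" if "f \<notin> D" for f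
      proof -
        obtain q where q: "q \<in> C" using False by blast
        have "0 \<le> u f" by (rule geI) (metis sub(3)[OF _ that] order_refl)
        then show ?thesis using le[OF q, of f] sub(3)[OF q that] by simp
      qed
      ultimately have "u \<in> A" by (simp add: A_def)
      then show ?thesis using le by (auto simp: P_def)
    qed
  qed
  then obtain m where m: "m \<in> A" "\<And>a. a \<in> A \<Longrightarrow> P m a \<Longrightarrow> a = m" by blast
  show thesis
  proof
    show "sublinear m" "\<And>f. f \<in> D \<Longrightarrow> m f \<le> q0 f" using m(1) by (auto simp: A_def)
    fix r f assume r: "sublinear r" "\<And>f. f \<in> D \<Longrightarrow> r f \<le> m f" and f: "f \<in> D"
    have "(\<lambda>f. if f \<in> D then r f else 0) = m"
    proof (rule m(2))
      show "(\<lambda>f. if f \<in> D then r f else 0) \<in> A"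
        using m(1) r by (intro on) (auto simp: A_def intro: order_trans)
      show "P m (\<lambda>f. if f \<in> D then r f else 0)"
        using m(1) r by (auto simp: A_def P_def)
    qed
    from fun_cong[OF this, of f] f show "r f = m f" by simp
  qed
qed

text \<open>A sublinear functional that is minimal below \<open>shift p v\<close> agrees with its own shift in every
  direction, hence is linear. This is the Hahn-Banach theorem in the form of a supporting functional
  at \<open>v\<close>.\<close>

lemma supporting_functional:
  assumes p: "sublinear p" and v: "v \<in> D"
  obtains l where "\<And>f g. f \<in> D \<Longrightarrow> g \<in> D \<Longrightarrow> l (\<lambda>x. f x + g x) = l f + l g"
    "\<And>f c. f \<in> D \<Longrightarrow> l (\<lambda>x. c * f x) = c * l f"
    "\<And>f. f \<in> D \<Longrightarrow> l f \<le> p f" "l v = p v"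
proof -
  obtain l where l: "sublinear l" "\<And>f. f \<in> D \<Longrightarrow> l f \<le> shift p v f"
    "\<And>r f. sublinear r \<Longrightarrow> (\<And>f. f \<in> D \<Longrightarrow> r f \<le> l f) \<Longrightarrow> f \<in> D \<Longrightarrow> r f = l f"
    using minimal_sublinear[OF sublinear_shift[OF p v]] by blast
  have neg: "l (\<lambda>x. - f x) = - l f" if f: "f \<in> D" for f
  proof -
    have "l (\<lambda>x. - f x) = shift l f (\<lambda>x. - f x)"
      using l(3)[OF sublinear_shift[OF l(1) f] shift_le[OF l(1) f] uminus[OF f]] by simp
    also have "\<dots> \<le> - l f" by (rule shift_neg[OF l(1) f])
    finally show ?thesis using sublinear_neg[OF l(1) f] by linarith
  qed
  show thesis
  proof
    fix f g assume f: "f \<in> D" and g: "g \<in> D"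
    have "l (\<lambda>x. - f x + - g x) \<le> l (\<lambda>x. - f x) + l (\<lambda>x. - g x)"
      by (rule sublinear_add[OF l(1) uminus[OF f] uminus[OF g]])
    then have "- l (\<lambda>x. f x + g x) \<le> - l f - l g"
      using neg[OF add[OF f g]] neg[OF f] neg[OF g] by simp
    then show "l (\<lambda>x. f x + g x) = l f + l g"
      using sublinear_add[OF l(1) f g] by linarith
  next
    fix f and c :: real assume f: "f \<in> D"
    consider "c > 0" | "c = 0" | "c < 0" by linarith
    then show "l (\<lambda>x. c * f x) = c * l f"
    proof cases
      case 1 then show ?thesis by (rule sublinear_cmult[OF l(1) f])
    next
      case 2 then show ?thesis by (simp add: sublinear_0[OF l(1)])
    next
      case 3
      then have "l (\<lambda>x. (- c) * f x) = - c * l f" by (intro sublinear_cmult[OF l(1) f]) simp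
      then show ?thesis using neg[OF cmult[OF f, of c]] by simp
    qed
  next
    show "l f \<le> p f" if "f \<in> D" for f
      using l(2)[OF that] shift_le[OF p v that] by linarith
    have "- l v \<le> - p v"
      using l(2)[OF uminus[OF v]] shift_neg[OF p v] neg[OF v] by linarith
    moreover have "l v \<le> p v" using l(2)[OF v] shift_le[OF p v v] by linarith
    ultimately show "l v = p v" by linarith
  qed
qed

end

lemma (in sublinear_functional) sublinear: "sublinear p"
  by (rule sublinearI) (auto simp: sub_add homogeneous)

section \<open>The Daniell integral\<close>

text \<open>An abstract integral on an algebra and lattice of bounded functions. Countable additivity of the
  measure comes from \<open>I_above\<close>.\<close>

locale daniell = function_space D for D :: "('w \<Rightarrow> real) set" +
  fixes I :: "('w \<Rightarrow> real) \<Rightarrow> real"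
  assumes D_mult: "f \<in> D \<Longrightarrow> g \<in> D \<Longrightarrow> (\<lambda>x. f x * g x) \<in> D"
    and D_max: "f \<in> D \<Longrightarrow> g \<in> D \<Longrightarrow> (\<lambda>x. max (f x) (g x)) \<in> D"
    and D_bounded: "f \<in> D \<Longrightarrow> \<exists>C. \<forall>x. \<bar>f x\<bar> \<le> C"
    and I_add: "f \<in> D \<Longrightarrow> g \<in> D \<Longrightarrow> I (\<lambda>x. f x + g x) = I f + I g"
    and I_cmult: "f \<in> D \<Longrightarrow> I (\<lambda>x. c * f x) = c * I f"
    and I_nonneg: "f \<in> D \<Longrightarrow> (\<And>x. 0 \<le> f x) \<Longrightarrow> 0 \<le> I f"
    and I_one: "I (\<lambda>_. 1) = 1"
    and I_above: "(\<And>n. h n \<in> D) \<Longrightarrow> decreases_to h (\<lambda>_. 0) \<Longrightarrow> (\<lambda>n. I (h n)) \<longlonglongrightarrow> 0"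
begin

lemma I_diff: "f \<in> D \<Longrightarrow> g \<in> D \<Longrightarrow> I (\<lambda>x. f x - g x) = I f - I g"
  using I_add[OF diff, of f g g] by simp

lemma I_mono: "f \<in> D \<Longrightarrow> g \<in> D \<Longrightarrow> (\<And>x. f x \<le> g x) \<Longrightarrow> I f \<le> I g"
  using I_nonneg[OF diff, of g f] I_diff[of g f] by simp

lemma I_const: "I (\<lambda>_. c) = c"
  using I_cmult[OF const, of c 1] I_one by simp

lemma I_sum: "finite J \<Longrightarrow> (\<And>i. i \<in> J \<Longrightarrow> f i \<in> D) \<Longrightarrow> I (\<lambda>x. \<Sum>i\<in>J. f i x) = (\<Sum>i\<in>J. I (f i))"
  by (induction J rule: finite_induct) (auto simp: I_const I_add sum)

lemma D_min1: "f \<in> D \<Longrightarrow> (\<lambda>x. min 1 (f x)) \<in> D"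
proof -
  assume f: "f \<in> D"
  have "(\<lambda>x. min 1 (f x)) = (\<lambda>x. - max (-1) (- f x))" by (auto simp: min_def max_def)
  then show ?thesis using uminus[OF D_max[OF const uminus[OF f]]] by simp
qed

text \<open>Sets are covered by countable sums of nonnegative functions, for which \<open>I\<close> is given, in place of
  countable unions of sets.\<close>

definition covers :: "(nat \<Rightarrow> 'w \<Rightarrow> real) \<Rightarrow> 'w set \<Rightarrow> bool" where
  "covers g A \<longleftrightarrow> (\<forall>n. g n \<in> D \<and> (\<forall>x. 0 \<le> g n x)) \<and> (\<forall>x\<in>A. 1 \<le> (\<Sum>n. ennreal (g n x)))"

definition outer :: "'w set \<Rightarrow> ennreal" where
  "outer A = (INF g\<in>{g. covers g A}. \<Sum>n. ennreal (I (g n)))"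

lemma outer_le: "covers g A \<Longrightarrow> outer A \<le> (\<Sum>n. ennreal (I (g n)))"
  unfolding outer_def by (intro INF_lower) simp

text \<open>The positive parts of \<open>f\<close> minus the partial sums decrease to zero.\<close>

lemma I_le_suminf:
  assumes f: "f \<in> D" and g: "\<And>n. g n \<in> D" "\<And>n x. 0 \<le> g n x"
    and le: "\<And>x. ennreal (f x) \<le> (\<Sum>n. ennreal (g n x))"
  shows "ennreal (I f) \<le> (\<Sum>n. ennreal (I (g n)))"
proof -
  define h where "h N x = max 0 (f x - (\<Sum>n<N. g n x))" for N x
  have sum_in: "(\<lambda>x. \<Sum>n<N. g n x) \<in> D" for N by (intro sum g) auto
  have h_in: "h N \<in> D" for N
    unfolding h_def by (intro D_max const diff f sum_in)
  have "decreases_to h (\<lambda>_. 0)"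
  proof (rule decreases_toI)
    show "h (Suc N) x \<le> h N x" for N x
      using g(2)[of N x] by (simp add: h_def max_def)
    show "(\<lambda>N. h N x) \<longlonglongrightarrow> 0" for x
    proof (rule tendstoI)
      fix e :: real assume e: "e > 0"
      have "\<forall>\<^sub>F N in sequentially. f x - (\<Sum>n<N. g n x) < e"
      proof (cases "f x < e")
        case True
        have "0 \<le> (\<Sum>n<N. g n x)" for N by (intro sum_nonneg g)
        then have "f x - (\<Sum>n<N. g n x) < e" for N
          using True by (metis diff_ge_0_iff_ge diff_left_mono diff_zero le_less_trans)
        then show ?thesis by simp
      next
        case False
        have "ennreal (f x - e) < ennreal (f x)" using False e by (intro ennreal_lessI) auto
        also have "\<dots> \<le> (\<Sum>n. ennreal (g n x))" by (rule le)
        finally have "\<forall>\<^sub>F N in sequentially. ennreal (f x - e) < (\<Sum>n<N. ennreal (g n x))"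
          by (rule order_tendstoD(1)[OF summable_LIMSEQ[OF summableI]])
        then show ?thesis
        proof eventually_elim
          case (elim N)
          then show ?case using False g(2) by (simp add: ennreal_less_iff)
        qed
      qed
      then show "\<forall>\<^sub>F N in sequentially. dist (h N x) 0 < e"
        using e by (auto elim!: eventually_mono simp: h_def)
    qed
  qed
  then have h0: "(\<lambda>N. I (h N)) \<longlonglongrightarrow> 0" by (rule I_above[OF h_in])
  show ?thesis
  proof (rule ennreal_le_epsilon)
    fix e :: real assume e: "e > 0"
    obtain N where N: "I (h N) < e"
      using order_tendstoD(2)[OF h0 e] by (auto simp: eventually_sequentially)
    have "I f \<le> I (\<lambda>x. (\<Sum>n<N. g n x) + h N x)"
      by (intro I_mono f add sum_in h_in) (simp add: h_def)
    also have "\<dots> = (\<Sum>n<N. I (g n)) + I (h N)"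
      using I_add[OF sum_in h_in] I_sum[of "{..<N}" g] g by simp
    finally have "I f \<le> (\<Sum>n<N. I (g n)) + e" using N by simp
    then have "ennreal (I f) \<le> ennreal ((\<Sum>n<N. I (g n)) + e)" by (rule ennreal_leI)
    also have "\<dots> = (\<Sum>n<N. ennreal (I (g n))) + ennreal e"
      using e g by (simp add: ennreal_plus sum_nonneg I_nonneg)
    also have "\<dots> \<le> (\<Sum>n. ennreal (I (g n))) + ennreal e"
      by (intro add_right_mono sum_le_suminf) auto
    finally show "ennreal (I f) \<le> (\<Sum>n. ennreal (I (g n))) + ennreal e" .
  qed
qed

lemma I_le_outer:
  assumes f: "f \<in> D" and le: "\<And>x. f x \<le> 1" and A: "\<And>x. x \<notin> A \<Longrightarrow> f x \<le> 0"
  shows "ennreal (I f) \<le> outer A"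
  unfolding outer_def
proof (rule INF_greatest)
  fix g assume "g \<in> {g. covers g A}"
  then have g: "\<And>n. g n \<in> D" "\<And>n x. 0 \<le> g n x" "\<And>x. x \<in> A \<Longrightarrow> 1 \<le> (\<Sum>n. ennreal (g n x))"
    by (auto simp: covers_def)
  have "ennreal (f x) \<le> (\<Sum>n. ennreal (g n x))" for x
  proof (cases "x \<in> A")
    case True
    have "ennreal (f x) \<le> 1" using le[of x] by (simp add: ennreal_le_1)
    then show ?thesis using g(3)[OF True] by (rule order_trans)
  next
    case False then show ?thesis using A[OF False] by (simp add: ennreal_neg)
  qed
  then show "ennreal (I f) \<le> (\<Sum>n. ennreal (I (g n)))"
    by (rule I_le_suminf[OF f g(1,2)])
qed

lemma outer_measure_outer: "outer_measure_space (Pow UNIV) outer"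
  unfolding outer_measure_space_def
proof (intro conjI)
  show "positive (Pow UNIV) outer"
  proof -
    have "covers (\<lambda>_ _. 0) {}" by (simp add: covers_def)
    from outer_le[OF this] show ?thesis by (simp add: positive_def I_const)
  qed
  show "increasing (Pow UNIV) outer"
    unfolding increasing_def outer_def by (auto intro!: INF_superset_mono simp: covers_def)
  show "countably_subadditive (Pow UNIV) outer"
    unfolding countably_subadditive_def
  proof (intro allI impI)
    fix A :: "nat \<Rightarrow> 'w set"
    show "outer (\<Union>i. A i) \<le> (\<Sum>i. outer (A i))"
    proof (rule ennreal_le_epsilon)
      fix e :: real assume fin: "(\<Sum>i. outer (A i)) < top" and e: "e > 0"
      have "\<exists>g. covers g (A i) \<and> (\<Sum>n. ennreal (I (g n))) \<le> outer (A i) + ennreal (e * (1/2) ^ Suc i)" for i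
      proof -
        have "outer (A i) < top"
          using fin ennreal_suminf_lessD by blast
        then have "outer (A i) < outer (A i) + ennreal (e * (1/2) ^ Suc i)"
          using e by (simp add: ennreal_zero_less_mult_iff)
        then obtain g where "covers g (A i)" "(\<Sum>n. ennreal (I (g n))) < outer (A i) + ennreal (e * (1/2) ^ Suc i)"
          unfolding outer_def[of "A i"] INF_less_iff by blast
        then show ?thesis by (blast intro: less_imp_le)
      qed
      then obtain g where g: "\<And>i. covers (g i) (A i)"
        "\<And>i. (\<Sum>n. ennreal (I (g i n))) \<le> outer (A i) + ennreal (e * (1/2) ^ Suc i)" by metis
      define G where "G k = case_prod g (prod_decode k)" for k
      have "covers G (\<Union>i. A i)"
        unfolding covers_def
      proof (intro conjI allI ballI)
        show "G k \<in> D" "0 \<le> G k x" for k x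
          using g(1) by (auto simp: G_def covers_def split: prod.split)
        fix x assume "x \<in> (\<Union>i. A i)"
        then obtain i where i: "x \<in> A i" by blast
        have "1 \<le> (\<Sum>n. ennreal (g i n x))" using g(1)[of i] i by (simp add: covers_def)
        also have "\<dots> \<le> (\<Sum>i. \<Sum>n. ennreal (g i n x))"
          using sum_le_suminf[of "\<lambda>i. \<Sum>n. ennreal (g i n x)" "{i}"] by simp
        also have "\<dots> = (\<Sum>k. ennreal (G k x))"
          using suminf_ennreal_2dimen[of "\<lambda>i. \<Sum>n. ennreal (g i n x)" "\<lambda>(i, n). ennreal (g i n x)"]
          by (simp add: G_def case_prod_unfold)
        finally show "1 \<le> (\<Sum>k. ennreal (G k x))" .
      qed
      then have "outer (\<Union>i. A i) \<le> (\<Sum>k. ennreal (I (G k)))" by (rule outer_le)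
      also have "\<dots> = (\<Sum>i. \<Sum>n. ennreal (I (g i n)))"
        using suminf_ennreal_2dimen[of "\<lambda>i. \<Sum>n. ennreal (I (g i n))" "\<lambda>(i, n). ennreal (I (g i n))"]
        by (simp add: G_def case_prod_unfold)
      also have "\<dots> \<le> (\<Sum>i. outer (A i) + ennreal (e * (1/2) ^ Suc i))"
        by (intro suminf_le g(2)) auto
      also have "\<dots> = (\<Sum>i. outer (A i)) + (\<Sum>i. ennreal (e * (1/2) ^ Suc i))"
        by (intro suminf_add[symmetric]) auto
      also have "(\<Sum>i. ennreal (e * (1/2) ^ Suc i)) = ennreal e"
        using e sums_mult[OF power_half_series, of e]
        by (intro suminf_ennreal_eq) auto
      finally show "outer (\<Union>i. A i) \<le> (\<Sum>i. outer (A i)) + ennreal e" .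
    qed
  qed
qed

text \<open>A cover of \<open>A\<close> is multiplied by an approximation \<open>k m\<close> of the indicator of \<open>{\<phi> > 0}\<close> and by
  \<open>1 - k m\<close>, which cuts it into covers of the two parts of \<open>A\<close>.\<close>

lemma outer_split:
  assumes \<phi>: "\<phi> \<in> D" "\<And>x. 0 \<le> \<phi> x"
  shows "outer (A \<inter> {x. 0 < \<phi> x}) + outer (A - {x. 0 < \<phi> x}) \<le> outer A"
  unfolding outer_def[of A]
proof (rule INF_greatest)
  fix g assume "g \<in> {g. covers g A}"
  then have g: "\<And>n. g n \<in> D" "\<And>n x. 0 \<le> g n x" "\<And>x. x \<in> A \<Longrightarrow> 1 \<le> (\<Sum>n. ennreal (g n x))"
    by (auto simp: covers_def)
  let ?G = "{x. 0 < \<phi> x}"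
  define k where "k m x = min 1 (real m * \<phi> x)" for m x
  have k_in: "k m \<in> D" for m unfolding k_def by (intro D_min1 cmult \<phi>)
  have k: "k 0 x = 0" "0 \<le> k m x" "k m x \<le> 1" "k m x \<le> k (Suc m) x" for m x
    using \<phi>(2)[of x] by (auto simp: k_def min_def algebra_simps)
  have k_lim: "(\<lambda>m. k m x) \<longlonglongrightarrow> 1" if x: "x \<in> ?G" for x
  proof -
    obtain N where N: "1 < real N * \<phi> x" using reals_Archimedean3 x by blast
    have "k m x = 1" if "m \<ge> N" for m
    proof -
      have "real N * \<phi> x \<le> real m * \<phi> x" using that \<phi>(2)[of x] by (intro mult_right_mono) auto
      then show ?thesis using N by (simp add: k_def)
    qed
    then show ?thesis by (intro tendsto_eventually eventually_sequentiallyI[of N])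
  qed
  define a where "a m n x = g n x * (k (Suc m) x - k m x)" for m n x
  have a: "a m n \<in> D" "0 \<le> a m n x" for m n x
    unfolding a_def using g(2) k by (auto intro!: D_mult diff k_in g(1))
  define b where "b i = case_prod a (prod_decode i)" for i
  have "covers b (A \<inter> ?G)"
    unfolding covers_def
  proof (intro conjI allI ballI)
    show "b i \<in> D" "0 \<le> b i x" for i x
      using a by (auto simp: b_def split: prod.split)
    fix x assume x: "x \<in> A \<inter> ?G"
    have "(\<lambda>m. k (Suc m) x - k m x) sums (1 - k 0 x)"
      using x by (intro telescope_sums k_lim) auto
    then have "(\<Sum>m. ennreal (k (Suc m) x - k m x)) = ennreal 1"
      using k by (intro suminf_ennreal_eq) simp_all
    then have tele: "(\<Sum>m. ennreal (k (Suc m) x - k m x)) = 1" by simp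
    have "1 \<le> (\<Sum>n. ennreal (g n x)) * (\<Sum>m. ennreal (k (Suc m) x - k m x))"
      using g(3) x tele by simp
    also have "\<dots> = (\<Sum>m. \<Sum>n. ennreal (a m n x))"
      unfolding a_def using g(2) k(4)
      by (simp add: ennreal_mult flip: ennreal_suminf_cmult ennreal_suminf_multc)
    also have "\<dots> = (\<Sum>i. ennreal (b i x))"
      using suminf_ennreal_2dimen[of "\<lambda>m. \<Sum>n. ennreal (a m n x)" "\<lambda>(m, n). ennreal (a m n x)"]
      by (simp add: b_def case_prod_unfold)
    finally show "1 \<le> (\<Sum>i. ennreal (b i x))" .
  qed
  then have "outer (A \<inter> ?G) \<le> (\<Sum>i. ennreal (I (b i)))" by (rule outer_le)
  also have "\<dots> = (\<Sum>m. \<Sum>n. ennreal (I (a m n)))"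
    using suminf_ennreal_2dimen[of "\<lambda>m. \<Sum>n. ennreal (I (a m n))" "\<lambda>(m, n). ennreal (I (a m n))"]
    by (simp add: b_def case_prod_unfold)
  finally have 1: "outer (A \<inter> ?G) \<le> (\<Sum>m. \<Sum>n. ennreal (I (a m n)))" .
  have "(\<Sum>m<M. \<Sum>n. ennreal (I (a m n))) + outer (A - ?G) \<le> (\<Sum>n. ennreal (I (g n)))" for M
  proof -
    define c where "c n x = g n x * (1 - k M x)" for n x
    have c: "c n \<in> D" "0 \<le> c n x" for n x
      unfolding c_def using g(2) k by (auto intro!: D_mult diff k_in g(1))
    have "covers c (A - ?G)"
      unfolding covers_def
    proof (intro conjI allI ballI c)
      fix x assume x: "x \<in> A - ?G"
      then have "\<phi> x = 0" using \<phi>(2)[of x] by auto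
      then have "c n x = g n x" for n by (simp add: c_def k_def)
      then show "1 \<le> (\<Sum>n. ennreal (c n x))" using g(3) x by simp
    qed
    then have "outer (A - ?G) \<le> (\<Sum>n. ennreal (I (c n)))" by (rule outer_le)
    moreover have "(\<Sum>m<M. \<Sum>n. ennreal (I (a m n))) = (\<Sum>n. \<Sum>m<M. ennreal (I (a m n)))"
      by (rule suminf_sum[symmetric]) simp
    ultimately have "(\<Sum>m<M. \<Sum>n. ennreal (I (a m n))) + outer (A - ?G)
        \<le> (\<Sum>n. \<Sum>m<M. ennreal (I (a m n))) + (\<Sum>n. ennreal (I (c n)))"
      by (simp add: add_left_mono)
    also have "\<dots> = (\<Sum>n. (\<Sum>m<M. ennreal (I (a m n))) + ennreal (I (c n)))"
      by (rule suminf_add) auto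
    also have "\<dots> = (\<Sum>n. ennreal (I (g n)))"
    proof (rule suminf_cong)
      fix n
      have "(\<Sum>m<M. k (Suc m) x - k m x) = k M x" for x
        using sum_lessThan_telescope[of "\<lambda>m. k m x" M] k(1) by simp
      then have "(\<Sum>m<M. a m n x) = g n x * k M x" for x
        unfolding a_def by (simp flip: sum_distrib_left)
      then have "(\<Sum>m<M. a m n x) + c n x = g n x" for x
        by (simp add: c_def right_diff_distrib)
      then have "I (\<lambda>x. (\<Sum>m<M. a m n x) + c n x) = I (g n)" by simp
      then have "(\<Sum>m<M. I (a m n)) + I (c n) = I (g n)"
        using I_add[OF sum c(1), of "{..<M}" "\<lambda>m. a m n" n] I_sum[of "{..<M}" "\<lambda>m. a m n"] a(1) by simp
      then show "(\<Sum>m<M. ennreal (I (a m n))) + ennreal (I (c n)) = ennreal (I (g n))"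
        using a c by (simp add: I_nonneg sum_nonneg flip: ennreal_plus)
    qed
    finally show ?thesis .
  qed
  then have "(\<Sum>m. \<Sum>n. ennreal (I (a m n))) + outer (A - ?G) \<le> (\<Sum>n. ennreal (I (g n)))"
    by (rule ennreal_suminf_bound_add)
  with 1 show "outer (A \<inter> ?G) + outer (A - ?G) \<le> (\<Sum>n. ennreal (I (g n)))"
    by (meson add_right_mono order_trans)
qed

definition level_sets :: "'w set set" where
  "level_sets = {{x. c < f x} |f c. f \<in> D}"

definition daniell_measure :: "'w measure" where
  "daniell_measure = measure_of UNIV level_sets outer"

abbreviation expec where "expec \<equiv> integral\<^sup>L daniell_measure"

lemma sets_daniell_measure: "sets daniell_measure = sigma_sets UNIV level_sets"
  and space_daniell_measure [simp]: "space daniell_measure = UNIV"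
  by (simp_all add: daniell_measure_def)

text \<open>By \<open>outer_split\<close> the level sets satisfy Caratheodory's criterion.\<close>

lemma emeasure_daniell_measure:
  assumes A: "A \<in> sets daniell_measure"
  shows "emeasure daniell_measure A = outer A"
proof -
  interpret P: sigma_algebra UNIV "Pow UNIV :: 'w set set" by (rule sigma_algebra_Pow)
  let ?L = "lambda_system UNIV (Pow UNIV) outer"
  note oms = outer_measure_outer
  have L: "measure_space UNIV ?L outer" by (rule P.caratheodory_lemma[OF oms])
  then have sigma_L: "sigma_algebra UNIV ?L" by (simp add: measure_space_def)
  have sub: "outer (A \<union> B) \<le> outer A + outer B" if "A \<inter> B = {}" for A B
    using P.countably_subadditive_subadditive[of outer] oms that
    unfolding outer_measure_space_def subadditive_def by auto
  have "level_sets \<subseteq> ?L"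
  proof
    fix G assume "G \<in> level_sets"
    then obtain f c where f: "f \<in> D" and G: "G = {x. c < f x}" by (auto simp: level_sets_def)
    let ?\<phi> = "\<lambda>x. max 0 (f x - c)"
    have \<phi>: "?\<phi> \<in> D" by (intro D_max const diff f)
    have G': "G = {x. 0 < ?\<phi> x}" by (auto simp: G)
    have "outer (A \<inter> G) + outer (A - G) = outer A" for A
    proof (rule antisym)
      show "outer (A \<inter> G) + outer (A - G) \<le> outer A"
        unfolding G' by (rule outer_split[OF \<phi>]) simp
      show "outer A \<le> outer (A \<inter> G) + outer (A - G)"
        using sub[of "A \<inter> G" "A - G"] by (simp add: Int_Diff_Un Int_Diff_disjoint)
    qed
    then show "G \<in> ?L" unfolding P.lambda_system_eq by simp
  qed
  then have sub_L: "sigma_sets UNIV level_sets \<subseteq> ?L"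
    by (rule sigma_algebra.sigma_sets_subset[OF sigma_L])
  have "measure_space UNIV (sigma_sets UNIV level_sets) outer"
    unfolding measure_space_def
  proof (intro conjI)
    show "sigma_algebra UNIV (sigma_sets UNIV level_sets)"
      by (rule sigma_algebra_sigma_sets) simp
    show "positive (sigma_sets UNIV level_sets) outer"
      using L by (simp add: measure_space_def positive_def)
    show "countably_additive (sigma_sets UNIV level_sets) outer"
      using L sub_L unfolding measure_space_def countably_additive_def by (meson subset_trans subsetD)
  qed
  then show ?thesis
    using A by (simp add: daniell_measure_def emeasure_measure_of_conv)
qed

lemma prob_space_daniell_measure: "prob_space daniell_measure"
proof
  have "ennreal (I (\<lambda>_. 1)) \<le> outer UNIV"
    by (rule I_le_outer) simp_all
  then have "1 \<le> outer UNIV" by (simp add: I_one)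
  moreover have "outer UNIV \<le> 1"
  proof -
    define g where "g n = (\<lambda>_::'w. if n = 0 then 1 else 0 :: real)" for n :: nat
    have "(\<Sum>n. ennreal (if n = 0 then 1 else 0)) = (\<Sum>n\<in>{0::nat}. ennreal (if n = 0 then 1 else 0))"
      by (rule suminf_finite) auto
    then have sum: "(\<Sum>n::nat. ennreal (if n = 0 then 1 else 0)) = 1" by simp
    have "covers g UNIV"
      unfolding covers_def g_def by (simp only: sum) simp
    moreover have "I (g n) = (if n = 0 then 1 else 0)" for n
      by (simp add: g_def I_const)
    ultimately show ?thesis using outer_le[of g UNIV] by (simp only: sum)
  qed
  ultimately show "emeasure daniell_measure (space daniell_measure) = 1"
    using emeasure_daniell_measure[of UNIV] sets.top[of daniell_measure] by simp
qed

lemma borel_measurable_D: "f \<in> D \<Longrightarrow> f \<in> borel_measurable daniell_measure"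
  by (rule borel_measurableI_greater)
    (auto simp: sets_daniell_measure level_sets_def intro!: sigma_sets.Basic)

lemma integrable_D: "f \<in> D \<Longrightarrow> integrable daniell_measure f"
proof -
  assume f: "f \<in> D"
  interpret prob_space daniell_measure by (rule prob_space_daniell_measure)
  obtain C where "\<And>x. \<bar>f x\<bar> \<le> C" using D_bounded[OF f] by blast
  then show ?thesis
    by (intro integrable_const_bound[where B=C] borel_measurable_D f) auto
qed

text \<open>A function with values in \<open>[0, 1]\<close> is cut into \<open>n\<close> slices of height \<open>1 / n\<close>. Each slice, scaled
  by \<open>n\<close>, is at most the indicator of a level set, which in turn is at most the scaled slice
  below it. This loses at most one slice.\<close>

lemma I_le_integral_unit:
  assumes f: "f \<in> D" and f01: "\<And>x. 0 \<le> f x" "\<And>x. f x \<le> 1"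
  shows "I f \<le> expec f"
proof -
  interpret P: prob_space daniell_measure by (rule prob_space_daniell_measure)
  have slices: "I f \<le> expec f + 1 / real n" if n: "n > 0" for n
  proof -
    define s where "s k x = max 0 (min 1 (real n * f x - real k))" for k x
    have s_in: "s k \<in> D" for k
      unfolding s_def by (intro D_max D_min1 const diff cmult f)
    have s_sum: "(\<Sum>k<m. s k x) = min (real m) (real n * f x)" for m x
      using f01(1)[of x] by (induction m) (auto simp: s_def min_def max_def)
    have s_sum_n: "(\<Sum>k<n. s k x) = real n * f x" for x
      using f01(2)[of x] n by (simp add: s_sum min_def)
    have meas: "{x. 0 < s k x} \<in> sets daniell_measure" for k
      using s_in[of k] unfolding sets_daniell_measure level_sets_def by (intro sigma_sets.Basic) blast
    have I_le: "I (s k) \<le> P.prob {x. 0 < s k x}" for k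
    proof -
      have "ennreal (I (s k)) \<le> outer {x. 0 < s k x}"
        by (rule I_le_outer[OF s_in]) (auto simp: s_def)
      then show ?thesis
        unfolding emeasure_daniell_measure[OF meas, symmetric] P.emeasure_eq_measure
        by (simp add: ennreal_le_iff)
    qed
    have prob_le: "P.prob {x. 0 < s (Suc k) x} \<le> expec (s k)" for k
    proof -
      have "P.prob {x. 0 < s (Suc k) x} = expec (indicator {x. 0 < s (Suc k) x})"
        using meas by simp
      also have "\<dots> \<le> expec (s k)"
      proof (rule integral_mono)
        show "integrable daniell_measure (indicator {x. 0 < s (Suc k) x} :: 'w \<Rightarrow> real)"
          using meas by (simp add: P.emeasure_eq_measure)
        show "indicator {x. 0 < s (Suc k) x} x \<le> s k x" for x
          by (auto simp: s_def indicator_def)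
      qed (rule integrable_D[OF s_in])
      finally show ?thesis .
    qed
    have int_nonneg: "0 \<le> expec (s k)" for k
      by (rule Bochner_Integration.integral_nonneg) (simp add: s_def)
    have "real n * I f = I (\<lambda>x. \<Sum>k<n. s k x)"
      by (simp add: s_sum_n I_cmult[OF f])
    also have "\<dots> = (\<Sum>k<n. I (s k))" by (intro I_sum s_in) simp
    also have "\<dots> = I (s 0) + (\<Sum>k<n - 1. I (s (Suc k)))"
      using n sum.lessThan_Suc_shift[of "\<lambda>k. I (s k)" "n - 1"] by simp
    also have "\<dots> \<le> 1 + (\<Sum>k<n - 1. expec (s k))"
      using order_trans[OF I_le P.prob_le_1] order_trans[OF I_le prob_le]
      by (intro add_mono sum_mono) auto
    also have "(\<Sum>k<n - 1. expec (s k)) \<le> (\<Sum>k<n. expec (s k))"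
      by (intro sum_mono2 int_nonneg) auto
    also have "(\<Sum>k<n. expec (s k)) = expec (\<lambda>x. real n * f x)"
      using Bochner_Integration.integral_sum[of "{..<n}" daniell_measure s] integrable_D[OF s_in]
      by (simp add: s_sum_n)
    finally have "real n * I f \<le> 1 + real n * expec f" by simp
    then show ?thesis using n by (simp add: field_simps)
  qed
  show ?thesis
  proof (rule field_le_epsilon)
    fix e :: real assume "e > 0"
    then obtain n where "1 / real (Suc n) < e"
      using reals_Archimedean[of e] by (auto simp: inverse_eq_divide)
    then show "I f \<le> expec f + e"
      using slices[of "Suc n"] by simp
  qed
qed

text \<open>An affine map turns the range of \<open>f\<close> into a subset of \<open>[0, 1]\<close>.\<close>

lemma I_le_integral:
  assumes f: "f \<in> D"
  shows "I f \<le> expec f"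
proof -
  interpret P: prob_space daniell_measure by (rule prob_space_daniell_measure)
  obtain C where C: "\<And>x. \<bar>f x\<bar> \<le> C" using D_bounded[OF f] by blast
  have C0: "0 \<le> C" using C[of undefined] by linarith
  define a where "a = 1 / (2 * C + 1)"
  have a: "a > 0" "a * (2 * C + 1) = 1" using C0 by (auto simp: a_def)
  define g where "g x = a * (f x + C)" for x
  have fC: "(\<lambda>x. f x + C) \<in> D" by (intro add f const)
  have g_in: "g \<in> D" unfolding g_def by (intro cmult fC)
  have g01: "0 \<le> g x" "g x \<le> 1" for x
  proof -
    have "0 \<le> f x + C" "f x + C \<le> 2 * C + 1" using C[of x] by linarith+
    then show "0 \<le> g x" "g x \<le> 1"
      using a mult_left_mono[of "f x + C" "2 * C + 1" a] by (simp_all add: g_def)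
  qed
  have "I g = a * (I f + C)"
    unfolding g_def using I_cmult[OF fC, of a] I_add[OF f const[of C]] by (simp add: I_const)
  moreover have "expec g = a * (expec f + C)"
    unfolding g_def using integrable_D[OF f] P.prob_space by simp
  ultimately have "a * (I f + C) \<le> a * (expec f + C)"
    using I_le_integral_unit[OF g_in g01] by simp
  then show ?thesis using a(1) by simp
qed

text \<open>The inequality for \<open>- f\<close> is the converse one.\<close>

lemma integral_daniell_measure: "f \<in> D \<Longrightarrow> expec f = I f"
  using I_le_integral[of f] I_le_integral[OF uminus, of f] I_cmult[of f "-1"] by simp

end

section \<open>The expectation of a cylinder function\<close>

context Cb_semigroup
begin

text \<open>A cylinder function does not determine its set of times, hence the choice; by \<open>path_op_consistent\<close>
  the result does not depend on it. Time \<open>0\<close> is added because the path starts at \<open>x\<close> at that time.\<close>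

definition path_exp :: "'a \<Rightarrow> ((real \<Rightarrow> 'a) \<Rightarrow> real) \<Rightarrow> real" where
  "path_exp x f =
     path_op T (times (insert 0 (SOME J. f \<in> cyl J \<and> finite J \<and> J \<subseteq> {0..}))) f (\<lambda>_. x)"

lemma path_exp_eq:
  assumes f: "f \<in> cyl J" and J: "finite J" "0 \<in> J" "J \<subseteq> {0..}"
  shows "path_exp x f = path_op T (times J) f (\<lambda>_. x)"
proof -
  define K where "K = insert 0 (SOME J. f \<in> cyl J \<and> finite J \<and> J \<subseteq> {0..})"
  have "f \<in> cyl (SOME J. f \<in> cyl J \<and> finite J \<and> J \<subseteq> {0..}) \<and>
      finite (SOME J. f \<in> cyl J \<and> finite J \<and> J \<subseteq> {0..}) \<and>
      (SOME J. f \<in> cyl J \<and> finite J \<and> J \<subseteq> {0..}) \<subseteq> {0..}"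
    by (rule someI[of _ J]) (use f J in blast)
  then have K: "f \<in> cyl K" "finite K" "0 \<in> K" "K \<subseteq> {0..}"
    using cyl_mono[of _ K] unfolding K_def by auto
  have "path_op T (times K) f = path_op T (times (K \<union> J)) f"
    by (rule path_op_consistent[symmetric]) (use K J in auto)
  also have "K \<union> J = J \<union> K" by auto
  also have "path_op T (times (J \<union> K)) f = path_op T (times J) f"
    by (rule path_op_consistent) (use K J f in auto)
  finally show ?thesis unfolding path_exp_def K_def[symmetric] by simp
qed

lemma path_op_times:
  assumes "finite J" "0 \<in> J" "J \<subseteq> {0..}"
  shows "sublinear_markov Cyl (path_op T (times J))" "continuous_from_above_op Cyl (path_op T (times J))"
  using path_op_markov[OF times_props(1)[OF assms]] times_props(2)[OF assms] by simp_all

end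

locale Polish_semigroup = Cb_semigroup T
    for T :: "real \<Rightarrow> ('a::{metric_space, second_countable_topology} \<Rightarrow> real) \<Rightarrow> 'a \<Rightarrow> real" +
  assumes Polish: "completely_metrizable_space (euclidean :: 'a topology)"
begin

sublocale path_exp: cylinder_functional "path_exp x" for x
proof
  fix f g :: "(real \<Rightarrow> 'a) \<Rightarrow> real" and c :: real
  assume f: "f \<in> Cyl"
  show "path_exp x (\<lambda>p. f p + g p) \<le> path_exp x f + path_exp x g"
    and "(\<And>p. f p \<le> g p) \<Longrightarrow> path_exp x f \<le> path_exp x g" if g: "g \<in> Cyl"
  proof -
    obtain J where J: "f \<in> cyl J" "g \<in> cyl J" "finite J" "J \<subseteq> {0..}"
      using f g by (rule Cyl_common)
    let ?J = "insert 0 J"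
    have J': "finite ?J" "0 \<in> ?J" "?J \<subseteq> {0..}" "f \<in> cyl ?J" "g \<in> cyl ?J"
      using J cyl_mono[of J ?J] by auto
    note eq = path_exp_eq[OF _ J'(1-3)]
    show "path_exp x (\<lambda>p. f p + g p) \<le> path_exp x f + path_exp x g"
      using sublinear_markov_add[OF path_op_times(1)[OF J'(1-3)] f g] J' by (simp add: eq cyl.add)
    show "path_exp x f \<le> path_exp x g" if "\<And>p. f p \<le> g p"
      using sublinear_markov_mono[OF path_op_times(1)[OF J'(1-3)] f g that] J' by (simp add: eq)
  qed
  show "path_exp x (\<lambda>p. c * f p) = c * path_exp x f" if c: "0 < c"
  proof -
    obtain J where J: "f \<in> cyl J" "finite J" "J \<subseteq> {0..}"
      using f by (rule CylE)
    let ?J = "insert 0 J"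
    have J': "finite ?J" "0 \<in> ?J" "?J \<subseteq> {0..}" "f \<in> cyl ?J"
      using J cyl_mono[of J ?J] by auto
    show ?thesis
      using sublinear_markov_cmult[OF path_op_times(1)[OF J'(1-3)] f c] J'
      by (simp add: path_exp_eq[OF _ J'(1-3)] cyl.cmult)
  qed
next
  show "path_exp x (\<lambda>_. c) = c" for c
    using path_exp_eq[OF cyl_const, of "{0}" x c] by simp
next
  fix J :: "real set" and f :: "nat \<Rightarrow> (real \<Rightarrow> 'a) \<Rightarrow> real"
  assume J: "finite J" "J \<subseteq> {0..}" and f: "\<And>n. f n \<in> cyl J" and dec: "decreases_to f (\<lambda>_. 0)"
  let ?J = "insert 0 J"
  have J': "finite ?J" "0 \<in> ?J" "?J \<subseteq> {0..}" "\<And>n. f n \<in> cyl ?J"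
    using J f cyl_mono[of J ?J] by auto
  show "(\<lambda>n. path_exp x (f n)) \<longlonglongrightarrow> 0"
    using decreases_to_lim[OF continuous_from_above_opD[OF path_op_times(2)[OF J'(1-3)] CylI[OF f J] dec]]
    by (simp add: path_exp_eq[OF J'(4) J'(1-3)])
qed (rule Polish)

text \<open>If \<open>s\<close> and \<open>t\<close> are the two largest times, then \<open>cond_op T s t\<close> is the operator that is applied
  first in the definition of the expectation.\<close>

lemma path_exp_cond_op:
  assumes f: "f \<in> cyl (insert t J)" and J: "finite J" "J \<subseteq> {0..s}" and st: "0 \<le> s" "s < t"
  shows "cond_op T s t f \<in> Cyl" "path_exp x (cond_op T s t f) = path_exp x f"
proof -
  let ?K = "insert 0 (insert s J)"
  have K: "finite ?K" "0 \<in> ?K" "?K \<subseteq> {0..}" using J st by auto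
  have "Max ?K = s" using J st by (intro Max_eqI) auto
  then have part: "?K \<in> partitions s" using K by (simp add: partitions_def)
  let ?xs = "times ?K"
  note xs = sorted_list_of_partition[OF part]
  have set_xs: "set ?xs = ?K" by (rule set_sorted_list_of_set[OF K(1)])
  have below: "r < t" if "r \<in> set ?xs" for r
    using that J st unfolding set_xs by auto
  have snoc: "increasing_list (?xs @ [t])" "hd (?xs @ [t]) = 0" "last (?xs @ [t]) = t"
    using xs(1,2) below by (auto simp: sorted_wrt_append hd_append simp del: sorted_list_of_set_insert_remove)
  have "set (?xs @ [t]) = insert t ?K" unfolding set_append set_xs by auto
  then have times: "times (insert t ?K) = ?xs @ [t]"
    using partition_of_list(2)[OF snoc] by (simp only:)
  have "cond_op T s t f \<in> cyl (insert s (insert t J - {t}))"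
    using J st by (intro cond_op_in_cyl[OF f]) auto
  then have c: "cond_op T s t f \<in> cyl ?K"
    using cyl_mono[of "insert s (insert t J - {t})" ?K] by auto
  then show "cond_op T s t f \<in> Cyl" by (rule CylI[OF _ K(1,3)])
  have f': "f \<in> cyl (insert t ?K)"
    using f cyl_mono[of "insert t J" "insert t ?K"] by auto
  have "path_exp x f = path_op T (?xs @ [t]) f (\<lambda>_. x)"
    unfolding times[symmetric] using K st by (intro path_exp_eq[OF f']) auto
  also have "\<dots> = path_op T ?xs (cond_op T s t f) (\<lambda>_. x)"
    using path_op_snoc[of ?xs t f] xs by simp
  also have "\<dots> = path_exp x (cond_op T s t f)"
    by (rule path_exp_eq[OF c K, symmetric])
  finally show "path_exp x (cond_op T s t f) = path_exp x f" ..
qed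

lemma path_exp_marginal:
  assumes u: "u \<in> Cb" and t: "t \<ge> 0"
  shows "path_exp x (\<lambda>p. u (p t)) = T t u x"
proof (cases "t = 0")
  case True
  then show ?thesis
    using path_exp_eq[OF cyl_coordinate[OF u, of 0], of x] by (simp add: zero[OF u])
next
  case False
  then have "0 < t" using t by simp
  let ?f = "\<lambda>p. u (p t)"
  have f: "?f \<in> cyl {t}" by (rule cyl_coordinate[OF u])
  have c: "cond_op T 0 t ?f \<in> cyl {0}"
    using cond_op_in_cyl[OF f, of 0 t] t by simp
  have "path_exp x ?f = path_exp x (cond_op T 0 t ?f)"
    using path_exp_cond_op(2)[of ?f t "{}" 0 x] f \<open>0 < t\<close> by simp
  also have "\<dots> = cond_op T 0 t ?f (\<lambda>_. x)"
    using path_exp_eq[OF c, of x] by simp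
  finally show ?thesis by (simp add: cond_op_def)
qed

section \<open>Representing measures\<close>

definition path_space :: "(real \<Rightarrow> 'a) measure" where
  "path_space = sigma UNIV {{p. c < f p} |f c. f \<in> Cyl}"

lemma space_path_space [simp]: "space path_space = UNIV"
  and sets_path_space: "sets path_space = sigma_sets UNIV {{p. c < f p} |f c. f \<in> Cyl}"
  by (simp_all add: path_space_def)

lemma coordinate_measurable:
  assumes "t \<ge> 0"
  shows "(\<lambda>p. p t) \<in> measurable path_space borel"
proof (rule borel_measurableI)
  fix U :: "'a set" assume "open U"
  then obtain \<phi> :: "'a \<Rightarrow> real" where \<phi>: "continuous_on UNIV \<phi>" "\<And>x. 0 \<le> \<phi> x" "\<And>x. 0 < \<phi> x \<longleftrightarrow> x \<in> U"
    using open_cozero by blast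
  define u where "u x = min 1 (\<phi> x)" for x
  have "u \<in> Cb"
    using \<phi>(2) by (intro CbI[of _ 1]) (auto simp: u_def intro!: continuous_intros \<phi>(1))
  then have "(\<lambda>p. u (p t)) \<in> Cyl"
    using assms by (intro CylI[OF cyl_coordinate]) auto
  then have "{p. 0 < u (p t)} \<in> sets path_space"
    unfolding sets_path_space
    by (intro sigma_sets.Basic CollectI exI[of _ "\<lambda>p. u (p t)"] exI[of _ 0] conjI refl)
  moreover have "{p. 0 < u (p t)} = (\<lambda>p. p t) -` U \<inter> space path_space"
    using \<phi>(3) by (auto simp: u_def)
  ultimately show "(\<lambda>p. p t) -` U \<inter> space path_space \<in> sets path_space" by simp
qed

text \<open>The measures whose finite-dimensional marginals are dominated by \<open>path_exp x\<close>.\<close>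

definition representing :: "'a \<Rightarrow> (real \<Rightarrow> 'a) measure set" where
  "representing x = {m. prob_space m \<and> sets m = sets path_space \<and>
     (\<forall>f\<in>Cyl. integral\<^sup>L m f \<le> path_exp x f)}"

text \<open>A linear functional supporting \<open>path_exp x\<close> at \<open>f\<close> inherits positivity and continuity from above
  and is therefore integration with respect to a probability measure.\<close>

lemma representing_attains:
  assumes f: "f \<in> Cyl"
  obtains m where "m \<in> representing x" "integral\<^sup>L m f = path_exp x f"
proof -
  obtain l where l: "\<And>f g. f \<in> Cyl \<Longrightarrow> g \<in> Cyl \<Longrightarrow> l (\<lambda>p. f p + g p) = l f + l g"
    "\<And>f c. f \<in> Cyl \<Longrightarrow> l (\<lambda>p. c * f p) = c * l f"
    "\<And>f. f \<in> Cyl \<Longrightarrow> l f \<le> path_exp x f" "l f = path_exp x f"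
    using Cyl.supporting_functional[OF path_exp.sublinear f] by blast
  have neg: "l (\<lambda>p. - g p) = - l g" if "g \<in> Cyl" for g
    using l(2)[OF that, of "-1"] by simp
  have nonneg: "0 \<le> l g" if g: "g \<in> Cyl" and "\<And>p. 0 \<le> g p" for g
  proof -
    have "- l g \<le> path_exp x (\<lambda>p. - g p)"
      using l(3)[OF Cyl.uminus[OF g]] neg[OF g] by simp
    also have "\<dots> \<le> path_exp x (\<lambda>_. 0)"
      using that by (intro path_exp.mono Cyl.uminus Cyl.const) auto
    finally show ?thesis by (simp add: path_exp.p_const)
  qed
  interpret I: daniell Cyl l
  proof
    show "l (\<lambda>_. 1) = 1"
      using l(3)[OF Cyl.const[of 1]] l(3)[OF Cyl.const[of "-1"]] neg[OF Cyl.const[of 1]]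
      by (simp add: path_exp.p_const)
    show "(\<lambda>n. l (h n)) \<longlonglongrightarrow> 0" if h: "\<And>n. h n \<in> Cyl" "decreases_to h (\<lambda>_. 0)" for h
    proof (rule tendsto_sandwich[OF _ _ tendsto_const path_exp.above[OF h, of x]])
      show "\<forall>\<^sub>F n in sequentially. 0 \<le> l (h n)"
        using nonneg[OF h(1) decreases_to_ge[OF h(2)]] by simp
      show "\<forall>\<^sub>F n in sequentially. l (h n) \<le> path_exp x (h n)"
        using l(3)[OF h(1)] by simp
    qed
  qed (use l nonneg in \<open>auto intro: Cyl_mult Cyl_max Cyl_bounded\<close>)
  have "sets I.daniell_measure = sets path_space"
    by (simp add: I.sets_daniell_measure I.level_sets_def sets_path_space)
  then have "I.daniell_measure \<in> representing x"
    unfolding representing_def using I.prob_space_daniell_measure I.integral_daniell_measure l(3) by simp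
  moreover have "I.expec f = path_exp x f"
    using I.integral_daniell_measure[OF f] l(4) by simp
  ultimately show thesis by (rule that)
qed

end

section \<open>Upper expectations\<close>

lemma bounded_integral:
  assumes p: "prob_space p" "sets p = sets \<Omega>" and X: "X \<in> L_infty \<Omega>"
  shows "integrable p X" "(\<And>\<omega>. \<omega> \<in> space \<Omega> \<Longrightarrow> \<bar>X \<omega>\<bar> \<le> C) \<Longrightarrow> \<bar>integral\<^sup>L p X\<bar> \<le> C"
proof -
  interpret prob_space p by fact
  have sp: "space p = space \<Omega>" using p(2) by (rule sets_eq_imp_space_eq)
  have meas: "X \<in> borel_measurable p"
    using X measurable_cong_sets[OF p(2) refl, of borel] by (auto simp: L_infty_def)
  obtain B where B: "\<And>\<omega>. \<omega> \<in> space \<Omega> \<Longrightarrow> \<bar>X \<omega>\<bar> \<le> B"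
    using X by (auto simp: L_infty_def bounded_iff)
  show int: "integrable p X"
    using B by (intro integrable_const_bound[where B=B] meas AE_I2) (simp add: sp)
  show "\<bar>integral\<^sup>L p X\<bar> \<le> C" if C: "\<And>\<omega>. \<omega> \<in> space \<Omega> \<Longrightarrow> \<bar>X \<omega>\<bar> \<le> C"
  proof -
    have "\<bar>integral\<^sup>L p X\<bar> \<le> (\<integral>\<omega>. \<bar>X \<omega>\<bar> \<partial>p)" by (rule integral_abs_bound)
    also have "\<dots> \<le> C"
      using C int by (intro integral_le_const AE_I2) (simp_all add: sp)
    finally show ?thesis .
  qed
qed

lemma sublinear_expectation_space_SUP:
  assumes ne: "P \<noteq> {}" and P: "\<And>p. p \<in> P \<Longrightarrow> prob_space p \<and> sets p = sets \<Omega>"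
  shows "sublinear_expectation_space \<Omega> (\<lambda>X. SUP p\<in>P. integral\<^sup>L p X)"
proof -
  let ?E = "\<lambda>X. SUP p\<in>P. integral\<^sup>L p X"
  note int = bounded_integral(1)[OF conjunct1[OF P] conjunct2[OF P]]
  have bdd: "bdd_above ((\<lambda>p. integral\<^sup>L p X) ` P)" if X: "X \<in> L_infty \<Omega>" for X
  proof -
    obtain B where B: "\<And>\<omega>. \<omega> \<in> space \<Omega> \<Longrightarrow> \<bar>X \<omega>\<bar> \<le> B"
      using X by (auto simp: L_infty_def bounded_iff)
    have "integral\<^sup>L p X \<le> B" if "p \<in> P" for p
      using bounded_integral(2)[OF _ _ X B] P[OF that] abs_le_D1 by blast
    then show ?thesis by (rule bdd_aboveI2)
  qed
  note upper = cSUP_upper[OF _ bdd]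
  have sp: "space p = space \<Omega>" if "p \<in> P" for p
    using P[OF that] sets_eq_imp_space_eq by blast
  have "sublinear_expectation \<Omega> ?E"
    unfolding sublinear_expectation_def
  proof (intro conjI ballI allI impI)
    fix X Y assume X: "X \<in> L_infty \<Omega>" and Y: "Y \<in> L_infty \<Omega>"
    show "?E (\<lambda>\<omega>. X \<omega> + Y \<omega>) \<le> ?E X + ?E Y"
    proof (rule cSUP_least[OF ne])
      fix p assume p: "p \<in> P"
      have "(\<integral>\<omega>. X \<omega> + Y \<omega> \<partial>p) = integral\<^sup>L p X + integral\<^sup>L p Y"
        by (intro Bochner_Integration.integral_add int p X Y)
      then show "(\<integral>\<omega>. X \<omega> + Y \<omega> \<partial>p) \<le> ?E X + ?E Y"
        using upper[OF p X] upper[OF p Y] by linarith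
    qed
    assume le: "\<forall>\<omega>\<in>space \<Omega>. X \<omega> \<le> Y \<omega>"
    show "?E X \<le> ?E Y"
    proof (rule cSUP_mono[OF ne bdd[OF Y]])
      fix p assume p: "p \<in> P"
      have "integral\<^sup>L p X \<le> integral\<^sup>L p Y"
        using le sp[OF p] by (intro integral_mono int p X Y) auto
      with p show "\<exists>q\<in>P. integral\<^sup>L p X \<le> integral\<^sup>L q Y" by blast
    qed
  next
    fix a :: real
    have "(\<integral>\<omega>. a \<partial>p) = a" if "p \<in> P" for p
      using P[OF that] by (simp add: prob_space.prob_space)
    then have "?E (\<lambda>_. a) = (SUP p\<in>P. a)" by (intro SUP_cong refl)
    then show "?E (\<lambda>_. a) = a" by (simp only: cSUP_const[OF ne])
  next
    fix X and c :: real assume X: "X \<in> L_infty \<Omega>" and c: "0 < c"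
    have le: "(\<integral>\<omega>. c * X \<omega> \<partial>p) \<le> c * ?E X" if "p \<in> P" for p
      using upper[OF that X] c by simp
    show "?E (\<lambda>\<omega>. c * X \<omega>) = c * ?E X"
    proof (rule antisym)
      show "?E (\<lambda>\<omega>. c * X \<omega>) \<le> c * ?E X" by (rule cSUP_least[OF ne le])
      have "bdd_above ((\<lambda>p. \<integral>\<omega>. c * X \<omega> \<partial>p) ` P)" using le by (rule bdd_aboveI2)
      then have "(\<integral>\<omega>. c * X \<omega> \<partial>p) \<le> ?E (\<lambda>\<omega>. c * X \<omega>)" if "p \<in> P" for p
        using that by (intro cSUP_upper)
      then have "integral\<^sup>L p X \<le> ?E (\<lambda>\<omega>. c * X \<omega>) / c" if "p \<in> P" for p
        using that c by (simp add: field_simps)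
      then have "?E X \<le> ?E (\<lambda>\<omega>. c * X \<omega>) / c" by (rule cSUP_least[OF ne])
      then show "c * ?E X \<le> ?E (\<lambda>\<omega>. c * X \<omega>)" using c by (simp add: field_simps)
    qed
  qed
  then show ?thesis
    unfolding sublinear_expectation_space_def using ne P by blast
qed

context Polish_semigroup
begin

definition upper_exp :: "'a \<Rightarrow> ((real \<Rightarrow> 'a) \<Rightarrow> real) \<Rightarrow> real" where
  "upper_exp x X = (SUP m\<in>representing x. integral\<^sup>L m X)"

lemma upper_exp_Cyl:
  assumes f: "f \<in> Cyl"
  shows "upper_exp x f = path_exp x f"
proof -
  obtain m where m: "m \<in> representing x" "integral\<^sup>L m f = path_exp x f"
    using f by (rule representing_attains)
  have "path_exp x f \<in> (\<lambda>m. integral\<^sup>L m f) ` representing x"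
    using m by (intro image_eqI[of _ _ m]) simp_all
  moreover have "integral\<^sup>L m f \<le> path_exp x f" if "m \<in> representing x" for m
    using that f by (simp add: representing_def)
  ultimately show ?thesis
    unfolding upper_exp_def by (intro cSup_eq_maximum) auto
qed

lemma sublinear_expectation_space_upper_exp: "sublinear_expectation_space path_space (upper_exp x)"
proof -
  obtain m where "m \<in> representing x"
    by (rule representing_attains[OF Cyl.const])
  then show ?thesis
    unfolding upper_exp_def[abs_def]
    by (intro sublinear_expectation_space_SUP) (auto simp: representing_def)
qed

end

section \<open>The process of a family of Feller semigroups\<close>

lemma Lip_b_subset_UC_kappa:
  assumes \<kappa>: "continuous_on UNIV \<kappa>" "bounded (range \<kappa>)"
  shows "Lip_b \<subseteq> UC_kappa \<kappa>"
proof
  fix u :: "'a \<Rightarrow> real" assume u: "u \<in> Lip_b"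
  obtain C where C: "\<And>x. \<bar>u x\<bar> \<le> C" using u by (rule Lip_bE) blast
  obtain B where B: "\<And>x. \<bar>\<kappa> x\<bar> \<le> B" using \<kappa>(2) by (auto simp: bounded_iff)
  have "kappa_norm \<kappa> u \<le> ereal (B * C)"
    unfolding kappa_norm_def sup_norm_def
    using B C by (intro SUP_least) (simp add: abs_mult mult_mono')
  then have "kappa_norm \<kappa> u < \<infinity>" by (rule order.strict_trans1) simp
  moreover have "continuous_on UNIV u" using u Lip_b_subset_Cb by (auto simp: Cb_def)
  moreover have "kappa_norm \<kappa> (\<lambda>x. u x - u x) < ereal \<epsilon>" if "\<epsilon> > 0" for \<epsilon>
    using that by (simp add: kappa_norm_def sup_norm_def)
  ultimately show "u \<in> UC_kappa \<kappa>"
    unfolding UC_kappa_def C_kappa_def using u by blast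
qed

text \<open>The infimum in the definition of \<open>lip_norm\<close> is attained.\<close>

lemma lipschitz_on_of_lip_norm:
  assumes "lip_norm u \<le> ereal L"
  shows "L-lipschitz_on UNIV u"
proof -
  have ex: "\<exists>K<L + e. K-lipschitz_on UNIV u" if "e > 0" for e
  proof -
    have "lip_norm u < ereal (L + e)" using assms that by (simp add: order.strict_trans1)
    then show ?thesis unfolding lip_norm_def Inf_less_iff by auto
  qed
  show ?thesis
  proof (rule lipschitz_onI)
    have "0 \<le> L + e" if "e > 0" for e
      using ex[OF that] lipschitz_on_nonneg by force
    then show "0 \<le> L" by (rule field_le_epsilon)
    fix x y
    show "dist (u x) (u y) \<le> L * dist x y"
    proof (cases "x = y")
      case False
      then have d: "dist x y > 0" by simp
      show ?thesis
      proof (rule field_le_epsilon)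
        fix e :: real assume "e > 0"
        then have "e / dist x y > 0" using d by simp
        then obtain K where K: "K < L + e / dist x y" "K-lipschitz_on UNIV u" using ex by blast
        have "dist (u x) (u y) \<le> K * dist x y" using K(2) by (auto intro: lipschitz_onD)
        also have "\<dots> \<le> (L + e / dist x y) * dist x y" using K(1) d by (intro mult_right_mono) auto
        also have "\<dots> = L * dist x y + e" using d by (simp add: field_simps)
        finally show "dist (u x) (u y) \<le> L * dist x y + e" .
      qed
    qed simp
  qed
qed

text \<open>Positivity and \<open>S l t 1 = 1\<close> make each \<open>S l t\<close> a contraction for the supremum norm, which together
  with the bound on Lipschitz constants keeps \<open>Lip_b\<close> invariant.\<close>

lemma markov_familyI:
  fixes \<kappa> :: "'a::{metric_space, second_countable_topology} \<Rightarrow> real"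
  assumes \<kappa>: "continuous_on UNIV \<kappa>" "bounded (range \<kappa>)" and ne: "\<Lambda> \<noteq> {}"
    and A1: "\<forall>l\<in>\<Lambda>. feller_semigroup \<kappa> (S l) \<and>
               (\<forall>t\<ge>0. linear_op (UC_kappa \<kappa>) (S l t) \<and> S l t (\<lambda>_. 1) = (\<lambda>_. 1))"
    and A2: "\<And>u l t. u \<in> Lip_b \<Longrightarrow> l \<in> \<Lambda> \<Longrightarrow> t \<ge> 0 \<Longrightarrow> lip_norm (S l t u) \<le> ereal (exp (\<beta> * t)) * lip_norm u"
  shows "markov_family \<Lambda> S \<beta>"
proof
  note UC = subsetD[OF Lip_b_subset_UC_kappa[OF \<kappa>]]
  show "\<Lambda> \<noteq> {}" by (rule ne)
  fix l assume l: "l \<in> \<Lambda>"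
  have F: "feller_semigroup \<kappa> (S l)" using A1 l by blast
  show "S l (s + t) u = S l s (S l t u)" if "0 \<le> s" "0 \<le> t" "u \<in> Lip_b" for s t u
    using F UC[OF that(3)] that unfolding feller_semigroup_def by blast
  fix t :: real assume t: "t \<ge> 0"
  have lin: "linear_op (UC_kappa \<kappa>) (S l t)" and one: "S l t (\<lambda>_. 1) = (\<lambda>_. 1)"
    using A1 l t by blast+
  have mono: "monotone_op (UC_kappa \<kappa>) (S l t)" using F t by (simp add: feller_semigroup_def)
  have S_add: "S l t (\<lambda>y. u y + v y) x = S l t u x + S l t v x" if "u \<in> Lip_b" "v \<in> Lip_b" for u v x
    using lin UC[OF that(1)] UC[OF that(2)] unfolding linear_op_def by blast
  have S_cmult: "S l t (\<lambda>y. c * u y) x = c * S l t u x" if "u \<in> Lip_b" for u c x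
    using lin UC[OF that] unfolding linear_op_def by blast
  have S_mono: "S l t u x \<le> S l t v x" if "u \<in> Lip_b" "v \<in> Lip_b" "\<And>y. u y \<le> v y" for u v x
    using mono UC[OF that(1)] UC[OF that(2)] that(3) unfolding monotone_op_def by blast
  have S_const: "S l t (\<lambda>_. c) x = c" for c x
    using S_cmult[OF Lip_b.const[of 1], of c x] one by simp
  show lip: "(exp (\<beta> * t) * L)-lipschitz_on UNIV (S l t u)" if u: "u \<in> Lip_b" "L-lipschitz_on UNIV u" for u L
  proof (rule lipschitz_on_of_lip_norm)
    have "lip_norm u \<le> ereal L" unfolding lip_norm_def using u(2) by (intro Inf_lower) simp
    then have "ereal (exp (\<beta> * t)) * lip_norm u \<le> ereal (exp (\<beta> * t)) * ereal L"
      by (rule ereal_mult_left_mono) simp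
    with A2[OF u(1) l t] show "lip_norm (S l t u) \<le> ereal (exp (\<beta> * t) * L)"
      by (simp add: order_trans)
  qed
  show "sublinear_markov Lip_b (S l t)"
  proof (rule Lip_b.sublinear_markovI)
    fix u :: "'a \<Rightarrow> real" assume u: "u \<in> Lip_b"
    obtain L C where L: "L-lipschitz_on UNIV u" and C: "\<And>x. \<bar>u x\<bar> \<le> C" using u by (rule Lip_bE) blast
    have bounds: "u y \<le> C" "- C \<le> u y" for y using C[of y] by linarith+
    have "\<bar>S l t u x\<bar> \<le> C" for x
      using S_mono[OF u Lip_b.const bounds(1), of x] S_mono[OF Lip_b.const u bounds(2), of x]
      unfolding S_const by linarith
    then show "S l t u \<in> Lip_b" by (rule Lip_bI[OF lip[OF u L]])
  qed (simp_all add: S_add S_cmult S_const S_mono)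
qed

lemma Cb_power_cylinder:
  assumes v: "v \<in> Cb_power (n + 1)"
  shows "(\<lambda>p. v (\<lambda>i\<in>{1..n + 1}. if i \<le> n then p (\<tau> i) else p t)) \<in> cyl (insert t (\<tau> ` {1..n}))"
    (is "?f \<in> _")
proof -
  let ?r = "\<lambda>p. \<lambda>i\<in>{1..n + 1}. if i \<le> n then p (\<tau> i) else p t"
  let ?X = "product_topology (\<lambda>_. euclidean) {1..n + 1}"
  have r: "continuous_map euclidean ?X ?r"
    unfolding continuous_map_componentwise
  proof (intro conjI ballI)
    show "?r ` topspace euclidean \<subseteq> extensional {1..n + 1}" by auto
    fix k assume k: "k \<in> {1..n + 1}"
    have "continuous_on UNIV (\<lambda>p. if k \<le> n then p (\<tau> k) else p t)"
      by (cases "k \<le> n") simp_all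
    then show "continuous_map euclidean euclidean (\<lambda>p. ?r p k)"
      using k by simp
  qed
  have "continuous_map ?X euclideanreal v" using v by (simp add: Cb_power_def)
  from continuous_map_compose[OF r this] have "continuous_on UNIV ?f"
    by (simp add: o_def)
  moreover obtain C where C: "\<And>z. z \<in> {1..n + 1} \<rightarrow>\<^sub>E UNIV \<Longrightarrow> \<bar>v z\<bar> \<le> C"
    using v by (auto simp: Cb_power_def bounded_iff)
  have "\<bar>?f p\<bar> \<le> C" for p by (rule C) simp
  moreover have "depends_on ?f (insert t (\<tau> ` {1..n}))"
    unfolding depends_on_def
  proof (intro allI impI)
    fix p p' :: "real \<Rightarrow> 'a" assume eq: "\<forall>s\<in>insert t (\<tau> ` {1..n}). p s = p' s"
    have "?r p = ?r p'" using eq by (intro restrict_ext) auto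
    then show "?f p = ?f p'" by simp
  qed
  ultimately show ?thesis by (intro cylI)
qed

theorem theorem5p5:
  fixes \<kappa> :: "'a::{metric_space, second_countable_topology} \<Rightarrow> real"
    and \<Lambda> :: "'l set"
    and S :: "'l \<Rightarrow> real \<Rightarrow> ('a \<Rightarrow> real) \<Rightarrow> 'a \<Rightarrow> real"
    and \<alpha> \<beta> :: real
  assumes kappa: "continuous_on UNIV \<kappa>" "\<forall>x. \<kappa> x > 0" "bounded (range \<kappa>)"
    and Lambda: "\<Lambda> \<noteq> {}"
    and A1: "\<forall>l\<in>\<Lambda>. feller_semigroup \<kappa> (S l) \<and>
               (\<forall>t\<ge>0. linear_op (UC_kappa \<kappa>) (S l t) \<and> S l t (\<lambda>_. 1) = (\<lambda>_. 1))"
    and A2: "\<forall>u\<in>Lip_b. \<forall>l\<in>\<Lambda>. \<forall>t\<ge>0.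
               kappa_norm \<kappa> (S l t u) \<le> ereal (exp (\<alpha> * t)) * kappa_norm \<kappa> u \<and>
               lip_norm (S l t u) \<le> ereal (exp (\<beta> * t)) * lip_norm u"
    and Polish: "completely_metrizable_space (euclidean :: 'a topology)"
    and above: "continuous_from_above Lip_b (envelope \<Lambda> S)"
  shows "\<exists>(\<Omega> :: (real \<Rightarrow> 'a) measure) (E :: 'a \<Rightarrow> ((real \<Rightarrow> 'a) \<Rightarrow> real) \<Rightarrow> real)
            (X :: real \<Rightarrow> (real \<Rightarrow> 'a) \<Rightarrow> 'a).
     (\<forall>t\<ge>0. X t \<in> measurable \<Omega> borel) \<and>
     (\<forall>x. sublinear_expectation_space \<Omega> (E x) \<and> (\<forall>u\<in>Cb. E x (\<lambda>\<omega>. u (X 0 \<omega>)) = u x)) \<and>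
     (\<forall>x s t. \<forall>n\<ge>1. \<forall>\<tau> :: nat \<Rightarrow> real. \<forall>v\<in>Cb_power (n + 1).
        0 \<le> s \<and> s < t \<and> 0 \<le> \<tau> 1 \<and> strict_mono_on {1..n} \<tau> \<and> \<tau> n \<le> s \<longrightarrow>
        E x (\<lambda>\<omega>. v (\<lambda>i\<in>{1..n + 1}. if i \<le> n then X (\<tau> i) \<omega> else X t \<omega>)) =
        E x (\<lambda>\<omega>. Cb_extension (envelope \<Lambda> S (t - s))
                    (\<lambda>y. v (\<lambda>i\<in>{1..n + 1}. if i \<le> n then X (\<tau> i) \<omega> else y)) (X s \<omega>))) \<and>
     (\<forall>t\<ge>0. \<forall>x. \<forall>u\<in>Cb. Cb_extension (envelope \<Lambda> S t) u x = E x (\<lambda>\<omega>. u (X t \<omega>)))"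
proof -
  let ?T = "\<lambda>t. Cb_extension (envelope \<Lambda> S t)"
  interpret F: markov_family \<Lambda> S \<beta>
    by (rule markov_familyI[OF kappa(1,3) Lambda A1]) (use A2 in blast)
  interpret Cb_semigroup ?T
    by (rule F.Cb_semigroup_envelope[OF above])
  interpret Polish_semigroup ?T
    by unfold_locales (rule Polish)
  let ?X = "\<lambda>t p. p t :: 'a"
  have marginal: "upper_exp x (\<lambda>p. u (p t)) = ?T t u x" if "u \<in> Cb" "t \<ge> 0" for u t x
    using that by (simp add: upper_exp_Cyl CylI[OF cyl_coordinate] path_exp_marginal)
  have markov: "upper_exp x (\<lambda>p. v (\<lambda>i\<in>{1..n + 1}. if i \<le> n then p (\<tau> i) else p t)) =
      upper_exp x (\<lambda>p. ?T (t - s) (\<lambda>y. v (\<lambda>i\<in>{1..n + 1}. if i \<le> n then p (\<tau> i) else y)) (p s))"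
    if v: "v \<in> Cb_power (n + 1)" and st: "0 \<le> s" "s < t"
      and \<tau>: "0 \<le> \<tau> 1" "strict_mono_on {1..n} \<tau>" "\<tau> n \<le> s"
    for x s t n v and \<tau> :: "nat \<Rightarrow> real"
  proof -
    let ?f = "\<lambda>p. v (\<lambda>i\<in>{1..n + 1}. if i \<le> n then p (\<tau> i) else p t)"
    note f = Cb_power_cylinder[OF v, of \<tau> t]
    have \<tau>_in: "\<tau> i \<in> {0..s}" if "i \<in> {1..n}" for i
    proof -
      have "\<tau> 1 \<le> \<tau> i" "\<tau> i \<le> \<tau> n"
        using that strict_mono_on_leD[OF \<tau>(2)] by auto
      then show ?thesis using \<tau> by auto
    qed
    have J: "finite (\<tau> ` {1..n})" "\<tau> ` {1..n} \<subseteq> {0..s}" using \<tau>_in by auto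
    \<comment> \<open>the times \<open>\<tau> i\<close> are at most \<open>s\<close>, so moving the path at time \<open>t\<close> leaves them alone\<close>
    have cond: "cond_op ?T s t ?f =
        (\<lambda>p. ?T (t - s) (\<lambda>y. v (\<lambda>i\<in>{1..n + 1}. if i \<le> n then p (\<tau> i) else y)) (p s))"
    proof
      fix p :: "real \<Rightarrow> 'a"
      have "(\<lambda>i\<in>{1..n + 1}. if i \<le> n then (p(t := y)) (\<tau> i) else (p(t := y)) t) =
          (\<lambda>i\<in>{1..n + 1}. if i \<le> n then p (\<tau> i) else y)" for y
      proof (rule restrict_ext)
        fix i assume "i \<in> {1..n + 1}"
        then have "\<tau> i \<noteq> t" if "i \<le> n" using \<tau>_in[of i] that st by auto
        then show "(if i \<le> n then (p(t := y)) (\<tau> i) else (p(t := y)) t) = (if i \<le> n then p (\<tau> i) else y)"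
          by auto
      qed
      then show "cond_op ?T s t ?f p =
          ?T (t - s) (\<lambda>y. v (\<lambda>i\<in>{1..n + 1}. if i \<le> n then p (\<tau> i) else y)) (p s)"
        unfolding cond_op_def by (simp only:)
    qed
    have "?f \<in> Cyl" using J st by (intro CylI[OF f]) auto
    then show ?thesis
      unfolding cond[symmetric] using path_exp_cond_op[OF f J st] by (simp only: upper_exp_Cyl)
  qed
  show ?thesis
  proof (intro exI[of _ path_space] exI[of _ upper_exp] exI[of _ ?X] conjI allI impI ballI)
    show "?X t \<in> measurable path_space borel" if "0 \<le> t" for t
      by (rule coordinate_measurable[OF that])
    show "sublinear_expectation_space path_space (upper_exp x)" for x
      by (rule sublinear_expectation_space_upper_exp)
    show "upper_exp x (\<lambda>p. u (p 0)) = u x" if "u \<in> Cb" for x u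
      using marginal[OF that, of 0 x] zero[OF that] by simp
    show "?T t u x = upper_exp x (\<lambda>p. u (p t))" if "0 \<le> t" "u \<in> Cb" for t x u
      using marginal[OF that(2,1)] by simp
  qed (elim conjE, rule markov)
qed

end
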